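(* Let $G$ be a locally compact second countable group which is abelian (or compact), let $H\subseteq G$ be a normal closed subgroup, let $q:G\to G/H$ be the quotient map, and let $E\subseteq G/H$ be a closed set. If $q^{-1}(E)$ is an $M_0$-set (in $G$), then $E$ is an $M_0$-set (in $G/H$).
   Context: Topological groups are assumed Hausdorff. For a locally compact group $G$, $M(G)$ is the Banach algebra (under convolution) of complex Borel measures on $G$; for a closed set $E\subseteq G$, $M(E)\subseteq M(G)$ is the set of measures with support contained in $E$. $L^p(G)$ is taken with respect to Haar measure. For $\mu\in M(G)$ the operator $\lambda(\mu)$ on $L^2(G)$ is $\lambda(\mu)\xi(g)=\int_G\xi(s^{-1}g)\,d\mu(s)$; $L^1(G)$ is identified with a closed ideal of $M(G)$. The reduced group $C^*$-algebra is $C_r^*(G)=\overline{\{\lambda(f): f\in L^1(G)\}}^{\|\cdot\|}\subseteq\mathcal{L}(L^2(G))$. A closed set $E\subseteq G$ is a set of extended uniqueness if $\lambda(M(E))\cap C_r^*(G)=\{0\}$; otherwise it is called a set of restricted multiplicity, or an $M_0$-set. *)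

theory Defs
  imports "HOL-Analysis.Analysis" "HOL-Algebra.Coset"
begin

section \<open>Topological groups and quotients\<close>

definition topological_group :: "('a, 'b) monoid_scheme \<Rightarrow> 'a topology \<Rightarrow> bool" where
  "topological_group G T \<longleftrightarrow>
     group G \<and> topspace T = carrier G \<and> Hausdorff_space T \<and>
     continuous_map (prod_topology T T) T (\<lambda>(x, y). x \<otimes>\<^bsub>G\<^esub> y) \<and>
     continuous_map T T (\<lambda>x. inv\<^bsub>G\<^esub> x)"

definition locally_compact_group :: "('a, 'b) monoid_scheme \<Rightarrow> 'a topology \<Rightarrow> bool" where
  "locally_compact_group G T \<longleftrightarrow> topological_group G T \<and> locally_compact_space T"

text \<open>The finest topology on \<open>G Mod H\<close> making the canonical map \<open>x \<mapsto> H #> x\<close> continuous.\<close>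

definition coset_topology :: "('a, 'b) monoid_scheme \<Rightarrow> 'a topology \<Rightarrow> 'a set \<Rightarrow> 'a set topology" where
  "coset_topology G T H =
     topology (\<lambda>U. U \<subseteq> carrier (G Mod H) \<and> openin T {x \<in> topspace T. H #>\<^bsub>G\<^esub> x \<in> U})"

lemma openin_coset_topology:
  "openin (coset_topology G T H) U \<longleftrightarrow>
     U \<subseteq> carrier (G Mod H) \<and> openin T {x \<in> topspace T. H #>\<^bsub>G\<^esub> x \<in> U}"
proof -
  let ?P = "\<lambda>U. U \<subseteq> carrier (G Mod H) \<and> openin T {x \<in> topspace T. H #>\<^bsub>G\<^esub> x \<in> U}"
  have "?P (A \<inter> B)" if "?P A" "?P B" for A B
  proof -
    have "{x \<in> topspace T. H #>\<^bsub>G\<^esub> x \<in> A \<inter> B} =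
        {x \<in> topspace T. H #>\<^bsub>G\<^esub> x \<in> A} \<inter> {x \<in> topspace T. H #>\<^bsub>G\<^esub> x \<in> B}" by blast
    with that show ?thesis by auto
  qed
  moreover have "?P (\<Union>\<K>)" if "\<forall>K\<in>\<K>. ?P K" for \<K>
  proof -
    have "{x \<in> topspace T. H #>\<^bsub>G\<^esub> x \<in> \<Union>\<K>} =
        (\<Union>K\<in>\<K>. {x \<in> topspace T. H #>\<^bsub>G\<^esub> x \<in> K})" by blast
    with that show ?thesis by auto
  qed
  ultimately have "istopology ?P" unfolding istopology_def by blast
  then show ?thesis by (simp add: coset_topology_def topology_inverse')
qed

lemma topspace_coset_topology:
  assumes "topspace T = carrier G"
  shows "topspace (coset_topology G T H) = carrier (G Mod H)"
proof -
  have "{x \<in> topspace T. H #>\<^bsub>G\<^esub> x \<in> carrier (G Mod H)} = topspace T"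
    using assms by (auto simp: carrier_FactGroup)
  then have "openin (coset_topology G T H) (carrier (G Mod H))"
    by (simp add: openin_coset_topology)
  moreover have "topspace (coset_topology G T H) \<subseteq> carrier (G Mod H)"
    by (auto simp: topspace_def openin_coset_topology)
  ultimately show ?thesis by (meson openin_subset subset_antisym)
qed

lemma quotient_map_coset_topology:
  assumes "topspace T = carrier G"
  shows "quotient_map T (coset_topology G T H) (\<lambda>x. H #>\<^bsub>G\<^esub> x)"
  unfolding quotient_map_def topspace_coset_topology[OF assms] openin_coset_topology
  using assms by (auto simp: carrier_FactGroup)


section \<open>Complex Borel measures\<close>

definition borel_of :: "'a topology \<Rightarrow> 'a measure" where
  "borel_of T = sigma (topspace T) {U. openin T U}"

text \<open>Complex measures are set functions on the \<open>\<sigma>\<close>-algebra of \<open>M\<close> (only \<open>space M\<close> and \<open>sets M\<close>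
  matter), with value \<open>0\<close> outside it so that equal measures are equal functions.\<close>

definition complex_measure :: "'a measure \<Rightarrow> ('a set \<Rightarrow> complex) \<Rightarrow> bool" where
  "complex_measure M \<mu> \<longleftrightarrow>
     (\<forall>A::nat \<Rightarrow> 'a set. range A \<subseteq> sets M \<longrightarrow> disjoint_family A \<longrightarrow>
        (\<lambda>i. \<mu> (A i)) sums \<mu> (\<Union>i. A i)) \<and>
     (\<forall>A. A \<notin> sets M \<longrightarrow> \<mu> A = 0)"

definition total_variation :: "'a measure \<Rightarrow> ('a set \<Rightarrow> complex) \<Rightarrow> 'a set \<Rightarrow> ennreal" where
  "total_variation M \<mu> A =
     (SUP P\<in>{P. finite P \<and> disjoint P \<and> P \<subseteq> sets M \<and> \<Union>P = A}. \<Sum>B\<in>P. ennreal (cmod (\<mu> B)))"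

definition measure_support :: "'a topology \<Rightarrow> ('a set \<Rightarrow> complex) \<Rightarrow> 'a set" where
  "measure_support T \<mu> =
     {x \<in> topspace T. \<forall>U. openin T U \<and> x \<in> U \<longrightarrow> total_variation (borel_of T) \<mu> U > 0}"

text \<open>The space \<open>M(E)\<close>.\<close>

definition measures_on :: "'a topology \<Rightarrow> 'a set \<Rightarrow> ('a set \<Rightarrow> complex) set" where
  "measures_on T E = {\<mu>. complex_measure (borel_of T) \<mu> \<and> measure_support T \<mu> \<subseteq> E}"

text \<open>For a finite signed measure \<open>\<rho>\<close>, \<open>positive_part M \<rho>\<close> and \<open>positive_part M (- \<rho>)\<close> are the two
  terms of its Jordan decomposition; negative values of \<open>\<rho>\<close> are cut off by \<^const>\<open>ennreal\<close>.\<close>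

definition positive_part :: "'a measure \<Rightarrow> ('a set \<Rightarrow> real) \<Rightarrow> 'a measure" where
  "positive_part M \<rho> =
     measure_of (space M) (sets M) (\<lambda>A. SUP B\<in>{B \<in> sets M. B \<subseteq> A}. ennreal (\<rho> B))"

definition cm_integral :: "'a measure \<Rightarrow> ('a set \<Rightarrow> complex) \<Rightarrow> ('a \<Rightarrow> complex) \<Rightarrow> complex" where
  "cm_integral M \<mu> f =
     (\<integral>x. f x \<partial>positive_part M (\<lambda>A. Re (\<mu> A))) - (\<integral>x. f x \<partial>positive_part M (\<lambda>A. - Re (\<mu> A))) +
     \<i> * ((\<integral>x. f x \<partial>positive_part M (\<lambda>A. Im (\<mu> A))) - (\<integral>x. f x \<partial>positive_part M (\<lambda>A. - Im (\<mu> A))))"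


section \<open>Haar measure\<close>

definition haar_measure :: "('a, 'b) monoid_scheme \<Rightarrow> 'a topology \<Rightarrow> 'a measure \<Rightarrow> bool" where
  "haar_measure G T m \<longleftrightarrow>
     space m = topspace T \<and> sets m = sets (borel_of T) \<and>
     emeasure m (space m) \<noteq> 0 \<and>
     (\<forall>x\<in>carrier G. \<forall>A\<in>sets m. emeasure m (x <#\<^bsub>G\<^esub> A) = emeasure m A) \<and>
     (\<forall>K. compactin T K \<longrightarrow> emeasure m K < \<infinity>) \<and>
     (\<forall>A\<in>sets m. emeasure m A = (INF U\<in>{U. openin T U \<and> A \<subseteq> U}. emeasure m U)) \<and>
     (\<forall>U. openin T U \<longrightarrow> emeasure m U = (SUP K\<in>{K. compactin T K \<and> K \<subseteq> U}. emeasure m K))"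


section \<open>The Hilbert space \<open>L\<^sup>2\<close> and its bounded operators\<close>

text \<open>Elements of \<open>L2 m\<close> are classes of square integrable functions modulo equality almost everywhere.
  Values of functions outside \<open>space m\<close> are irrelevant.\<close>

definition L2_fun :: "'a measure \<Rightarrow> ('a \<Rightarrow> complex) set" where
  "L2_fun m = {\<xi> \<in> borel_measurable m. integrable m (\<lambda>x. (cmod (\<xi> x))\<^sup>2)}"

definition L2_class :: "'a measure \<Rightarrow> ('a \<Rightarrow> complex) \<Rightarrow> ('a \<Rightarrow> complex) set" where
  "L2_class m \<xi> = {\<eta> \<in> L2_fun m. AE x in m. \<eta> x = \<xi> x}"

definition L2 :: "'a measure \<Rightarrow> ('a \<Rightarrow> complex) set set" where
  "L2 m = L2_class m ` L2_fun m"

definition L2_rep :: "('a \<Rightarrow> complex) set \<Rightarrow> 'a \<Rightarrow> complex" where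
  "L2_rep c = (SOME \<xi>. \<xi> \<in> c)"

definition L2_zero :: "'a measure \<Rightarrow> ('a \<Rightarrow> complex) set" where
  "L2_zero m = L2_class m (\<lambda>x. 0)"

definition L2_add :: "'a measure \<Rightarrow> ('a \<Rightarrow> complex) set \<Rightarrow> ('a \<Rightarrow> complex) set \<Rightarrow> ('a \<Rightarrow> complex) set" where
  "L2_add m c d = L2_class m (\<lambda>x. L2_rep c x + L2_rep d x)"

definition L2_scale :: "'a measure \<Rightarrow> complex \<Rightarrow> ('a \<Rightarrow> complex) set \<Rightarrow> ('a \<Rightarrow> complex) set" where
  "L2_scale m z c = L2_class m (\<lambda>x. z * L2_rep c x)"

definition L2_diff :: "'a measure \<Rightarrow> ('a \<Rightarrow> complex) set \<Rightarrow> ('a \<Rightarrow> complex) set \<Rightarrow> ('a \<Rightarrow> complex) set" where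
  "L2_diff m c d = L2_class m (\<lambda>x. L2_rep c x - L2_rep d x)"

definition L2_norm :: "'a measure \<Rightarrow> ('a \<Rightarrow> complex) set \<Rightarrow> real" where
  "L2_norm m c = sqrt (\<integral>x. (cmod (L2_rep c x))\<^sup>2 \<partial>m)"

type_synonym 'a L2_op = "('a \<Rightarrow> complex) set \<Rightarrow> ('a \<Rightarrow> complex) set"

definition bounded_ops :: "'a measure \<Rightarrow> 'a L2_op set" where
  "bounded_ops m = {S \<in> L2 m \<rightarrow>\<^sub>E L2 m.
     (\<forall>c\<in>L2 m. \<forall>d\<in>L2 m. S (L2_add m c d) = L2_add m (S c) (S d)) \<and>
     (\<forall>z. \<forall>c\<in>L2 m. S (L2_scale m z c) = L2_scale m z (S c)) \<and>
     (\<exists>K. \<forall>c\<in>L2 m. L2_norm m (S c) \<le> K * L2_norm m c)}"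

definition op_zero :: "'a measure \<Rightarrow> 'a L2_op" where
  "op_zero m = (\<lambda>c\<in>L2 m. L2_zero m)"

definition op_diff :: "'a measure \<Rightarrow> 'a L2_op \<Rightarrow> 'a L2_op \<Rightarrow> 'a L2_op" where
  "op_diff m S R = (\<lambda>c\<in>L2 m. L2_diff m (S c) (R c))"

definition op_norm :: "'a measure \<Rightarrow> 'a L2_op \<Rightarrow> real" where
  "op_norm m S = (SUP c\<in>{c \<in> L2 m. L2_norm m c \<le> 1}. L2_norm m (S c))"


section \<open>The reduced group C*-algebra and \<open>M\<^sub>0\<close>-sets\<close>

text \<open>The argument \<open>m\<close> is a Haar measure of the group. It is determined up to a positive factor, and
  the operators \<open>conv_op G T m \<mu>\<close>, the set \<open>reduced_cstar G T m\<close> and the notions of uniqueness and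
  multiplicity do not change under such a rescaling.\<close>

definition conv_op ::
  "('a, 'b) monoid_scheme \<Rightarrow> 'a topology \<Rightarrow> 'a measure \<Rightarrow> ('a set \<Rightarrow> complex) \<Rightarrow> 'a L2_op" where
  "conv_op G T m \<mu> =
     (\<lambda>c\<in>L2 m. L2_class m (\<lambda>g. cm_integral (borel_of T) \<mu> (\<lambda>s. L2_rep c (inv\<^bsub>G\<^esub> s \<otimes>\<^bsub>G\<^esub> g))))"

text \<open>The embedding of \<open>L\<^sup>1(G)\<close> into \<open>M(G)\<close>.\<close>

definition density_cm :: "'a measure \<Rightarrow> ('a \<Rightarrow> complex) \<Rightarrow> 'a set \<Rightarrow> complex" where
  "density_cm m f A = (if A \<in> sets m then set_lebesgue_integral m A f else 0)"

definition reduced_cstar ::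
  "('a, 'b) monoid_scheme \<Rightarrow> 'a topology \<Rightarrow> 'a measure \<Rightarrow> 'a L2_op set" where
  "reduced_cstar G T m =
     {S \<in> bounded_ops m. \<forall>\<epsilon>>0. \<exists>f. integrable m f \<and>
        op_norm m (op_diff m S (conv_op G T m (density_cm m f))) < \<epsilon>}"

definition extended_uniqueness_set ::
  "('a, 'b) monoid_scheme \<Rightarrow> 'a topology \<Rightarrow> 'a measure \<Rightarrow> 'a set \<Rightarrow> bool" where
  "extended_uniqueness_set G T m E \<longleftrightarrow>
     closedin T E \<and> conv_op G T m ` measures_on T E \<inter> reduced_cstar G T m = {op_zero m}"

definition M0_set ::
  "('a, 'b) monoid_scheme \<Rightarrow> 'a topology \<Rightarrow> 'a measure \<Rightarrow> 'a set \<Rightarrow> bool" where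
  "M0_set G T m E \<longleftrightarrow> closedin T E \<and> \<not> extended_uniqueness_set G T m E"

end

theory Submission
  imports Defs
begin

text \<open>Let \<open>\<mu>\<close> be a measure on \<open>q\<^sup>-\<^sup>1(E)\<close> with \<open>0 \<noteq> \<lambda>(\<mu>) \<in> C\<^sub>r\<^sup>*(G)\<close>. For \<open>\<xi>, \<eta> \<in> L\<^sup>2(G)\<close> let \<open>u\<close> be the
  coefficient \<open>u(s) = \<langle>\<lambda>(s)\<xi>, \<eta>\<rangle>\<close> of the regular representation. By Fell's absorption principle
  \<open>\<parallel>\<lambda>(q\<^sub>*(u\<sigma>))\<parallel> \<le> \<parallel>\<xi>\<parallel> \<parallel>\<eta>\<parallel> \<parallel>\<lambda>(\<sigma>)\<parallel>\<close> for every complex measure \<open>\<sigma>\<close> on \<open>G\<close>, and \<open>q\<^sub>*(uf)\<close> is absolutely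
  continuous for \<open>f \<in> L\<^sup>1(G)\<close>; hence \<open>\<nu> = q\<^sub>*(u\<mu>)\<close>, which lives on \<open>E\<close>, satisfies \<open>\<lambda>(\<nu>) \<in> C\<^sub>r\<^sup>*(G/H)\<close>.
  Choosing \<open>\<xi>\<close> with \<open>\<eta> = \<lambda>(\<mu>)\<xi> \<noteq> 0\<close> gives \<open>\<nu>(G/H) = \<integral> u d\<mu> = \<parallel>\<eta>\<parallel>\<^sup>2 \<noteq> 0\<close>. Finally \<open>\<lambda>(\<nu>) = 0\<close> would force
  \<open>\<nu>(G/H) = 0\<close>: exhaust \<open>G/H\<close> by sets \<open>A\<^sub>k\<close> of finite measure and apply \<open>\<lambda>(\<nu>)\<close> to their indicator
  functions.\<close>

section \<open>Complex measures\<close>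

text \<open>The factor \<open>u\<close> has two jobs. The image of \<mu> under \<open>q\<close> can
  vanish although \<mu> does not, and a suitable \<open>u\<close> gives the image nonzero total
  mass. Moreover, integrating \<open>u\<close> against \<sigma> pairs the tensor product of
  \<lambda> and \<open>\<lambda> o q\<close> with vectors of the first factor, and absorption
  compares that product with \<lambda> alone. The estimate is needed for \<sigma> = \<mu> - f with
  one fixed \<open>u\<close>, so that an approximation of \<lambda>(\<mu>) by \<lambda>(f) passes to
  the quotient. Integration against a complex measure is defined by four Jordan parts, a form to
  which Fubini does not apply directly. Every measure that occurs is therefore written as the image
  of a bounded density against a finite positive measure \<open>P\<close>, so that one integral over
  \<open>P\<close> remains. As \<mu> and f come with different \<open>P\<close>, the norm estimates
  are stated for the difference of two such operators.\<close>

definition countably_summing :: "'a measure \<Rightarrow> ('a set \<Rightarrow> 'c::real_normed_vector) \<Rightarrow> bool" where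
  "countably_summing M \<mu> \<longleftrightarrow>
     (\<forall>A::nat \<Rightarrow> 'a set. range A \<subseteq> sets M \<longrightarrow> disjoint_family A \<longrightarrow>
        (\<lambda>i. \<mu> (A i)) sums \<mu> (\<Union>i. A i))"

lemma countably_summingD:
  "countably_summing M \<mu> \<Longrightarrow> range A \<subseteq> sets M \<Longrightarrow> disjoint_family A \<Longrightarrow>
    (\<lambda>i::nat. \<mu> (A i)) sums \<mu> (\<Union>i. A i)"
  by (simp add: countably_summing_def)

lemma countably_summing_empty:
  assumes "countably_summing M \<mu>"
  shows "\<mu> {} = 0"
proof -
  have "(\<lambda>i::nat. \<mu> {}) sums \<mu> (\<Union>i::nat. {})"
    by (rule countably_summingD[OF assms]) (auto simp: disjoint_family_on_def)
  then have "(\<lambda>i::nat. \<mu> {}) \<longlonglongrightarrow> 0"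
    using sums_summable summable_LIMSEQ_zero by blast
  then show ?thesis
    by (simp add: LIMSEQ_const_iff)
qed

lemma countably_summing_Un:
  assumes "countably_summing M \<mu>" "A \<in> sets M" "B \<in> sets M" "A \<inter> B = {}"
  shows "\<mu> (A \<union> B) = \<mu> A + \<mu> B"
proof -
  have "(\<lambda>i. \<mu> (binaryset A B i)) sums \<mu> (\<Union>i. binaryset A B i)"
    using assms by (intro countably_summingD[OF assms(1)])
      (auto simp: range_binaryset_eq disjoint_family_on_def binaryset_def)
  moreover have "(\<lambda>i. \<mu> (binaryset A B i)) sums (\<mu> A + \<mu> B)"
    by (rule binaryset_sums) (rule countably_summing_empty[OF assms(1)])
  ultimately show ?thesis
    using sums_unique2 by (metis UN_binaryset_eq)
qed

lemma countably_summing_Diff: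
  assumes "countably_summing M \<mu>" "A \<in> sets M" "B \<in> sets M" "B \<subseteq> A"
  shows "\<mu> (A - B) = \<mu> A - \<mu> B"
proof -
  have "\<mu> ((A - B) \<union> B) = \<mu> (A - B) + \<mu> B"
    using assms by (intro countably_summing_Un) auto
  moreover have "(A - B) \<union> B = A" using assms by blast
  ultimately show ?thesis by simp
qed

text \<open>If the values were unbounded, a set whose subsets have unbounded values could be cut
  into two pieces of norm at least 1, one of which again has subsets of unbounded value. Repeating
  this splits off a disjoint sequence of pieces of norm at least 1, against convergence of the
  series.\<close>

lemma countably_summing_bounded:
  fixes \<mu> :: "'a set \<Rightarrow> 'c::real_normed_vector"
  assumes \<mu>: "countably_summing M \<mu>"
  shows "\<exists>K. \<forall>A\<in>sets M. norm (\<mu> A) \<le> K"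
proof (rule ccontr)
  assume unb: "\<not> ?thesis"
  define I where "I A \<longleftrightarrow> A \<in> sets M \<and> (\<forall>K. \<exists>B\<in>sets M. B \<subseteq> A \<and> norm (\<mu> B) > K)" for A
  have "I (space M)"
    using unb sets.sets_into_space unfolding I_def by (metis linorder_not_le sets.top)
  have step: "\<exists>A'. I A' \<and> A' \<subseteq> A \<and> norm (\<mu> (A - A')) \<ge> 1" if A: "I A" for A
  proof -
    \<comment> \<open>The excess over \<open>norm (\<mu> A)\<close> forces norm at least 1 on
      \<open>A - B\<close> as well, so either piece may be the one split off.\<close>
    obtain B where B: "B \<in> sets M" "B \<subseteq> A" "norm (\<mu> B) > 1 + norm (\<mu> A)"
      using A unfolding I_def by blast
    have As: "A \<in> sets M" using A by (simp add: I_def)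
    have d: "\<mu> (A - B) = \<mu> A - \<mu> B"
      using countably_summing_Diff[OF \<mu> As B(1,2)] .
    have d1: "norm (\<mu> (A - B)) \<ge> 1"
      unfolding d using B(3) norm_triangle_ineq2[of "\<mu> B" "\<mu> A"] by (simp add: norm_minus_commute)
    have d2: "norm (\<mu> (A - (A - B))) \<ge> 1"
    proof -
      have "A - (A - B) = B" using B by blast
      then show ?thesis using B(3) norm_ge_zero[of "\<mu> A"] by (metis add.commute add_increasing less_eq_real_def linorder_not_le)
    qed
    have "I B \<or> I (A - B)"
    proof (rule ccontr)
      assume "\<not> ?thesis"
      then have nI: "\<not> I B" "\<not> I (A - B)" by blast+
      obtain K1 where K1: "\<And>C. C \<in> sets M \<Longrightarrow> C \<subseteq> B \<Longrightarrow> norm (\<mu> C) \<le> K1"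
        using nI(1) B(1) unfolding I_def by (meson not_le)
      obtain K2 where K2: "\<And>C. C \<in> sets M \<Longrightarrow> C \<subseteq> A - B \<Longrightarrow> norm (\<mu> C) \<le> K2"
        using nI(2) sets.Diff[OF As B(1)] unfolding I_def by (meson not_le)
      have "norm (\<mu> C) \<le> K1 + K2" if C: "C \<in> sets M" "C \<subseteq> A" for C
      proof -
        have "\<mu> ((C \<inter> B) \<union> (C - B)) = \<mu> (C \<inter> B) + \<mu> (C - B)"
          using C B by (intro countably_summing_Un[OF \<mu>]) auto
        moreover have "(C \<inter> B) \<union> (C - B) = C" by blast
        moreover have "norm (\<mu> (C \<inter> B)) \<le> K1" "norm (\<mu> (C - B)) \<le> K2"
          using C B by (auto intro!: K1 K2)
        ultimately show ?thesis
          using norm_triangle_ineq[of "\<mu> (C \<inter> B)" "\<mu> (C - B)"] by simp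
      qed
      then show False using A unfolding I_def by (meson linorder_not_le)
    qed
    then show ?thesis using d1 d2 B by blast
  qed
  obtain A where A: "\<And>n. I (A n)" "\<And>n. A (Suc n) \<subseteq> A n \<and> norm (\<mu> (A n - A (Suc n))) \<ge> 1"
    using dependent_nat_choice[of "\<lambda>_. I" "\<lambda>_ A A'. A' \<subseteq> A \<and> norm (\<mu> (A - A')) \<ge> 1"]
      \<open>I (space M)\<close> step by metis
  have anti: "A n \<subseteq> A k" if "k \<le> n" for n k
    using that A(2) lift_Suc_antimono_le[of A] by blast
  have "disjoint_family (\<lambda>n. A n - A (Suc n))"
    unfolding disjoint_family_on_def
  proof (intro ballI impI)
    fix i j :: nat assume "i \<noteq> j"
    then show "(A i - A (Suc i)) \<inter> (A j - A (Suc j)) = {}"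
      using anti[of "Suc i" j] anti[of "Suc j" i] by (cases "i < j") auto
  qed
  moreover have "range (\<lambda>n. A n - A (Suc n)) \<subseteq> sets M"
    using A(1) unfolding I_def by auto
  ultimately have "(\<lambda>n. \<mu> (A n - A (Suc n))) sums \<mu> (\<Union>n. A n - A (Suc n))"
    using countably_summingD[OF \<mu>] by blast
  then have "(\<lambda>n. \<mu> (A n - A (Suc n))) \<longlonglongrightarrow> 0"
    using sums_summable summable_LIMSEQ_zero by blast
  then have "(\<lambda>n. norm (\<mu> (A n - A (Suc n)))) \<longlonglongrightarrow> 0"
    using tendsto_norm_zero by blast
  then have "1 \<le> (0::real)"
    using A(2) by (intro LIMSEQ_le_const) auto
  then show False by simp
qed

section \<open>Jordan decomposition of a signed measure\<close>

lemma
  shows sets_positive_part[simp, measurable_cong]: "sets (positive_part M \<rho>) = sets M"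
    and space_positive_part[simp]: "space (positive_part M \<rho>) = space M"
  by (simp_all add: positive_part_def)

text \<open>\<open>measure_of\<close> takes the prescribed values only if they form a measure.
  Uniting competitors for disjoint sets gives superadditivity; cutting a competitor \<open>B\<close>
  along the \<open>A i\<close> gives the reverse inequality.\<close>

lemma emeasure_positive_part:
  assumes \<rho>: "countably_summing M \<rho>" and A: "A \<in> sets M"
  shows "emeasure (positive_part M \<rho>) A = (SUP B\<in>{B \<in> sets M. B \<subseteq> A}. ennreal (\<rho> B))"
proof -
  define f where "f A = (SUP B\<in>{B \<in> sets M. B \<subseteq> A}. ennreal (\<rho> B))" for A
  have e: "\<rho> {} = 0" by (rule countably_summing_empty[OF \<rho>])
  have upper: "ennreal (\<rho> B) \<le> f A" if "B \<in> sets M" "B \<subseteq> A" for A B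
    unfolding f_def using that by (intro SUP_upper) auto
  have mono: "f A \<le> f B" if "A \<subseteq> B" for A B
    unfolding f_def using that by (intro SUP_subset_mono) auto
  have super: "f A + f B \<le> f (A \<union> B)" if "A \<inter> B = {}" for A B
  proof -
    have "f A + f B = (SUP X\<in>{B \<in> sets M. B \<subseteq> A}. (SUP Y\<in>{X \<in> sets M. X \<subseteq> B}. ennreal (\<rho> X) + ennreal (\<rho> Y)))"
      unfolding f_def
      by (subst ennreal_SUP_add_left[symmetric], blast, intro SUP_cong refl,
          subst ennreal_SUP_add_right[symmetric], blast) simp
    also have "\<dots> \<le> f (A \<union> B)"
    proof (intro SUP_least)
      fix X Y assume X: "X \<in> {B \<in> sets M. B \<subseteq> A}" and Y: "Y \<in> {X \<in> sets M. X \<subseteq> B}"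
      \<comment> \<open>\<open>ennreal\<close> is additive only on nonnegative reals. A competitor
        of negative value contributes 0, so the empty set may replace it.\<close>
      define X' where "X' = (if \<rho> X \<ge> 0 then X else {})"
      define Y' where "Y' = (if \<rho> Y \<ge> 0 then Y else {})"
      have "ennreal (\<rho> X) + ennreal (\<rho> Y) = ennreal (\<rho> X' + \<rho> Y')"
        by (auto simp: X'_def Y'_def e ennreal_neg)
      also have "\<dots> = ennreal (\<rho> (X' \<union> Y'))"
        using X Y that by (subst countably_summing_Un[OF \<rho>]) (auto simp: X'_def Y'_def)
      also have "\<dots> \<le> f (A \<union> B)"
        using X Y by (intro upper) (auto simp: X'_def Y'_def)
      finally show "ennreal (\<rho> X) + ennreal (\<rho> Y) \<le> f (A \<union> B)" .
    qed
    finally show ?thesis .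
  qed
  have "countably_additive (sets M) f"
    unfolding countably_additive_def
  proof (intro allI impI)
    fix A :: "nat \<Rightarrow> 'a set"
    assume A: "range A \<subseteq> sets M" "disjoint_family A" "(\<Union>i. A i) \<in> sets M"
    show "(\<Sum>i. f (A i)) = f (\<Union>i. A i)"
    proof (rule antisym)
      have "(\<Sum>i<n. f (A i)) \<le> f (\<Union>i<n. A i)" for n
      proof (induction n)
        case (Suc n)
        have "A i \<inter> A n = {}" if "i < n" for i
          using A(2) that by (intro disjoint_family_onD[OF A(2)]) auto
        then have "(\<Union>i<n. A i) \<inter> A n = {}"
          by blast
        then have st: "f (\<Union>i<n. A i) + f (A n) \<le> f (\<Union>i<Suc n. A i)"
          using super[of "\<Union>i<n. A i" "A n"] by (simp only: lessThan_Suc UN_insert Un_commute)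
        show ?case
          unfolding sum.lessThan_Suc by (rule order_trans[OF add_right_mono[OF Suc] st])
      qed simp
      also have "f (\<Union>i<n. A i) \<le> f (\<Union>i. A i)" for n
        by (rule mono) auto
      finally show "(\<Sum>i. f (A i)) \<le> f (\<Union>i. A i)"
        unfolding suminf_eq_SUP by (intro SUP_least)
      show "f (\<Union>i. A i) \<le> (\<Sum>i. f (A i))"
        unfolding f_def[of "\<Union>i. A i"]
      proof (intro SUP_least)
        fix B assume B: "B \<in> {B \<in> sets M. B \<subseteq> (\<Union>i. A i)}"
        have "(\<lambda>i. \<rho> (B \<inter> A i)) sums \<rho> (\<Union>i. B \<inter> A i)"
          using A B by (intro countably_summingD[OF \<rho>]) (auto simp: disjoint_family_on_def)
        moreover have "(\<Union>i. B \<inter> A i) = B" using B by blast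
        ultimately have lim: "(\<lambda>n. ennreal (\<Sum>i<n. \<rho> (B \<inter> A i))) \<longlonglongrightarrow> ennreal (\<rho> B)"
          unfolding sums_def by (intro tendsto_ennrealI) simp
        have "ennreal (\<Sum>i<n. \<rho> (B \<inter> A i)) \<le> (\<Sum>i. f (A i))" for n
        proof -
          have "ennreal (\<Sum>i<n. \<rho> (B \<inter> A i)) \<le> ennreal (\<Sum>i<n. max 0 (\<rho> (B \<inter> A i)))"
            by (intro ennreal_leI sum_mono) simp
          also have "\<dots> = (\<Sum>i<n. ennreal (max 0 (\<rho> (B \<inter> A i))))"
            by (simp add: sum_ennreal)
          also have "\<dots> \<le> (\<Sum>i<n. f (A i))"
            using A B by (intro sum_mono) (auto simp: max_def intro!: upper)
          also have "\<dots> \<le> (\<Sum>i. f (A i))"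
            by (rule sum_le_suminf) auto
          finally show ?thesis .
        qed
        then show "ennreal (\<rho> B) \<le> (\<Sum>i. f (A i))"
          using lim by (intro LIMSEQ_le_const2) auto
      qed
    qed
  qed
  moreover have "positive (sets M) f"
  proof -
    have "{B \<in> sets M. B \<subseteq> {}} = {{}}" by auto
    then show ?thesis by (simp add: positive_def f_def e)
  qed
  ultimately show ?thesis
    using A unfolding positive_part_def f_def[symmetric]
    by (intro emeasure_measure_of_sigma) (auto simp: sets.sigma_algebra_axioms)
qed

lemma finite_measure_positive_part:
  assumes "countably_summing M \<rho>"
  shows "finite_measure (positive_part M \<rho>)"
proof
  obtain K where "\<And>A. A \<in> sets M \<Longrightarrow> norm (\<rho> A) \<le> K"
    using countably_summing_bounded[OF assms] by blast
  then have "emeasure (positive_part M \<rho>) (space M) \<le> ennreal K"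
    by (subst emeasure_positive_part[OF assms])
      (auto intro!: SUP_least ennreal_leI simp: abs_le_iff)
  then show "emeasure (positive_part M \<rho>) (space (positive_part M \<rho>)) \<noteq> \<infinity>"
    by (auto simp: top_unique)
qed

lemma countably_summing_minus:
  "countably_summing M \<rho> \<Longrightarrow> countably_summing M (\<lambda>A. - \<rho> A)"
  by (simp add: countably_summing_def sums_minus)

lemma measure_positive_part_ge:
  assumes \<rho>: "countably_summing M \<rho>" and A: "A \<in> sets M"
  shows "\<rho> A \<le> measure (positive_part M \<rho>) A"
proof -
  interpret finite_measure "positive_part M \<rho>" by (rule finite_measure_positive_part[OF \<rho>])
  have "ennreal (\<rho> A) \<le> emeasure (positive_part M \<rho>) A"
    unfolding emeasure_positive_part[OF assms] using A by (intro SUP_upper) auto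
  then show ?thesis by (simp add: emeasure_eq_measure)
qed

text \<open>For \<open>B\<close> inside \<open>A\<close>, the value \<open>\<rho> B\<close> is
  \<open>\<rho> A - \<rho> (A - B)\<close>, and the second term is controlled by the negative part.
  Used for \<rho> and for its negative, this yields the Jordan identity.\<close>

lemma measure_positive_part_le:
  assumes \<rho>: "countably_summing M \<rho>" and A: "A \<in> sets M"
  shows "measure (positive_part M \<rho>) A \<le> \<rho> A + measure (positive_part M (\<lambda>A. - \<rho> A)) A"
proof -
  note \<rho>' = countably_summing_minus[OF \<rho>]
  interpret finite_measure "positive_part M \<rho>" by (rule finite_measure_positive_part[OF \<rho>])
  interpret N: finite_measure "positive_part M (\<lambda>A. - \<rho> A)"
    by (rule finite_measure_positive_part[OF \<rho>'])
  let ?r = "\<rho> A + measure (positive_part M (\<lambda>A. - \<rho> A)) A"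
  have "emeasure (positive_part M \<rho>) A \<le> ennreal ?r"
    unfolding emeasure_positive_part[OF assms]
  proof (intro SUP_least ennreal_leI)
    fix B assume B: "B \<in> {B \<in> sets M. B \<subseteq> A}"
    have "\<rho> B = \<rho> A + - \<rho> (A - B)"
      using B A by (simp add: countably_summing_Diff[OF \<rho>])
    also have "- \<rho> (A - B) \<le> measure (positive_part M (\<lambda>A. - \<rho> A)) (A - B)"
      using A B by (intro measure_positive_part_ge[OF \<rho>']) auto
    also have "\<dots> \<le> measure (positive_part M (\<lambda>A. - \<rho> A)) A"
      using A by (intro N.finite_measure_mono) auto
    finally show "\<rho> B \<le> ?r" by simp
  qed
  moreover have "0 \<le> ?r"
    using measure_positive_part_ge[OF \<rho>' A] by simp
  ultimately show ?thesis by (simp add: emeasure_eq_measure)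
qed

lemma measure_positive_part_diff:
  assumes \<rho>: "countably_summing M \<rho>" and A: "A \<in> sets M"
  shows "measure (positive_part M \<rho>) A - measure (positive_part M (\<lambda>A. - \<rho> A)) A = \<rho> A"
  using measure_positive_part_le[OF assms] measure_positive_part_le[OF countably_summing_minus[OF \<rho>] A]
  by simp

section \<open>Independence of integrals from the decomposition of a signed measure\<close>

lemma exists_sum_measure:
  assumes "sets M1 = sets M" "sets M2 = sets M"
  shows "\<exists>P. sets P = sets M \<and> (\<forall>A. emeasure P A = emeasure M1 A + emeasure M2 A)"
proof (intro exI conjI allI)
  let ?f = "\<lambda>A. emeasure M1 A + emeasure M2 A"
  let ?P = "measure_of (space M) (sets M) ?f"
  show s: "sets ?P = sets M" by simp
  fix A
  show "emeasure ?P A = ?f A"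
  proof (cases "A \<in> sets M")
    case True
    have "countably_additive (sets M) ?f"
      unfolding countably_additive_def
      using assms by (auto simp: suminf_add[symmetric] suminf_emeasure)
    then show ?thesis
      using True by (intro emeasure_measure_of_sigma) (auto simp: sets.sigma_algebra_axioms positive_def)
  next
    case False
    then show ?thesis using assms s by (simp add: emeasure_notin_sets)
  qed
qed

text \<open>Domination implies absolute continuity, and finiteness of \<open>N\<close> lets the
  density be real-valued and integrable.\<close>

lemma exists_bounded_density:
  assumes "finite_measure P" "sets N = sets P" "\<And>A. emeasure N A \<le> emeasure P A"
  shows "\<exists>d. d \<in> borel_measurable P \<and> (\<forall>x. (0::real) \<le> d x) \<and> N = density P (\<lambda>x. ennreal (d x)) \<and> integrable P d"
proof -
  interpret finite_measure P by fact
  have sp: "space N = space P" using assms(2) by (rule sets_eq_imp_space_eq)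
  have fN: "finite_measure N"
  proof
    show "emeasure N (space N) \<noteq> \<infinity>"
      using assms(3)[of "space P"] sp by (simp add: emeasure_eq_measure) (metis ennreal_neq_top neq_top_trans)
  qed
  have ac: "absolutely_continuous P N"
    using assms(2,3) unfolding absolutely_continuous_def null_sets_def
    by (auto, metis le_zero_eq)
  obtain D where D: "D \<in> borel_measurable P" "AE x in P. RN_deriv P N x = ennreal (D x)" "\<And>x. 0 \<le> D x"
    using real_RN_deriv[OF fN ac assms(2)] by metis
  have "N = density P (RN_deriv P N)"
    using density_RN_deriv[OF ac assms(2)] by simp
  also have "\<dots> = density P (\<lambda>x. ennreal (D x))"
    using D by (intro density_cong) auto
  finally have N: "N = density P (\<lambda>x. ennreal (D x))" .
  have "(\<integral>\<^sup>+x. ennreal (D x) \<partial>P) = emeasure N (space P)"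
    using D(1) by (subst N) (simp add: emeasure_density cong: nn_integral_cong)
  also have "\<dots> < \<infinity>"
    using fN sp by (metis finite_measure.emeasure_finite infinity_ennreal_def top.not_eq_extremum)
  finally have "integrable P D"
    using D by (intro integrableI_bounded) auto
  with D N show ?thesis by blast
qed

text \<open>Both sides integrate against one signed measure decomposed in two ways. Relative to the
  sum of all four measures each of them has a density, and the additive hypothesis becomes an almost
  everywhere identity between these densities.\<close>

lemma integral_diff_eq_of_sum_eq:
  fixes f :: "'a \<Rightarrow> complex"
  assumes fin: "finite_measure M1" "finite_measure M2" "finite_measure M3" "finite_measure M4"
    and sets: "sets M1 = sets M" "sets M2 = sets M" "sets M3 = sets M" "sets M4 = sets M"
    and eq: "\<And>A. A \<in> sets M \<Longrightarrow> measure M1 A + measure M4 A = measure M3 A + measure M2 A"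
    and int: "integrable M1 f" "integrable M2 f" "integrable M3 f" "integrable M4 f"
  shows "integral\<^sup>L M1 f - integral\<^sup>L M2 f = integral\<^sup>L M3 f - integral\<^sup>L M4 f"
proof -
  obtain P1 where P1: "sets P1 = sets M" "\<And>A. emeasure P1 A = emeasure M1 A + emeasure M2 A"
    using exists_sum_measure[OF sets(1,2)] by blast
  obtain P2 where P2: "sets P2 = sets M" "\<And>A. emeasure P2 A = emeasure M3 A + emeasure M4 A"
    using exists_sum_measure[OF sets(3,4)] by blast
  obtain P where P: "sets P = sets M" "\<And>A. emeasure P A = emeasure P1 A + emeasure P2 A"
    using exists_sum_measure[OF P1(1) P2(1)] by blast
  have [simp]: "space P = space M" using P(1) by (rule sets_eq_imp_space_eq)
  interpret P: finite_measure P
    by (rule finite_measureI) (use fin in \<open>simp add: P P1 P2 finite_measure.emeasure_eq_measure\<close>)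
  note em = finite_measure.emeasure_eq_measure
  have ex: "\<exists>d. d \<in> borel_measurable P \<and> (\<forall>x. (0::real) \<le> d x) \<and> N = density P (\<lambda>x. ennreal (d x)) \<and> integrable P d"
    if "sets N = sets M" "\<And>A. emeasure N A \<le> emeasure P A" for N
    using that P by (intro exists_bounded_density P.finite_measure_axioms) auto
  have le: "emeasure M1 A \<le> emeasure P A" "emeasure M2 A \<le> emeasure P A"
    "emeasure M3 A \<le> emeasure P A" "emeasure M4 A \<le> emeasure P A" for A
    using fin by (simp_all add: P P1 P2 em flip: ennreal_plus)
  obtain d1 where d1: "d1 \<in> borel_measurable P" "\<And>x. (0::real) \<le> d1 x" "M1 = density P (\<lambda>x. ennreal (d1 x))" "integrable P d1"
    using ex[OF sets(1) le(1)] by blast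
  obtain d2 where d2: "d2 \<in> borel_measurable P" "\<And>x. (0::real) \<le> d2 x" "M2 = density P (\<lambda>x. ennreal (d2 x))" "integrable P d2"
    using ex[OF sets(2) le(2)] by blast
  obtain d3 where d3: "d3 \<in> borel_measurable P" "\<And>x. (0::real) \<le> d3 x" "M3 = density P (\<lambda>x. ennreal (d3 x))" "integrable P d3"
    using ex[OF sets(3) le(3)] by blast
  obtain d4 where d4: "d4 \<in> borel_measurable P" "\<And>x. (0::real) \<le> d4 x" "M4 = density P (\<lambda>x. ennreal (d4 x))" "integrable P d4"
    using ex[OF sets(4) le(4)] by blast
  note dm[measurable] = d1(1) d2(1) d3(1) d4(1)
  have "density P (\<lambda>x. ennreal (d1 x) + ennreal (d4 x)) = density P (\<lambda>x. ennreal (d3 x) + ennreal (d2 x))"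
  proof (rule measure_eqI)
    fix A assume "A \<in> sets (density P (\<lambda>x. ennreal (d1 x) + ennreal (d4 x)))"
    then have A[measurable]: "A \<in> sets P" by simp
    have *: "emeasure (density P (\<lambda>x. ennreal (f x) + ennreal (g x))) A =
       emeasure (density P (\<lambda>x. ennreal (f x))) A + emeasure (density P (\<lambda>x. ennreal (g x))) A"
      if [measurable]: "f \<in> borel_measurable P" "g \<in> borel_measurable P" for f g :: "'a \<Rightarrow> real"
      by (simp add: emeasure_density nn_integral_add distrib_right)
    show "emeasure (density P (\<lambda>x. ennreal (d1 x) + ennreal (d4 x))) A =
      emeasure (density P (\<lambda>x. ennreal (d3 x) + ennreal (d2 x))) A"
      using eq[of A] A P(1)
      by (simp add: * d1(3)[symmetric] d2(3)[symmetric] d3(3)[symmetric] d4(3)[symmetric]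
          fin em flip: ennreal_plus)
  qed simp
  then have "AE x in P. ennreal (d1 x) + ennreal (d4 x) = ennreal (d3 x) + ennreal (d2 x)"
    by (subst (asm) P.density_unique_iff) auto
  then have ae: "AE x in P. d1 x + d4 x = d3 x + d2 x"
    by eventually_elim (use d1(2) d2(2) d3(2) d4(2) in \<open>simp flip: ennreal_plus\<close>)
  have fm[measurable]: "f \<in> borel_measurable P"
    using int(1) sets(1) P(1) by (metis borel_measurable_integrable measurable_cong_sets)
  have I: "integrable P (\<lambda>x. d1 x *\<^sub>R f x)" "integrable P (\<lambda>x. d2 x *\<^sub>R f x)"
     "integrable P (\<lambda>x. d3 x *\<^sub>R f x)" "integrable P (\<lambda>x. d4 x *\<^sub>R f x)"
    using int d1(2,3) d2(2,3) d3(2,3) d4(2,3) by (simp_all add: integrable_density)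
  have "(\<integral>x. d1 x *\<^sub>R f x + d4 x *\<^sub>R f x \<partial>P) = (\<integral>x. d3 x *\<^sub>R f x + d2 x *\<^sub>R f x \<partial>P)"
    using ae by (intro integral_cong_AE) (auto simp flip: scaleR_add_left)
  moreover have "integral\<^sup>L M1 f = (\<integral>x. d1 x *\<^sub>R f x \<partial>P)" "integral\<^sup>L M2 f = (\<integral>x. d2 x *\<^sub>R f x \<partial>P)"
     "integral\<^sup>L M3 f = (\<integral>x. d3 x *\<^sub>R f x \<partial>P)" "integral\<^sup>L M4 f = (\<integral>x. d4 x *\<^sub>R f x \<partial>P)"
    using d1(2,3) d2(2,3) d3(2,3) d4(2,3) by (simp_all add: integral_density)
  ultimately show ?thesis
    using I by (simp add: algebra_simps)
qed

text \<open>The image under \<kappa> of the complex measure with density \<open>w\<close> against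
  \<open>P\<close>, set to 0 off the \<sigma>-algebra as \<open>complex_measure\<close> demands. An
  arbitrary complex measure, an integrable function, and the product of either with \<open>u\<close>
  pushed to the quotient all take this form.\<close>

definition weighted_image :: "'b measure \<Rightarrow> ('b \<Rightarrow> 'a) \<Rightarrow> ('b \<Rightarrow> complex) \<Rightarrow> 'a measure \<Rightarrow> 'a set \<Rightarrow> complex" where
  "weighted_image P \<kappa> w M A = (if A \<in> sets M then \<integral>x. indicator A (\<kappa> x) * w x \<partial>P else 0)"

lemma countably_summing_diff:
  assumes "finite_measure M1" "finite_measure M2" "sets M1 = sets M" "sets M2 = sets M"
    and "\<And>A. A \<in> sets M \<Longrightarrow> \<rho> A = measure M1 A - measure M2 A"
  shows "countably_summing M \<rho>"
  unfolding countably_summing_def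
proof (intro allI impI)
  fix A :: "nat \<Rightarrow> 'a set" assume A: "range A \<subseteq> sets M" "disjoint_family A"
  have "(\<lambda>i. measure M1 (A i) - measure M2 (A i)) sums (measure M1 (\<Union>i. A i) - measure M2 (\<Union>i. A i))"
    using A assms by (intro sums_diff finite_measure.finite_measure_UNION) auto
  moreover have "measure M1 (A i) - measure M2 (A i) = \<rho> (A i)" for i
    using A assms(5)[of "A i"] by auto
  moreover have "measure M1 (\<Union>i. A i) - measure M2 (\<Union>i. A i) = \<rho> (\<Union>i. A i)"
    using A assms(5)[of "\<Union>i. A i"] by (auto simp: sets.countable_UN)
  ultimately show "(\<lambda>i. \<rho> (A i)) sums \<rho> (\<Union>i. A i)" by simp
qed

text \<open>The Jordan parts are minimal: \<open>M1\<close> and \<open>M2\<close> dominate them, so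
  integrability passes to them, and the comparison of two decompositions applies.\<close>

lemma jordan_integral_eq:
  fixes f :: "'a \<Rightarrow> complex"
  assumes fin: "finite_measure M1" "finite_measure M2" and sets: "sets M1 = sets M" "sets M2 = sets M"
    and \<rho>: "\<And>A. A \<in> sets M \<Longrightarrow> \<rho> A = measure M1 A - measure M2 A"
    and int: "integrable M1 f" "integrable M2 f"
  shows "integral\<^sup>L (positive_part M \<rho>) f - integral\<^sup>L (positive_part M (\<lambda>A. - \<rho> A)) f =
    integral\<^sup>L M1 f - integral\<^sup>L M2 f"
proof -
  have cs: "countably_summing M \<rho>"
    using fin sets \<rho> by (rule countably_summing_diff)
  note cs' = countably_summing_minus[OF cs]
  have fm: "f \<in> borel_measurable M"
    using int(1) sets(1) by (metis borel_measurable_integrable measurable_cong_sets)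
  have le: "integrable (positive_part M \<sigma>) f"
    if "finite_measure N" "sets N = sets M" "integrable N f" "countably_summing M \<sigma>"
      "\<And>A. A \<in> sets M \<Longrightarrow> \<sigma> A \<le> measure N A" for N \<sigma>
  proof (rule integrableI_bounded)
    interpret N: finite_measure N by fact
    have "emeasure (positive_part M \<sigma>) A \<le> emeasure N A" if A: "A \<in> sets M" for A
      unfolding emeasure_positive_part[OF \<open>countably_summing M \<sigma>\<close> A] N.emeasure_eq_measure
    proof (intro SUP_least ennreal_leI)
      fix B assume B: "B \<in> {B \<in> sets M. B \<subseteq> A}"
      have "\<sigma> B \<le> measure N B" using B \<open>\<And>A. A \<in> sets M \<Longrightarrow> \<sigma> A \<le> measure N A\<close> by auto
      also have "\<dots> \<le> measure N A"
        using B A \<open>sets N = sets M\<close> by (intro N.finite_measure_mono) auto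
      finally show "\<sigma> B \<le> measure N A" .
    qed
    then have "(\<integral>\<^sup>+x. norm (f x) \<partial>positive_part M \<sigma>) \<le> (\<integral>\<^sup>+x. norm (f x) \<partial>N)"
      using \<open>sets N = sets M\<close> by (intro nn_integral_mono_measure) (auto simp: le_measure)
    also have "\<dots> < \<infinity>" using \<open>integrable N f\<close> by (simp add: integrable_iff_bounded)
    finally show "(\<integral>\<^sup>+x. norm (f x) \<partial>positive_part M \<sigma>) < \<infinity>" .
    show "f \<in> borel_measurable (positive_part M \<sigma>)"
      using fm by simp
  qed
  show ?thesis
  proof (rule integral_diff_eq_of_sum_eq[where M=M])
    show "integrable (positive_part M \<rho>) f"
      by (rule le[of M1]) (use fin sets int cs \<rho> in auto)
    show "integrable (positive_part M (\<lambda>A. - \<rho> A)) f"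
      by (rule le[of M2]) (use fin sets int cs' \<rho> in auto)
    fix A assume A: "A \<in> sets M"
    show "measure (positive_part M \<rho>) A + measure M2 A = measure M1 A + measure (positive_part M (\<lambda>A. - \<rho> A)) A"
      using measure_positive_part_diff[OF cs A] \<rho>[OF A] by simp
  qed (use fin sets int cs cs' in \<open>auto intro: finite_measure_positive_part\<close>)
qed

text \<open>The positive and negative parts of \<open>v\<close> give a decomposition of \<rho> that
  need not be the Jordan one, because \<kappa> may identify points where \<open>v\<close> has
  different signs. Hence the appeal to independence of the decomposition.\<close>

lemma weighted_image_real:
  fixes f :: "'a \<Rightarrow> complex"
  assumes P: "finite_measure P" and \<kappa>[measurable]: "\<kappa> \<in> P \<rightarrow>\<^sub>M M"
    and v[measurable]: "v \<in> borel_measurable P" and bnd: "\<And>x. \<bar>v x\<bar> \<le> C"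
    and \<rho>: "\<And>A. A \<in> sets M \<Longrightarrow> \<rho> A = (\<integral>x. indicator A (\<kappa> x) * v x \<partial>P)"
  shows "countably_summing M \<rho>"
    and "f \<in> borel_measurable M \<Longrightarrow> integrable P (\<lambda>x. f (\<kappa> x)) \<Longrightarrow>
      integral\<^sup>L (positive_part M \<rho>) f - integral\<^sup>L (positive_part M (\<lambda>A. - \<rho> A)) f =
      (\<integral>x. v x *\<^sub>R f (\<kappa> x) \<partial>P)"
proof -
  interpret finite_measure P by fact
  define N where "N u = distr (density P (\<lambda>x. ennreal (max 0 (u x)))) M \<kappa>" for u :: "'b \<Rightarrow> real"
  have \<kappa>'[measurable]: "\<kappa> \<in> density P g \<rightarrow>\<^sub>M M" for g :: "'b \<Rightarrow> ennreal" by simp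
  have em: "emeasure (N u) A = ennreal (\<integral>x. indicator A (\<kappa> x) * max 0 (u x) \<partial>P)"
    and ib: "integrable P (\<lambda>x. indicator A (\<kappa> x) * max 0 (u x))"
    if A[measurable]: "A \<in> sets M" and [measurable]: "u \<in> borel_measurable P" and b: "\<And>x. \<bar>u x\<bar> \<le> C" for A u
  proof -
    show i: "integrable P (\<lambda>x. indicator A (\<kappa> x) * max 0 (u x))"
    proof (rule integrable_const_bound[of _ C])
      show "AE x in P. norm (indicator A (\<kappa> x) * max 0 (u x)) \<le> C"
      proof (rule AE_I2)
        fix x show "norm (indicator A (\<kappa> x) * max 0 (u x)) \<le> C"
          using b[of x] by (auto simp: indicator_def)
      qed
    qed simp
    have "emeasure (N u) A = (\<integral>\<^sup>+x. ennreal (max 0 (u x)) * indicator (\<kappa> -` A \<inter> space P) x \<partial>P)"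
      unfolding N_def by (simp add: emeasure_distr emeasure_density)
    also have "\<dots> = (\<integral>\<^sup>+x. ennreal (indicator A (\<kappa> x) * max 0 (u x)) \<partial>P)"
      by (intro nn_integral_cong) (auto simp: indicator_def)
    also have "\<dots> = ennreal (\<integral>x. indicator A (\<kappa> x) * max 0 (u x) \<partial>P)"
      using i by (intro nn_integral_eq_integral) auto
    finally show "emeasure (N u) A = ennreal (\<integral>x. indicator A (\<kappa> x) * max 0 (u x) \<partial>P)" .
  qed
  have sN: "sets (N u) = sets M" "space (N u) = space M" for u by (simp_all add: N_def)
  have fN: "finite_measure (N u)" if "u \<in> borel_measurable P" "\<And>x. \<bar>u x\<bar> \<le> C" for u
    by (rule finite_measureI) (use em[OF sets.top that] in \<open>simp add: sN\<close>)
  have bm: "\<And>x. \<bar>- v x\<bar> \<le> C" using bnd by simp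
  have vm: "(\<lambda>x. - v x) \<in> borel_measurable P" by simp
  have diff: "\<rho> A = measure (N v) A - measure (N (\<lambda>x. - v x)) A" if A: "A \<in> sets M" for A
  proof -
    have "measure (N v) A = (\<integral>x. indicator A (\<kappa> x) * max 0 (v x) \<partial>P)"
      "measure (N (\<lambda>x. - v x)) A = (\<integral>x. indicator A (\<kappa> x) * max 0 (- v x) \<partial>P)"
      unfolding measure_def by (simp_all add: em[OF A v bnd] em[OF A vm bm])
    then show ?thesis
      unfolding \<rho>[OF A] using ib[OF A v bnd] ib[OF A vm bm]
      by (simp flip: Bochner_Integration.integral_diff right_diff_distrib)
         (intro Bochner_Integration.integral_cong, auto simp: max_def)
  qed
  show "countably_summing M \<rho>"
    by (rule countably_summing_diff[OF fN[OF v bnd] fN[OF vm bm] sN(1) sN(1) diff])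
  assume fm[measurable]: "f \<in> borel_measurable M" and fi: "integrable P (\<lambda>x. f (\<kappa> x))"
  have iu: "integrable P (\<lambda>x. u x *\<^sub>R f (\<kappa> x))" if [measurable]: "u \<in> borel_measurable P" and b: "\<And>x. \<bar>u x\<bar> \<le> C" for u
  proof (rule Bochner_Integration.integrable_bound[of P "\<lambda>x. C *\<^sub>R f (\<kappa> x)"])
    show "AE x in P. norm (u x *\<^sub>R f (\<kappa> x)) \<le> norm (C *\<^sub>R f (\<kappa> x))"
    proof (rule AE_I2)
      fix x show "norm (u x *\<^sub>R f (\<kappa> x)) \<le> norm (C *\<^sub>R f (\<kappa> x))"
        using b[of x] by (simp add: mult_right_mono)
    qed
  qed (use fi in auto)
  have iN: "integrable (N u) f" "integral\<^sup>L (N u) f = (\<integral>x. max 0 (u x) *\<^sub>R f (\<kappa> x) \<partial>P)"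
    if [measurable]: "u \<in> borel_measurable P" and b: "\<And>x. \<bar>u x\<bar> \<le> C" for u
  proof -
    have "integrable P (\<lambda>x. max 0 (u x) *\<^sub>R f (\<kappa> x))"
    proof (rule iu)
      show "\<bar>max 0 (u x)\<bar> \<le> C" for x using b[of x] by linarith
    qed simp
    then show "integrable (N u) f"
      unfolding N_def by (simp add: integrable_distr_eq integrable_density)
    show "integral\<^sup>L (N u) f = (\<integral>x. max 0 (u x) *\<^sub>R f (\<kappa> x) \<partial>P)"
      unfolding N_def by (simp add: integral_distr integral_density)
  qed
  have mp: "integrable P (\<lambda>x. max 0 (v x) *\<^sub>R f (\<kappa> x))" "integrable P (\<lambda>x. max 0 (- v x) *\<^sub>R f (\<kappa> x))"
  proof -
    show "integrable P (\<lambda>x. max 0 (v x) *\<^sub>R f (\<kappa> x))"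
    proof (rule iu)
      show "\<bar>max 0 (v x)\<bar> \<le> C" for x using bnd[of x] by linarith
    qed simp
    show "integrable P (\<lambda>x. max 0 (- v x) *\<^sub>R f (\<kappa> x))"
    proof (rule iu)
      show "\<bar>max 0 (- v x)\<bar> \<le> C" for x using bnd[of x] by linarith
    qed simp
  qed
  have "integral\<^sup>L (positive_part M \<rho>) f - integral\<^sup>L (positive_part M (\<lambda>A. - \<rho> A)) f =
      integral\<^sup>L (N v) f - integral\<^sup>L (N (\<lambda>x. - v x)) f"
    by (rule jordan_integral_eq[OF fN[OF v bnd] fN[OF vm bm] sN(1) sN(1) diff iN(1)[OF v bnd] iN(1)[OF vm bm]])
  also have "\<dots> = (\<integral>x. max 0 (v x) *\<^sub>R f (\<kappa> x) - max 0 (- v x) *\<^sub>R f (\<kappa> x) \<partial>P)"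
    using mp by (simp add: iN(2)[OF v bnd] iN(2)[OF vm bm])
  also have "\<dots> = (\<integral>x. v x *\<^sub>R f (\<kappa> x) \<partial>P)"
    by (intro Bochner_Integration.integral_cong) (auto simp: max_def simp flip: scaleR_diff_left)
  finally show "integral\<^sup>L (positive_part M \<rho>) f - integral\<^sup>L (positive_part M (\<lambda>A. - \<rho> A)) f =
      (\<integral>x. v x *\<^sub>R f (\<kappa> x) \<partial>P)" .
qed

text \<open>This replaces the four-term \<open>cm_integral\<close> by a single integral over
  \<open>P\<close>, by treating the real and imaginary parts of \<open>w\<close> separately.
  Boundedness of \<open>w\<close> is what makes integrability of \<open>f (\<kappa> x)\<close> a
  sufficient condition.\<close>

lemma
  fixes f :: "'a \<Rightarrow> complex"
  assumes P: "finite_measure P" and \<kappa>[measurable]: "\<kappa> \<in> P \<rightarrow>\<^sub>M M"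
    and w[measurable]: "w \<in> borel_measurable P" and bnd: "\<And>x. cmod (w x) \<le> C"
  shows complex_measure_weighted_image: "complex_measure M (weighted_image P \<kappa> w M)"
    and cm_integral_weighted_image:
      "f \<in> borel_measurable M \<Longrightarrow> integrable P (\<lambda>x. f (\<kappa> x)) \<Longrightarrow>
       cm_integral M (weighted_image P \<kappa> w M) f = (\<integral>x. w x * f (\<kappa> x) \<partial>P)"
proof -
  interpret finite_measure P by fact
  let ?\<mu> = "weighted_image P \<kappa> w M"
  have iw: "integrable P (\<lambda>x. indicator A (\<kappa> x) * w x)" if [measurable]: "A \<in> sets M" for A
  proof (rule integrable_const_bound[of _ C])
    show "AE x in P. cmod (indicator A (\<kappa> x) * w x) \<le> C"
    proof (rule AE_I2)
      fix x show "cmod (indicator A (\<kappa> x) * w x) \<le> C"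
        using bnd[of x] norm_ge_zero[of "w x"] by (auto simp: indicator_def intro: order_trans simp del: norm_ge_zero)
    qed
  qed simp
  have bR: "\<bar>Re (w x)\<bar> \<le> C" and bI: "\<bar>Im (w x)\<bar> \<le> C" for x
    using bnd[of x] abs_Re_le_cmod[of "w x"] abs_Im_le_cmod[of "w x"] by linarith+
  have R: "Re (?\<mu> A) = (\<integral>x. indicator A (\<kappa> x) * Re (w x) \<partial>P)" if A: "A \<in> sets M" for A
    unfolding weighted_image_def using A iw[OF A]
    by (simp flip: integral_Re) (auto intro!: Bochner_Integration.integral_cong simp: indicator_def)
  have I: "Im (?\<mu> A) = (\<integral>x. indicator A (\<kappa> x) * Im (w x) \<partial>P)" if A: "A \<in> sets M" for A
    unfolding weighted_image_def using A iw[OF A]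
    by (simp flip: integral_Im) (auto intro!: Bochner_Integration.integral_cong simp: indicator_def)
  have mR: "(\<lambda>x. Re (w x)) \<in> borel_measurable P" "(\<lambda>x. Im (w x)) \<in> borel_measurable P" by auto
  have csR: "countably_summing M (\<lambda>A. Re (?\<mu> A))" and csI: "countably_summing M (\<lambda>A. Im (?\<mu> A))"
    by (rule weighted_image_real(1)[OF P \<kappa> mR(1) bR R] weighted_image_real(1)[OF P \<kappa> mR(2) bI I]; assumption)+
  show "complex_measure M ?\<mu>"
    unfolding complex_measure_def
  proof (intro conjI allI impI)
    fix A :: "nat \<Rightarrow> 'a set" assume A: "range A \<subseteq> sets M" "disjoint_family A"
    show "(\<lambda>i. ?\<mu> (A i)) sums ?\<mu> (\<Union>i. A i)"
      unfolding sums_complex_iff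
      using countably_summingD[OF csR A] countably_summingD[OF csI A] by blast
  qed (simp add: weighted_image_def)
  assume f: "f \<in> borel_measurable M" "integrable P (\<lambda>x. f (\<kappa> x))"
  note [measurable] = f(1)
  have ib: "integrable P (\<lambda>x. u x *\<^sub>R f (\<kappa> x))" if [measurable]: "u \<in> borel_measurable P" and b: "\<And>x. \<bar>u x\<bar> \<le> C" for u
  proof (rule Bochner_Integration.integrable_bound[of P "\<lambda>x. C *\<^sub>R f (\<kappa> x)"])
    show "AE x in P. norm (u x *\<^sub>R f (\<kappa> x)) \<le> norm (C *\<^sub>R f (\<kappa> x))"
    proof (rule AE_I2)
      fix x show "norm (u x *\<^sub>R f (\<kappa> x)) \<le> norm (C *\<^sub>R f (\<kappa> x))"
        using b[of x] by (simp add: mult_right_mono)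
    qed
  qed (use f in auto)
  have "cm_integral M ?\<mu> f = (\<integral>x. Re (w x) *\<^sub>R f (\<kappa> x) \<partial>P) + \<i> * (\<integral>x. Im (w x) *\<^sub>R f (\<kappa> x) \<partial>P)"
    unfolding cm_integral_def
    by (subst weighted_image_real(2)[OF P \<kappa> mR(1) bR R f], assumption,
        subst weighted_image_real(2)[OF P \<kappa> mR(2) bI I f], assumption, rule refl)
  also have "\<dots> = (\<integral>x. Re (w x) *\<^sub>R f (\<kappa> x) + \<i> * (Im (w x) *\<^sub>R f (\<kappa> x)) \<partial>P)"
    using ib[OF mR(1) bR] ib[OF mR(2) bI]
    by (subst Bochner_Integration.integral_add) (auto simp del: mult_scaleR_right)
  also have "\<dots> = (\<integral>x. w x * f (\<kappa> x) \<partial>P)"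
    by (intro Bochner_Integration.integral_cong refl) (simp add: complex_eq_iff algebra_simps)
  finally show "cm_integral M ?\<mu> f = (\<integral>x. w x * f (\<kappa> x) \<partial>P)" .
qed

text \<open>The modulus of an integrable, possibly unbounded weight moves into the measure and
  leaves the bounded weight \<open>sgn (w x)\<close>; at zeros of \<open>w\<close> both sides
  vanish.\<close>

lemma weighted_image_polar:
  assumes w: "integrable P w" and \<kappa>[measurable]: "\<kappa> \<in> P \<rightarrow>\<^sub>M M"
  shows "finite_measure (density P (\<lambda>x. ennreal (cmod (w x))))"
    and "v \<in> borel_measurable P \<Longrightarrow> weighted_image P \<kappa> (\<lambda>x. w x * v x) M =
      weighted_image (density P (\<lambda>x. ennreal (cmod (w x)))) \<kappa> (\<lambda>x. sgn (w x) * v x) M"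
proof -
  note [measurable] = borel_measurable_integrable[OF w]
  show "finite_measure (density P (\<lambda>x. ennreal (cmod (w x))))"
  proof (rule finite_measureI)
    have "emeasure (density P (\<lambda>x. ennreal (cmod (w x)))) (space P) = (\<integral>\<^sup>+x. ennreal (cmod (w x)) \<partial>P)"
      by (simp add: emeasure_density cong: nn_integral_cong)
    also have "\<dots> < \<infinity>" using w by (simp add: integrable_iff_bounded)
    finally show "emeasure (density P (\<lambda>x. ennreal (cmod (w x)))) (space (density P (\<lambda>x. ennreal (cmod (w x))))) \<noteq> \<infinity>"
      by simp
  qed
  assume [measurable]: "v \<in> borel_measurable P"
  show "weighted_image P \<kappa> (\<lambda>x. w x * v x) M = weighted_image (density P (\<lambda>x. ennreal (cmod (w x)))) \<kappa> (\<lambda>x. sgn (w x) * v x) M"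
  proof (rule ext)
    fix A
    show "weighted_image P \<kappa> (\<lambda>x. w x * v x) M A = weighted_image (density P (\<lambda>x. ennreal (cmod (w x)))) \<kappa> (\<lambda>x. sgn (w x) * v x) M A"
    proof (cases "A \<in> sets M")
      case True
      note [measurable] = True
      have "cmod z *\<^sub>R (c * (sgn z * u)) = c * (z * u)" for z c u
        by (cases "z = 0") (simp_all add: sgn_div_norm)
      note s = this
      show ?thesis
        unfolding weighted_image_def using True
        by (subst integral_density)
          (simp_all add: s)
    qed (simp add: weighted_image_def)
  qed
qed

lemma complex_measure_countably_summing:
  assumes "complex_measure M \<mu>"
  shows "countably_summing M (\<lambda>A. Re (\<mu> A))" "countably_summing M (\<lambda>A. Im (\<mu> A))"
  using assms unfolding complex_measure_def countably_summing_def sums_complex_iff by blast+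

section \<open>Radon-Nikodym and polar form of complex measures\<close>

lemma real_Radon_Nikodym:
  assumes "sigma_finite_measure M" and \<rho>: "countably_summing M \<rho>"
    and null: "\<And>B. B \<in> null_sets M \<Longrightarrow> \<rho> B = (0::real)"
  shows "\<exists>h. integrable M h \<and> (\<forall>A\<in>sets M. \<rho> A = (\<integral>x. indicator A x * h x \<partial>M))"
proof -
  interpret sigma_finite_measure M by fact
  have ex: "\<exists>d. integrable M d \<and> (\<forall>A\<in>sets M. integrable M (\<lambda>x. indicator A x * d x) \<and>
      measure (positive_part M \<sigma>) A = (\<integral>x. indicator A x * d x \<partial>M))"
    if \<sigma>: "countably_summing M \<sigma>" and null: "\<And>B. B \<in> null_sets M \<Longrightarrow> \<sigma> B = (0::real)" for \<sigma>
  proof -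
    let ?N = "positive_part M \<sigma>"
    have fN: "finite_measure ?N" by (rule finite_measure_positive_part[OF \<sigma>])
    \<comment> \<open>Measurable subsets of a null set are null, so the supremum that defines the
      positive part vanishes there.\<close>
    have "absolutely_continuous M ?N"
      unfolding absolutely_continuous_def
    proof
      fix A assume A: "A \<in> null_sets M"
      then have "emeasure ?N A = (SUP B\<in>{B \<in> sets M. B \<subseteq> A}. ennreal (\<sigma> B))"
        by (intro emeasure_positive_part[OF \<sigma>]) auto
      also have "\<dots> \<le> 0"
        using A by (intro SUP_least) (auto simp: null null_sets_subset)
      finally show "A \<in> null_sets ?N" using A by (auto simp: null_sets_def)
    qed
    then obtain D where D: "D \<in> borel_measurable M" "AE x in M. RN_deriv M ?N x = ennreal (D x)" "\<And>x. 0 \<le> D x"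
      using real_RN_deriv[OF fN, of thesis] by auto
    have N: "?N = density M (\<lambda>x. ennreal (D x))"
      using density_RN_deriv[OF \<open>absolutely_continuous M ?N\<close>] density_cong[OF _ _ D(2)] D(1) by simp
    have I: "emeasure ?N A = (\<integral>\<^sup>+x. ennreal (indicator A x * D x) \<partial>M)" if A: "A \<in> sets M" for A
      using A D(1) by (subst N) (auto simp: emeasure_density indicator_def intro!: nn_integral_cong)
    have iA: "integrable M (\<lambda>x. indicator A x * D x)" if A: "A \<in> sets M" for A
    proof (rule integrableI_bounded)
      show "(\<integral>\<^sup>+x. ennreal (norm (indicator A x * D x)) \<partial>M) < \<infinity>"
        using I[OF A] finite_measure.emeasure_finite[OF fN, of A] D(3)
        by (simp add: top.not_eq_extremum abs_mult)
    qed (use A D(1) in simp)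
    have "measure ?N A = (\<integral>x. indicator A x * D x \<partial>M)" if A: "A \<in> sets M" for A
      unfolding measure_def I[OF A] using D(3) by (subst nn_integral_eq_integral[OF iA[OF A]]) auto
    moreover have "integrable M D"
      using iA[OF sets.top] by (rule Bochner_Integration.integrable_cong[THEN iffD1, OF refl, rotated]) simp
    ultimately show ?thesis using iA by blast
  qed
  obtain d1 where d1: "integrable M d1" "\<And>A. A \<in> sets M \<Longrightarrow> integrable M (\<lambda>x. indicator A x * d1 x)"
      "\<And>A. A \<in> sets M \<Longrightarrow> measure (positive_part M \<rho>) A = (\<integral>x. indicator A x * d1 x \<partial>M)"
    using ex[OF \<rho> null] by blast
  obtain d2 where d2: "integrable M d2" "\<And>A. A \<in> sets M \<Longrightarrow> integrable M (\<lambda>x. indicator A x * d2 x)"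
      "\<And>A. A \<in> sets M \<Longrightarrow> measure (positive_part M (\<lambda>A. - \<rho> A)) A = (\<integral>x. indicator A x * d2 x \<partial>M)"
    using ex[OF countably_summing_minus[OF \<rho>]] null by auto
  have "\<rho> A = (\<integral>x. indicator A x * (d1 x - d2 x) \<partial>M)" if A: "A \<in> sets M" for A
    unfolding right_diff_distrib Bochner_Integration.integral_diff[OF d1(2)[OF A] d2(2)[OF A]]
    using measure_positive_part_diff[OF \<rho> A] d1(3)[OF A] d2(3)[OF A] by simp
  then show ?thesis
    using d1(1) d2(1) by (intro exI[of _ "\<lambda>x. d1 x - d2 x"]) auto
qed

lemma complex_Radon_Nikodym:
  assumes M: "sigma_finite_measure M" and \<mu>: "complex_measure M \<mu>"
    and null: "\<And>B. B \<in> null_sets M \<Longrightarrow> \<mu> B = 0"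
  shows "\<exists>h. integrable M h \<and> \<mu> = density_cm M h"
proof -
  obtain a where a: "integrable M a" "\<And>A. A \<in> sets M \<Longrightarrow> Re (\<mu> A) = (\<integral>x. indicator A x * a x \<partial>M)"
    using real_Radon_Nikodym[OF M complex_measure_countably_summing(1)[OF \<mu>]] null by auto
  obtain b where b: "integrable M b" "\<And>A. A \<in> sets M \<Longrightarrow> Im (\<mu> A) = (\<integral>x. indicator A x * b x \<partial>M)"
    using real_Radon_Nikodym[OF M complex_measure_countably_summing(2)[OF \<mu>]] null by auto
  define h where "h x = complex_of_real (a x) + \<i> * complex_of_real (b x)" for x
  have ih: "integrable M h"
    unfolding h_def using a b by (intro Bochner_Integration.integrable_add integrable_mult_right integrable_of_real)
  have "\<mu> A = density_cm M h A" for A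
  proof (cases "A \<in> sets M")
    case A: True
    have iA: "integrable M (\<lambda>x. indicator A x *\<^sub>R h x)"
      using A ih by (rule integrable_mult_indicator)
    have "Re (\<integral>x. indicator A x *\<^sub>R h x \<partial>M) = (\<integral>x. Re (indicator A x *\<^sub>R h x) \<partial>M)"
      "Im (\<integral>x. indicator A x *\<^sub>R h x \<partial>M) = (\<integral>x. Im (indicator A x *\<^sub>R h x) \<partial>M)"
      by (rule integral_Re[OF iA, symmetric] integral_Im[OF iA, symmetric])+
    then show ?thesis
      using A a(2)[OF A] b(2)[OF A]
      by (simp add: density_cm_def set_lebesgue_integral_def complex_eq_iff h_def)
  qed (use \<mu> in \<open>simp add: density_cm_def complex_measure_def\<close>)
  with ih show ?thesis by blast
qed

lemma density_cm_eq_weighted_image: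
  assumes "integrable M h"
  shows "density_cm M h = weighted_image (density M (\<lambda>x. ennreal (cmod (h x)))) (\<lambda>x. x) (\<lambda>x. sgn (h x)) M"
proof -
  have "density_cm M h = weighted_image M (\<lambda>x. x) (\<lambda>x. h x * 1) M"
    by (rule ext, unfold density_cm_def weighted_image_def set_lebesgue_integral_def)
      (auto intro!: Bochner_Integration.integral_cong simp: indicator_def)
  then show ?thesis
    using weighted_image_polar(2)[OF assms measurable_ident_sets, of M "\<lambda>_. 1"] by simp
qed

text \<open>The sum of the four Jordan parts is a finite control measure. Radon-Nikodym against it,
  followed by the polar form, leaves a weight of modulus at most 1.\<close>

lemma complex_measure_representation:
  assumes \<mu>: "complex_measure M \<mu>"
  obtains P \<theta> where "finite_measure P" "sets P = sets M" "\<theta> \<in> borel_measurable P"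
    "\<And>x. cmod (\<theta> x) \<le> 1" "\<mu> = weighted_image P (\<lambda>x. x) \<theta> M"
proof -
  note c = complex_measure_countably_summing[OF \<mu>]
  note c' = c[THEN countably_summing_minus]
  obtain P1 where P1: "sets P1 = sets M" "\<And>A. emeasure P1 A =
      emeasure (positive_part M (\<lambda>A. Re (\<mu> A))) A + emeasure (positive_part M (\<lambda>A. - Re (\<mu> A))) A"
    using exists_sum_measure[of "positive_part M (\<lambda>A. Re (\<mu> A))" M "positive_part M (\<lambda>A. - Re (\<mu> A))"] by auto
  obtain P2 where P2: "sets P2 = sets M" "\<And>A. emeasure P2 A =
      emeasure (positive_part M (\<lambda>A. Im (\<mu> A))) A + emeasure (positive_part M (\<lambda>A. - Im (\<mu> A))) A"
    using exists_sum_measure[of "positive_part M (\<lambda>A. Im (\<mu> A))" M "positive_part M (\<lambda>A. - Im (\<mu> A))"] by auto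
  obtain P where P: "sets P = sets M" "\<And>A. emeasure P A = emeasure P1 A + emeasure P2 A"
    using exists_sum_measure[OF P1(1) P2(1)] by blast
  note fin = finite_measure_positive_part[OF c(1)] finite_measure_positive_part[OF c(2)]
    finite_measure_positive_part[OF c'(1)] finite_measure_positive_part[OF c'(2)]
  have fP: "finite_measure P"
    by (rule finite_measureI) (use fin in \<open>simp add: P P1 P2 finite_measure.emeasure_eq_measure\<close>)
  have "\<mu> B = 0" if "B \<in> null_sets P" for B
  proof -
    have B: "B \<in> sets M" using that P(1) by auto
    have "emeasure P B = 0" using that by auto
    then have "measure (positive_part M (\<lambda>A. Re (\<mu> A))) B = 0" "measure (positive_part M (\<lambda>A. - Re (\<mu> A))) B = 0"
      "measure (positive_part M (\<lambda>A. Im (\<mu> A))) B = 0" "measure (positive_part M (\<lambda>A. - Im (\<mu> A))) B = 0"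
      by (auto simp: P P1 P2 measure_def)
    then show ?thesis
      using measure_positive_part_diff[OF c(1) B] measure_positive_part_diff[OF c(2) B]
      by (simp add: complex_eq_iff)
  qed
  moreover have "complex_measure P \<mu>" using \<mu> P(1) by (simp add: complex_measure_def)
  ultimately obtain h where h: "integrable P h" "\<mu> = density_cm P h"
    using complex_Radon_Nikodym[OF finite_measure.axioms(1)[OF fP]] by blast
  show thesis
  proof (rule that)
    show "finite_measure (density P (\<lambda>x. ennreal (cmod (h x))))"
      by (rule weighted_image_polar(1)[OF h(1) measurable_ident_sets[OF refl]])
    show "\<mu> = weighted_image (density P (\<lambda>x. ennreal (cmod (h x)))) (\<lambda>x. x) (\<lambda>x. sgn (h x)) M"
      unfolding h(2) density_cm_eq_weighted_image[OF h(1)] by (rule ext) (simp add: weighted_image_def P(1))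
    show "(\<lambda>x. sgn (h x)) \<in> borel_measurable (density P (\<lambda>x. ennreal (cmod (h x))))"
      using borel_measurable_integrable[OF h(1)] by (simp add: sgn_div_norm)
  qed (simp_all add: P(1) norm_sgn)
qed

section \<open>Square integrable functions and operators on \<open>L\<^sup>2\<close>\<close>

text \<open>Valued in \<open>ennreal\<close> so that Tonelli and Cauchy-Schwarz apply before square
  integrability is known; the latter is finiteness of this value.\<close>

definition sq_norm :: "'a measure \<Rightarrow> ('a \<Rightarrow> complex) \<Rightarrow> ennreal" where
  "sq_norm m \<xi> = (\<integral>\<^sup>+x. ennreal (cmod (\<xi> x)) ^ 2 \<partial>m)"

lemma L2_fun_iff: "\<xi> \<in> L2_fun m \<longleftrightarrow> \<xi> \<in> borel_measurable m \<and> sq_norm m \<xi> < \<infinity>"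
  unfolding L2_fun_def sq_norm_def by (auto simp: integrable_iff_bounded ennreal_power)

lemma L2_fun_measurable[measurable_dest]: "\<xi> \<in> L2_fun m \<Longrightarrow> \<xi> \<in> borel_measurable m"
  by (simp add: L2_fun_def)

lemma sq_norm_cong_AE: "AE x in m. \<xi> x = \<eta> x \<Longrightarrow> sq_norm m \<xi> = sq_norm m \<eta>"
  unfolding sq_norm_def by (intro nn_integral_cong_AE) auto

lemma sq_norm_scale: "\<xi> \<in> borel_measurable m \<Longrightarrow> sq_norm m (\<lambda>x. z * \<xi> x) = ennreal (cmod z) ^ 2 * sq_norm m \<xi>"
  unfolding sq_norm_def by (subst nn_integral_cmult[symmetric]) (auto simp: norm_mult ennreal_mult power_mult_distrib)

lemma cmod_add_squared_le: "(cmod (a + b))\<^sup>2 \<le> 2 * (cmod a)\<^sup>2 + 2 * (cmod b)\<^sup>2"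
proof -
  have "(cmod (a + b))\<^sup>2 \<le> (cmod a + cmod b)\<^sup>2"
    by (intro power_mono norm_triangle_ineq) auto
  also have "\<dots> \<le> 2 * (cmod a)\<^sup>2 + 2 * (cmod b)\<^sup>2"
    using zero_le_power2[of "cmod a - cmod b"] by (simp add: power2_eq_square algebra_simps)
  finally show ?thesis .
qed

lemma L2_fun_add: "\<xi> \<in> L2_fun m \<Longrightarrow> \<eta> \<in> L2_fun m \<Longrightarrow> (\<lambda>x. \<xi> x + \<eta> x) \<in> L2_fun m"
proof -
  assume \<xi>: "\<xi> \<in> L2_fun m" and \<eta>: "\<eta> \<in> L2_fun m"
  then have [measurable]: "\<xi> \<in> borel_measurable m" "\<eta> \<in> borel_measurable m"
    by (simp_all add: L2_fun_def)
  have "integrable m (\<lambda>x. (cmod (\<xi> x + \<eta> x))\<^sup>2)"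
  proof (rule Bochner_Integration.integrable_bound)
    show "integrable m (\<lambda>x. 2 * (cmod (\<xi> x))\<^sup>2 + 2 * (cmod (\<eta> x))\<^sup>2)"
      using \<xi> \<eta> by (simp add: L2_fun_def)
    show "AE x in m. norm ((cmod (\<xi> x + \<eta> x))\<^sup>2) \<le> norm (2 * (cmod (\<xi> x))\<^sup>2 + 2 * (cmod (\<eta> x))\<^sup>2)"
      by (rule AE_I2) (simp add: cmod_add_squared_le)
  qed simp
  then show ?thesis by (simp add: L2_fun_def)
qed

lemma L2_fun_scale: "\<xi> \<in> L2_fun m \<Longrightarrow> (\<lambda>x. z * \<xi> x) \<in> L2_fun m"
  unfolding L2_fun_def by (auto simp: norm_mult power_mult_distrib)

lemma L2_fun_diff: "\<xi> \<in> L2_fun m \<Longrightarrow> \<eta> \<in> L2_fun m \<Longrightarrow> (\<lambda>x. \<xi> x - \<eta> x) \<in> L2_fun m"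
  using L2_fun_add[of \<xi> m "\<lambda>x. - 1 * \<eta> x"] L2_fun_scale[of \<eta> m "- 1"] by simp

lemma L2_fun_zero: "(\<lambda>x. 0) \<in> L2_fun m"
  by (simp add: L2_fun_def)

lemma L2_class_cong_AE: "AE x in m. \<xi> x = \<eta> x \<Longrightarrow> L2_class m \<xi> = L2_class m \<eta>"
  unfolding L2_class_def by (auto elim: AE_mp)

lemma L2_class_self: "\<xi> \<in> L2_fun m \<Longrightarrow> \<xi> \<in> L2_class m \<xi>"
  by (simp add: L2_class_def)

lemma L2_class_in_L2: "\<xi> \<in> L2_fun m \<Longrightarrow> L2_class m \<xi> \<in> L2 m"
  by (simp add: L2_def)

lemma L2_class_eqD: "L2_class m \<xi> = L2_class m \<eta> \<Longrightarrow> \<xi> \<in> L2_fun m \<Longrightarrow> AE x in m. \<xi> x = \<eta> x"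
  using L2_class_self[of \<xi> m] by (auto simp: L2_class_def)

lemma L2_rep_class:
  assumes "\<xi> \<in> L2_fun m"
  shows "L2_rep (L2_class m \<xi>) \<in> L2_fun m" "AE x in m. L2_rep (L2_class m \<xi>) x = \<xi> x"
  using someI[of "\<lambda>\<eta>. \<eta> \<in> L2_class m \<xi>", OF L2_class_self[OF assms]]
  unfolding L2_rep_def by (auto simp: L2_class_def)

lemma L2_rep:
  assumes "c \<in> L2 m"
  shows "L2_rep c \<in> L2_fun m" "L2_class m (L2_rep c) = c"
proof -
  obtain \<xi> where \<xi>: "\<xi> \<in> L2_fun m" "c = L2_class m \<xi>" using assms by (auto simp: L2_def)
  show "L2_rep c \<in> L2_fun m" unfolding \<xi>(2) by (rule L2_rep_class(1)[OF \<xi>(1)])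
  show "L2_class m (L2_rep c) = c"
    unfolding \<xi>(2) by (rule L2_class_cong_AE[OF L2_rep_class(2)[OF \<xi>(1)]])
qed

lemma L2_norm_class: "\<xi> \<in> L2_fun m \<Longrightarrow> ennreal (L2_norm m (L2_class m \<xi>)) ^ 2 = sq_norm m \<xi>"
proof -
  assume \<xi>: "\<xi> \<in> L2_fun m"
  have r: "L2_rep (L2_class m \<xi>) \<in> L2_fun m" using L2_rep_class[OF \<xi>] by simp
  have "ennreal (L2_norm m (L2_class m \<xi>)) ^ 2 = ennreal (\<integral>x. (cmod (L2_rep (L2_class m \<xi>) x))\<^sup>2 \<partial>m)"
    by (simp add: L2_norm_def ennreal_power)
  also have "\<dots> = sq_norm m (L2_rep (L2_class m \<xi>))"
    unfolding sq_norm_def using r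
    by (subst nn_integral_eq_integral[symmetric]) (auto simp: L2_fun_def ennreal_power)
  also have "\<dots> = sq_norm m \<xi>"
    using L2_rep_class[OF \<xi>] by (intro sq_norm_cong_AE) auto
  finally show ?thesis .
qed

lemma L2_norm_nonneg: "0 \<le> L2_norm m c"
  by (simp add: L2_norm_def)

text \<open>Moves estimates between classes, on which operator norms are defined, and functions, on
  which integrals are computed. Squares avoid roots of extended values.\<close>

lemma L2_norm_class_le_iff:
  assumes "\<xi> \<in> L2_fun m" "\<eta> \<in> L2_fun n" "0 \<le> K"
  shows "L2_norm m (L2_class m \<xi>) \<le> K * L2_norm n (L2_class n \<eta>) \<longleftrightarrow>
    sq_norm m \<xi> \<le> ennreal K ^ 2 * sq_norm n \<eta>"
proof -
  have "sq_norm m \<xi> \<le> ennreal K ^ 2 * sq_norm n \<eta> \<longleftrightarrow>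
     ennreal ((L2_norm m (L2_class m \<xi>))\<^sup>2) \<le> ennreal ((K * L2_norm n (L2_class n \<eta>))\<^sup>2)"
    using assms by (simp add: L2_norm_class[symmetric] ennreal_power ennreal_mult power_mult_distrib L2_norm_nonneg)
  also have "\<dots> \<longleftrightarrow> L2_norm m (L2_class m \<xi>) \<le> K * L2_norm n (L2_class n \<eta>)"
    using assms(3) by (simp add: L2_norm_nonneg power2_le_iff_abs_le abs_mult)
  finally show ?thesis by simp
qed

lemma L2_scale_class:
  assumes "\<xi> \<in> L2_fun m"
  shows "L2_scale m z (L2_class m \<xi>) = L2_class m (\<lambda>x. z * \<xi> x)"
  unfolding L2_scale_def
proof (rule L2_class_cong_AE)
  show "AE x in m. z * L2_rep (L2_class m \<xi>) x = z * \<xi> x"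
    using L2_rep_class(2)[OF assms] by eventually_elim simp
qed

lemma L2_norm_scale:
  assumes "c \<in> L2 m"
  shows "L2_norm m (L2_scale m z c) = cmod z * L2_norm m c"
proof -
  obtain \<xi> where \<xi>: "\<xi> \<in> L2_fun m" "c = L2_class m \<xi>" using assms by (auto simp: L2_def)
  have "L2_scale m z c = L2_class m (\<lambda>x. z * \<xi> x)"
    unfolding \<xi>(2) by (rule L2_scale_class[OF \<xi>(1)])
  then have "ennreal (L2_norm m (L2_scale m z c)) ^ 2 = ennreal (cmod z) ^ 2 * ennreal (L2_norm m c) ^ 2"
    using \<xi> by (simp add: L2_norm_class L2_fun_scale sq_norm_scale L2_fun_measurable)
  then have "ennreal ((L2_norm m (L2_scale m z c))\<^sup>2) = ennreal ((cmod z * L2_norm m c)\<^sup>2)"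
    by (simp add: ennreal_power ennreal_mult power_mult_distrib L2_norm_nonneg)
  then show ?thesis
    by (simp add: L2_norm_nonneg)
qed

text \<open>\<open>op_norm\<close> is a supremum of reals, so the family must first be known to be
  bounded. That is the purpose of \<open>K\<close>, which also settles classes of norm 0; the others
  are scaled to the unit ball.\<close>

lemma L2_op_norm_bound:
  assumes hom: "\<And>z c. c \<in> L2 m \<Longrightarrow> L2_norm m (D (L2_scale m z c)) = cmod z * L2_norm m (D c)"
    and bnd: "\<And>c. c \<in> L2 m \<Longrightarrow> L2_norm m (D c) \<le> K * L2_norm m c"
    and c: "c \<in> L2 m"
  shows "L2_norm m (D c) \<le> op_norm m D * L2_norm m c"
proof (cases "L2_norm m c = 0")
  case True
  then show ?thesis using bnd[OF c] by simp
next
  case False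
  then have pos: "L2_norm m c > 0" using L2_norm_nonneg[of m c] by simp
  define z where "z = complex_of_real (1 / L2_norm m c)"
  have cz: "cmod z = 1 / L2_norm m c" using pos by (simp add: z_def norm_divide)
  have "L2_scale m z c \<in> L2 m"
    unfolding L2_scale_def using L2_rep[OF c] by (intro L2_class_in_L2 L2_fun_scale) auto
  moreover have "L2_norm m (L2_scale m z c) \<le> 1"
    using pos by (simp add: L2_norm_scale[OF c] cz)
  moreover have "bdd_above ((\<lambda>c. L2_norm m (D c)) ` {c \<in> L2 m. L2_norm m c \<le> 1})"
  proof (rule bdd_aboveI)
    fix r assume "r \<in> (\<lambda>c. L2_norm m (D c)) ` {c \<in> L2 m. L2_norm m c \<le> 1}"
    then obtain d where d: "d \<in> L2 m" "L2_norm m d \<le> 1" "r = L2_norm m (D d)" by auto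
    have "r \<le> K * L2_norm m d" using bnd d by simp
    also have "\<dots> \<le> \<bar>K\<bar> * 1"
      using d(2) L2_norm_nonneg[of m d] by (intro mult_mono) auto
    finally show "r \<le> \<bar>K\<bar>" by simp
  qed
  ultimately have "L2_norm m (D (L2_scale m z c)) \<le> op_norm m D"
    unfolding op_norm_def by (intro cSUP_upper) auto
  then show ?thesis
    using pos by (simp add: hom[OF c] cz field_simps)
qed

lemma op_norm_le:
  assumes "\<And>c. c \<in> L2 m \<Longrightarrow> L2_norm m (D c) \<le> K * L2_norm m c" "0 \<le> K"
  shows "op_norm m D \<le> K"
  unfolding op_norm_def
proof (rule cSUP_least)
  have "L2_norm m (L2_zero m) = 0"
    using L2_norm_class[OF L2_fun_zero, of m] by (simp add: L2_zero_def sq_norm_def L2_norm_nonneg)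
  then show "{c \<in> L2 m. L2_norm m c \<le> 1} \<noteq> {}"
    using L2_class_in_L2[OF L2_fun_zero, of m] by (auto simp: L2_zero_def intro!: exI[of _ "L2_zero m"])
  fix c assume c: "c \<in> {c \<in> L2 m. L2_norm m c \<le> 1}"
  then have "L2_norm m (D c) \<le> K * L2_norm m c" using assms by simp
  also have "\<dots> \<le> K * 1" using c assms(2) by (intro mult_left_mono) auto
  finally show "L2_norm m (D c) \<le> K" by simp
qed

text \<open>The Jordan parts depend only on the \<sigma>-algebra, so a Haar measure can stand in for
  \<open>borel_of T\<close>.\<close>

lemma cm_integral_cong_sets:
  "sets M = sets N \<Longrightarrow> cm_integral M \<mu> f = cm_integral N \<mu> f"
  unfolding cm_integral_def positive_part_def using sets_eq_imp_space_eq[of M N] by simp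

lemma norm_integral_le_nn_integral:
  fixes f :: "'z \<Rightarrow> complex"
  shows "ennreal (norm (integral\<^sup>L M f)) \<le> (\<integral>\<^sup>+x. ennreal (norm (f x)) \<partial>M)"
proof (cases "integrable M f")
  case True
  then show ?thesis by (rule integral_norm_bound_ennreal)
qed (simp add: not_integrable_integral_eq)


section \<open>Groups with a left invariant measure\<close>

text \<open>The measurable skeleton of a second countable locally compact group: joint measurability
  of the product, \<sigma>-finiteness and left invariance carry the Fubini arguments over
  translates, and \<open>nonzero\<close> lets points be chosen outside null sets.\<close>

locale measured_group = group G + sigma_finite_measure m
  for G :: "('a, 'c) monoid_scheme" (structure) and m :: "'a measure" +
  assumes space_eq: "space m = carrier G"
    and mult_measurable: "(\<lambda>(x, y). x \<otimes> y) \<in> m \<Otimes>\<^sub>M m \<rightarrow>\<^sub>M m"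
    and inv_measurable: "(\<lambda>x. inv x) \<in> m \<rightarrow>\<^sub>M m"
    and left_invariant: "x \<in> carrier G \<Longrightarrow> A \<in> sets m \<Longrightarrow> emeasure m (x <# A) = emeasure m A"
    and nonzero: "emeasure m (space m) \<noteq> 0"
begin

lemma measurable_mult[measurable (raw)]:
  "f \<in> N \<rightarrow>\<^sub>M m \<Longrightarrow> g \<in> N \<rightarrow>\<^sub>M m \<Longrightarrow> (\<lambda>x. f x \<otimes> g x) \<in> N \<rightarrow>\<^sub>M m"
  using measurable_compose[OF measurable_Pair mult_measurable] by simp

lemma measurable_inv[measurable (raw)]: "f \<in> N \<rightarrow>\<^sub>M m \<Longrightarrow> (\<lambda>x. inv (f x)) \<in> N \<rightarrow>\<^sub>M m"
  using measurable_compose[OF _ inv_measurable] .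

lemma in_carrier: "f \<in> N \<rightarrow>\<^sub>M m \<Longrightarrow> x \<in> space N \<Longrightarrow> f x \<in> carrier G"
  using measurable_space[of f N m x] space_eq by simp

lemma measurable_translate: "x \<in> carrier G \<Longrightarrow> (\<lambda>y. x \<otimes> y) \<in> m \<rightarrow>\<^sub>M m"
  by (intro measurable_mult measurable_const measurable_ident_sets) (simp_all add: space_eq)

lemma distr_translate:
  assumes x: "x \<in> carrier G"
  shows "distr m m (\<lambda>y. x \<otimes> y) = m"
proof (rule measure_eqI)
  note [measurable] = measurable_translate[OF x]
  fix A assume "A \<in> sets (distr m m (\<lambda>y. x \<otimes> y))"
  then have A: "A \<in> sets m" by simp
  then have AG: "A \<subseteq> carrier G" using sets.sets_into_space space_eq by blast
  have "(\<lambda>y. x \<otimes> y) -` A \<inter> space m = inv x <# A"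
  proof (intro equalityI subsetI)
    fix y assume "y \<in> (\<lambda>y. x \<otimes> y) -` A \<inter> space m"
    then have y: "x \<otimes> y \<in> A" "y \<in> carrier G" by (auto simp: space_eq)
    then have "y = inv x \<otimes> (x \<otimes> y)" using x by (simp add: m_assoc[symmetric])
    then show "y \<in> inv x <# A" using y by (auto simp: l_coset_def)
  next
    fix y assume "y \<in> inv x <# A"
    then obtain a where a: "a \<in> A" "y = inv x \<otimes> a" by (auto simp: l_coset_def)
    then have "a \<in> carrier G" using AG by auto
    then show "y \<in> (\<lambda>y. x \<otimes> y) -` A \<inter> space m" using a x by (simp add: space_eq m_assoc[symmetric])
  qed
  then show "emeasure (distr m m (\<lambda>y. x \<otimes> y)) A = emeasure m A"
    using A x by (simp add: emeasure_distr left_invariant)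
qed simp

lemma nn_integral_translate:
  assumes "x \<in> carrier G" "f \<in> borel_measurable m"
  shows "(\<integral>\<^sup>+y. f (x \<otimes> y) \<partial>m) = (\<integral>\<^sup>+y. f y \<partial>m)"
proof -
  have "(\<integral>\<^sup>+y. f (x \<otimes> y) \<partial>m) = (\<integral>\<^sup>+y. f y \<partial>distr m m (\<lambda>y. x \<otimes> y))"
    using assms measurable_translate[OF assms(1)] by (subst nn_integral_distr) auto
  then show ?thesis by (simp add: distr_translate[OF assms(1)])
qed

text \<open>The operator \<lambda> of \<open>weighted_image P \<kappa> w m\<close>, acting on
  functions instead of classes.\<close>

definition wconv :: "'b measure \<Rightarrow> ('b \<Rightarrow> 'a) \<Rightarrow> ('b \<Rightarrow> complex) \<Rightarrow> ('a \<Rightarrow> complex) \<Rightarrow> 'a \<Rightarrow> complex" where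
  "wconv P \<kappa> w \<xi> g = (\<integral>s. w s * \<xi> (inv (\<kappa> s) \<otimes> g) \<partial>P)"

text \<open>After exchanging the integrals, left invariance removes the translation for each
  \<open>s\<close>, and only the mass of \<open>P\<close> remains.\<close>

lemma nn_integral_orbit:
  assumes P: "finite_measure P" and \<kappa>[measurable]: "\<kappa> \<in> P \<rightarrow>\<^sub>M m"
    and f[measurable]: "f \<in> borel_measurable m"
  shows "(\<integral>\<^sup>+g. (\<integral>\<^sup>+s. f (inv (\<kappa> s) \<otimes> g) \<partial>P) \<partial>m) = emeasure P (space P) * (\<integral>\<^sup>+g. f g \<partial>m)"
proof -
  interpret P: finite_measure P by fact
  interpret pair_sigma_finite P m ..
  have "(\<integral>\<^sup>+g. (\<integral>\<^sup>+s. f (inv (\<kappa> s) \<otimes> g) \<partial>P) \<partial>m) = (\<integral>\<^sup>+s. (\<integral>\<^sup>+g. f (inv (\<kappa> s) \<otimes> g) \<partial>m) \<partial>P)"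
    by (rule Fubini') measurable
  also have "\<dots> = (\<integral>\<^sup>+s. (\<integral>\<^sup>+g. f g \<partial>m) \<partial>P)"
    by (intro nn_integral_cong nn_integral_translate f inv_closed in_carrier[OF \<kappa>])
  finally show ?thesis by (simp add: mult.commute)
qed

text \<open>The orbit formula for the modulus of \<xi> - \<eta>: a change on a null set is invisible
  along almost every orbit, which makes the operators well defined on classes.\<close>

lemma AE_orbit:
  assumes P: "finite_measure P" and \<kappa>[measurable]: "\<kappa> \<in> P \<rightarrow>\<^sub>M m"
    and [measurable]: "\<xi> \<in> borel_measurable m" "\<eta> \<in> borel_measurable m"
    and ae: "AE x in m. \<xi> x = (\<eta> x :: complex)"
  shows "AE g in m. AE s in P. \<xi> (inv (\<kappa> s) \<otimes> g) = \<eta> (inv (\<kappa> s) \<otimes> g)"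
proof -
  interpret P: finite_measure P by fact
  let ?f = "\<lambda>x. ennreal (cmod (\<xi> x - \<eta> x))"
  have "(\<integral>\<^sup>+g. ?f g \<partial>m) = 0"
    using ae by (subst nn_integral_0_iff_AE) auto
  then have "(\<integral>\<^sup>+g. (\<integral>\<^sup>+s. ?f (inv (\<kappa> s) \<otimes> g) \<partial>P) \<partial>m) = 0"
    by (subst nn_integral_orbit[OF P \<kappa>]) auto
  then have ae: "AE g in m. (\<integral>\<^sup>+s. ?f (inv (\<kappa> s) \<otimes> g) \<partial>P) = 0"
    by (subst (asm) nn_integral_0_iff_AE) auto
  show ?thesis
  proof (rule AE_mp[OF ae], rule AE_I2, rule impI)
    fix g assume [measurable]: "g \<in> space m" and 0: "(\<integral>\<^sup>+s. ?f (inv (\<kappa> s) \<otimes> g) \<partial>P) = 0"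
    show "AE s in P. \<xi> (inv (\<kappa> s) \<otimes> g) = \<eta> (inv (\<kappa> s) \<otimes> g)"
      using 0 by (subst (asm) nn_integral_0_iff_AE) auto
  qed
qed

lemma wconv_cong_AE:
  assumes P: "finite_measure P" and \<kappa>[measurable]: "\<kappa> \<in> P \<rightarrow>\<^sub>M m"
    and [measurable]: "w \<in> borel_measurable P" "\<xi> \<in> borel_measurable m" "\<eta> \<in> borel_measurable m"
    and ae: "AE x in m. \<xi> x = \<eta> x"
  shows "AE g in m. wconv P \<kappa> w \<xi> g = wconv P \<kappa> w \<eta> g"
  using AE_orbit[OF P \<kappa> assms(4,5) ae]
proof (rule AE_mp, intro AE_I2 impI)
  fix g assume [measurable]: "g \<in> space m" and "AE s in P. \<xi> (inv (\<kappa> s) \<otimes> g) = \<eta> (inv (\<kappa> s) \<otimes> g)"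
  then show "wconv P \<kappa> w \<xi> g = wconv P \<kappa> w \<eta> g"
    unfolding wconv_def by (intro integral_cong_AE) (auto elim: AE_mp)
qed

text \<open>By the orbit formula almost every orbit is square integrable over \<open>P\<close>, and
  \<open>P\<close> is finite.\<close>

lemma integrable_orbit:
  assumes P: "finite_measure P" and \<kappa>[measurable]: "\<kappa> \<in> P \<rightarrow>\<^sub>M m" and \<xi>: "\<xi> \<in> L2_fun m"
  shows "AE g in m. integrable P (\<lambda>s. \<xi> (inv (\<kappa> s) \<otimes> g))"
proof -
  interpret P: finite_measure P by fact
  note [measurable] = L2_fun_measurable[OF \<xi>]
  have "(\<integral>\<^sup>+g. (\<integral>\<^sup>+s. ennreal (cmod (\<xi> (inv (\<kappa> s) \<otimes> g))) ^ 2 \<partial>P) \<partial>m) = emeasure P (space P) * sq_norm m \<xi>"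
    unfolding sq_norm_def by (rule nn_integral_orbit[OF P \<kappa>]) simp
  also have "\<dots> < \<infinity>" using \<xi> by (simp add: L2_fun_iff P.emeasure_eq_measure ennreal_mult_less_top)
  finally have "AE g in m. (\<integral>\<^sup>+s. ennreal (cmod (\<xi> (inv (\<kappa> s) \<otimes> g))) ^ 2 \<partial>P) \<noteq> \<infinity>"
    by (intro nn_integral_PInf_AE) auto
  then show ?thesis
  proof (rule AE_mp, intro AE_I2 impI)
    fix g assume [measurable]: "g \<in> space m"
      and fin: "(\<integral>\<^sup>+s. ennreal (cmod (\<xi> (inv (\<kappa> s) \<otimes> g))) ^ 2 \<partial>P) \<noteq> \<infinity>"
    show "integrable P (\<lambda>s. \<xi> (inv (\<kappa> s) \<otimes> g))"
    proof (rule P.square_integrable_imp_integrable)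
      show "integrable P (\<lambda>s. (\<xi> (inv (\<kappa> s) \<otimes> g))\<^sup>2)"
        using fin by (intro integrableI_bounded) (auto simp: norm_power ennreal_power top.not_eq_extremum)
    qed simp
  qed
qed

lemma wconv_measurable[measurable]:
  assumes P: "finite_measure P" and [measurable]: "\<kappa> \<in> P \<rightarrow>\<^sub>M m" "w \<in> borel_measurable P" "\<xi> \<in> borel_measurable m"
  shows "wconv P \<kappa> w \<xi> \<in> borel_measurable m"
proof -
  interpret P: finite_measure P by fact
  show ?thesis unfolding wconv_def[abs_def] by measurable
qed

text \<open>Cauchy-Schwarz against the constant 1 on \<open>P\<close>, then the orbit formula; each
  step contributes one factor of the mass of \<open>P\<close>.\<close>

lemma sq_norm_wconv_le:
  assumes P: "finite_measure P" and \<kappa>[measurable]: "\<kappa> \<in> P \<rightarrow>\<^sub>M m"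
    and w[measurable]: "w \<in> borel_measurable P" and bnd: "\<And>s. cmod (w s) \<le> C" and \<xi>[measurable]: "\<xi> \<in> borel_measurable m"
  shows "sq_norm m (wconv P \<kappa> w \<xi>) \<le> (ennreal C * emeasure P (space P)) ^ 2 * sq_norm m \<xi>"
proof -
  interpret P: finite_measure P by fact
  have C: "0 \<le> C" using bnd norm_ge_zero order_trans by blast
  have "sq_norm m (wconv P \<kappa> w \<xi>) \<le>
      (\<integral>\<^sup>+g. ennreal C ^ 2 * emeasure P (space P) * (\<integral>\<^sup>+s. ennreal (cmod (\<xi> (inv (\<kappa> s) \<otimes> g))) ^ 2 \<partial>P) \<partial>m)"
    unfolding sq_norm_def
  proof (intro nn_integral_mono)
    fix g assume [measurable]: "g \<in> space m"
    have "ennreal (cmod (wconv P \<kappa> w \<xi> g)) \<le> (\<integral>\<^sup>+s. ennreal (cmod (w s * \<xi> (inv (\<kappa> s) \<otimes> g))) \<partial>P)"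
      unfolding wconv_def by (rule norm_integral_le_nn_integral)
    also have "\<dots> \<le> (\<integral>\<^sup>+s. ennreal C * ennreal (cmod (\<xi> (inv (\<kappa> s) \<otimes> g))) \<partial>P)"
      using bnd C by (intro nn_integral_mono) (auto simp: norm_mult ennreal_mult[symmetric] intro!: ennreal_leI mult_right_mono)
    also have "\<dots> = ennreal C * (\<integral>\<^sup>+s. ennreal (cmod (\<xi> (inv (\<kappa> s) \<otimes> g))) * 1 \<partial>P)"
      by (simp add: nn_integral_cmult)
    finally have "ennreal (cmod (wconv P \<kappa> w \<xi> g)) ^ 2 \<le> (ennreal C * (\<integral>\<^sup>+s. ennreal (cmod (\<xi> (inv (\<kappa> s) \<otimes> g))) * 1 \<partial>P)) ^ 2"
      by (intro power_mono) auto
    also have "\<dots> \<le> ennreal C ^ 2 * ((\<integral>\<^sup>+s. ennreal (cmod (\<xi> (inv (\<kappa> s) \<otimes> g))) ^ 2 \<partial>P) * (\<integral>\<^sup>+s. 1 ^ 2 \<partial>P))"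
      unfolding power_mult_distrib by (intro mult_left_mono Cauchy_Schwarz_nn_integral) auto
    finally show "ennreal (cmod (wconv P \<kappa> w \<xi> g)) ^ 2 \<le> ennreal C ^ 2 * emeasure P (space P) * (\<integral>\<^sup>+s. ennreal (cmod (\<xi> (inv (\<kappa> s) \<otimes> g))) ^ 2 \<partial>P)"
      by (simp add: mult_ac)
  qed
  also have "\<dots> = ennreal C ^ 2 * emeasure P (space P) * (\<integral>\<^sup>+g. (\<integral>\<^sup>+s. ennreal (cmod (\<xi> (inv (\<kappa> s) \<otimes> g))) ^ 2 \<partial>P) \<partial>m)"
    by (rule nn_integral_cmult) measurable
  also have "\<dots> = ennreal C ^ 2 * emeasure P (space P) * (emeasure P (space P) * sq_norm m \<xi>)"
    unfolding sq_norm_def by (subst nn_integral_orbit[OF P \<kappa>]) auto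
  finally show ?thesis by (simp add: power_mult_distrib power2_eq_square mult_ac)
qed

lemma wconv_L2:
  assumes P: "finite_measure P" and \<kappa>: "\<kappa> \<in> P \<rightarrow>\<^sub>M m"
    and w: "w \<in> borel_measurable P" and bnd: "\<And>s. cmod (w s) \<le> C" and \<xi>: "\<xi> \<in> L2_fun m"
  shows "wconv P \<kappa> w \<xi> \<in> L2_fun m"
proof -
  interpret P: finite_measure P by fact
  note [measurable] = L2_fun_measurable[OF \<xi>] \<kappa> w
  have "sq_norm m (wconv P \<kappa> w \<xi>) \<le> (ennreal C * emeasure P (space P)) ^ 2 * sq_norm m \<xi>"
    by (rule sq_norm_wconv_le[OF P \<kappa> w bnd]) simp
  also have "\<dots> < \<infinity>"
    using \<xi> by (simp add: L2_fun_iff P.emeasure_eq_measure ennreal_mult_less_top power_less_top_ennreal)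
  finally show ?thesis
    using wconv_measurable[OF P \<kappa> w] by (simp add: L2_fun_iff)
qed

lemma integrable_orbit_mult:
  assumes P: "finite_measure P" and \<kappa>[measurable]: "\<kappa> \<in> P \<rightarrow>\<^sub>M m"
    and w[measurable]: "w \<in> borel_measurable P" and bnd: "\<And>s. cmod (w s) \<le> C" and \<xi>: "\<xi> \<in> L2_fun m"
  shows "AE g in m. integrable P (\<lambda>s. w s * \<xi> (inv (\<kappa> s) \<otimes> g))"
  using integrable_orbit[OF P \<kappa> \<xi>]
proof (rule AE_mp, intro AE_I2 impI)
  note [measurable] = L2_fun_measurable[OF \<xi>]
  fix g assume [measurable]: "g \<in> space m" and i: "integrable P (\<lambda>s. \<xi> (inv (\<kappa> s) \<otimes> g))"
  show "integrable P (\<lambda>s. w s * \<xi> (inv (\<kappa> s) \<otimes> g))"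
  proof (rule Bochner_Integration.integrable_bound)
    show "integrable P (\<lambda>s. complex_of_real C * \<xi> (inv (\<kappa> s) \<otimes> g))" using i by simp
    have "cmod (w s) \<le> \<bar>C\<bar>" for s using bnd[of s] by linarith
    then show "AE s in P. cmod (w s * \<xi> (inv (\<kappa> s) \<otimes> g)) \<le> cmod (complex_of_real C * \<xi> (inv (\<kappa> s) \<otimes> g))"
      by (auto simp: norm_mult intro!: mult_right_mono)
  qed simp
qed

lemma wconv_add:
  assumes P: "finite_measure P" and \<kappa>: "\<kappa> \<in> P \<rightarrow>\<^sub>M m"
    and w: "w \<in> borel_measurable P" and bnd: "\<And>s. cmod (w s) \<le> C" and \<xi>: "\<xi> \<in> L2_fun m" "\<eta> \<in> L2_fun m"
  shows "AE g in m. wconv P \<kappa> w (\<lambda>x. \<xi> x + \<eta> x) g = wconv P \<kappa> w \<xi> g + wconv P \<kappa> w \<eta> g"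
  using integrable_orbit_mult[OF P \<kappa> w bnd \<xi>(1)] integrable_orbit_mult[OF P \<kappa> w bnd \<xi>(2)]
  by eventually_elim (simp add: wconv_def distrib_left)

lemma wconv_scale: "wconv P \<kappa> w (\<lambda>x. z * \<xi> x) g = z * wconv P \<kappa> w \<xi> g"
  unfolding wconv_def by (simp add: mult.left_commute[of _ z])

text \<open>Two almost everywhere corrections meet here: \<open>conv_op\<close> works with the
  representative picked by \<open>L2_rep\<close>, and its \<open>cm_integral\<close> is known to be
  an integral over \<open>P\<close> only for those \<open>g\<close> whose orbit is
  integrable.\<close>

lemma conv_op_weighted_image:
  assumes P: "finite_measure P" and \<kappa>[measurable]: "\<kappa> \<in> P \<rightarrow>\<^sub>M m"
    and w: "w \<in> borel_measurable P" and bnd: "\<And>s. cmod (w s) \<le> C" and \<xi>: "\<xi> \<in> L2_fun m"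
    and sets: "sets m = sets (borel_of T)"
  shows "conv_op G T m (weighted_image P \<kappa> w m) (L2_class m \<xi>) = L2_class m (wconv P \<kappa> w \<xi>)"
proof -
  define \<eta> where "\<eta> = L2_rep (L2_class m \<xi>)"
  have \<eta>: "\<eta> \<in> L2_fun m" "AE x in m. \<eta> x = \<xi> x"
    unfolding \<eta>_def using L2_rep_class[OF \<xi>] by auto
  note [measurable] = L2_fun_measurable[OF \<xi>] L2_fun_measurable[OF \<eta>(1)]
  have "AE g in m. cm_integral (borel_of T) (weighted_image P \<kappa> w m) (\<lambda>s. \<eta> (inv s \<otimes> g)) = wconv P \<kappa> w \<eta> g"
    using integrable_orbit[OF P \<kappa> \<eta>(1)]
  proof (rule AE_mp, intro AE_I2 impI)
    fix g assume [measurable]: "g \<in> space m" and "integrable P (\<lambda>s. \<eta> (inv (\<kappa> s) \<otimes> g))"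
    then show "cm_integral (borel_of T) (weighted_image P \<kappa> w m) (\<lambda>s. \<eta> (inv s \<otimes> g)) = wconv P \<kappa> w \<eta> g"
      unfolding wconv_def cm_integral_cong_sets[OF sets[symmetric]]
      by (intro cm_integral_weighted_image[OF P \<kappa> w bnd]) auto
  qed
  moreover have "AE g in m. wconv P \<kappa> w \<eta> g = wconv P \<kappa> w \<xi> g"
    using \<eta>(2) by (intro wconv_cong_AE[OF P \<kappa> w]) auto
  ultimately have "AE g in m. cm_integral (borel_of T) (weighted_image P \<kappa> w m) (\<lambda>s. \<eta> (inv s \<otimes> g)) = wconv P \<kappa> w \<xi> g"
    by eventually_elim simp
  then have "L2_class m (\<lambda>g. cm_integral (borel_of T) (weighted_image P \<kappa> w m) (\<lambda>s. \<eta> (inv s \<otimes> g))) = L2_class m (wconv P \<kappa> w \<xi>)"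
    by (rule L2_class_cong_AE)
  then show ?thesis
    unfolding conv_op_def using L2_class_in_L2[OF \<xi>] by (simp add: \<eta>_def)
qed

text \<open>Membership in \<open>bounded_ops\<close> is part of the definition of
  \<open>reduced_cstar\<close>, so it has to be checked for the operator on the quotient.\<close>

lemma conv_op_bounded:
  assumes P: "finite_measure P" and \<kappa>: "\<kappa> \<in> P \<rightarrow>\<^sub>M m"
    and w: "w \<in> borel_measurable P" and bnd: "\<And>s. cmod (w s) \<le> C"
    and sets: "sets m = sets (borel_of T)"
  shows "conv_op G T m (weighted_image P \<kappa> w m) \<in> bounded_ops m"
proof -
  interpret P: finite_measure P by fact
  define S where "S = conv_op G T m (weighted_image P \<kappa> w m)"
  note S = conv_op_weighted_image[OF P \<kappa> w bnd _ sets, folded S_def]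
  note L = wconv_L2[OF P \<kappa> w bnd]
  have C: "0 \<le> C" using bnd norm_ge_zero order_trans by blast
  have 1: "S \<in> L2 m \<rightarrow>\<^sub>E L2 m"
  proof (rule PiE_I)
    fix c assume "c \<in> L2 m"
    then obtain \<xi> where \<xi>: "\<xi> \<in> L2_fun m" "c = L2_class m \<xi>" by (auto simp: L2_def)
    show "S c \<in> L2 m" unfolding \<xi>(2) S[OF \<xi>(1)] by (intro L2_class_in_L2 L \<xi>)
  qed (simp add: S_def conv_op_def)
  have 2: "S (L2_add m c d) = L2_add m (S c) (S d)" if cd: "c \<in> L2 m" "d \<in> L2 m" for c d
  proof -
    note c = L2_rep[OF cd(1)] and d = L2_rep[OF cd(2)]
    have Sc: "S c = L2_class m (wconv P \<kappa> w (L2_rep c))" using S[OF c(1)] c(2) by simp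
    have Sd: "S d = L2_class m (wconv P \<kappa> w (L2_rep d))" using S[OF d(1)] d(2) by simp
    have "S (L2_add m c d) = L2_class m (wconv P \<kappa> w (\<lambda>x. L2_rep c x + L2_rep d x))"
      unfolding L2_add_def by (rule S) (intro L2_fun_add c d)
    also have "\<dots> = L2_class m (\<lambda>x. L2_rep (S c) x + L2_rep (S d) x)"
    proof (rule L2_class_cong_AE)
      show "AE x in m. wconv P \<kappa> w (\<lambda>x. L2_rep c x + L2_rep d x) x = L2_rep (S c) x + L2_rep (S d) x"
        unfolding Sc Sd
        using wconv_add[OF P \<kappa> w bnd c(1) d(1)] L2_rep_class(2)[OF L[OF c(1)]] L2_rep_class(2)[OF L[OF d(1)]]
        by eventually_elim simp
    qed
    finally show ?thesis by (simp add: L2_add_def)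
  qed
  have 3: "S (L2_scale m z c) = L2_scale m z (S c)" if cd: "c \<in> L2 m" for z c
  proof -
    note c = L2_rep[OF cd]
    have Sc: "S c = L2_class m (wconv P \<kappa> w (L2_rep c))" using S[OF c(1)] c(2) by simp
    have "S (L2_scale m z c) = L2_class m (wconv P \<kappa> w (\<lambda>x. z * L2_rep c x))"
      unfolding L2_scale_def by (rule S) (intro L2_fun_scale c)
    also have "\<dots> = L2_class m (\<lambda>x. z * L2_rep (S c) x)"
    proof (rule L2_class_cong_AE)
      show "AE x in m. wconv P \<kappa> w (\<lambda>x. z * L2_rep c x) x = z * L2_rep (S c) x"
        unfolding Sc using L2_rep_class(2)[OF L[OF c(1)]]
        by eventually_elim (simp add: wconv_scale)
    qed
    finally show ?thesis by (simp add: L2_scale_def)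
  qed
  have 4: "L2_norm m (S c) \<le> (C * measure P (space P)) * L2_norm m c" if cd: "c \<in> L2 m" for c
  proof -
    obtain \<xi> where \<xi>: "\<xi> \<in> L2_fun m" "c = L2_class m \<xi>" using cd by (auto simp: L2_def)
    show ?thesis
      unfolding \<xi>(2) S[OF \<xi>(1)]
      using sq_norm_wconv_le[OF P \<kappa> w bnd L2_fun_measurable[OF \<xi>(1)]] C
      by (subst L2_norm_class_le_iff) (auto simp: L \<xi> P.emeasure_eq_measure ennreal_mult)
  qed
  have "\<exists>K. \<forall>c\<in>L2 m. L2_norm m (S c) \<le> K * L2_norm m c"
    using 4 by blast
  then show ?thesis
    using 1 2 3 unfolding bounded_ops_def S_def[symmetric] by simp
qed

lemma op_diff_conv_op:
  assumes P: "finite_measure P" and \<kappa>: "\<kappa> \<in> P \<rightarrow>\<^sub>M m"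
    and w: "w \<in> borel_measurable P" and bnd: "\<And>s. cmod (w s) \<le> C"
    and P': "finite_measure P'" and \<kappa>': "\<kappa>' \<in> P' \<rightarrow>\<^sub>M m"
    and w': "w' \<in> borel_measurable P'" and bnd': "\<And>s. cmod (w' s) \<le> C'"
    and sets: "sets m = sets (borel_of T)"
    and \<xi>: "\<xi> \<in> L2_fun m"
  shows "op_diff m (conv_op G T m (weighted_image P \<kappa> w m)) (conv_op G T m (weighted_image P' \<kappa>' w' m)) (L2_class m \<xi>)
    = L2_class m (\<lambda>g. wconv P \<kappa> w \<xi> g - wconv P' \<kappa>' w' \<xi> g)"
proof -
  note L = wconv_L2[OF P \<kappa> w bnd \<xi>] and L' = wconv_L2[OF P' \<kappa>' w' bnd' \<xi>]
  have ae: "AE g in m. L2_rep (L2_class m (wconv P \<kappa> w \<xi>)) g - L2_rep (L2_class m (wconv P' \<kappa>' w' \<xi>)) g =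
      wconv P \<kappa> w \<xi> g - wconv P' \<kappa>' w' \<xi> g"
    using L2_rep_class(2)[OF L] L2_rep_class(2)[OF L'] by eventually_elim simp
  show ?thesis
    unfolding op_diff_def L2_diff_def
    using L2_class_in_L2[OF \<xi>] ae
    by (simp add: conv_op_weighted_image[OF P \<kappa> w bnd \<xi> sets] conv_op_weighted_image[OF P' \<kappa>' w' bnd' \<xi> sets])
       (rule L2_class_cong_AE)
qed

text \<open>The second part turns a small operator norm on the group into an estimate for functions;
  the third turns such an estimate on the quotient back into an operator norm. Transference connects
  the two.\<close>

lemma op_diff_conv_op_bound:
  assumes P: "finite_measure P" and \<kappa>: "\<kappa> \<in> P \<rightarrow>\<^sub>M m"
    and w: "w \<in> borel_measurable P" and bnd: "\<And>s. cmod (w s) \<le> C"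
    and P': "finite_measure P'" and \<kappa>': "\<kappa>' \<in> P' \<rightarrow>\<^sub>M m"
    and w': "w' \<in> borel_measurable P'" and bnd': "\<And>s. cmod (w' s) \<le> C'"
    and sets: "sets m = sets (borel_of T)"
  defines "D \<equiv> op_diff m (conv_op G T m (weighted_image P \<kappa> w m)) (conv_op G T m (weighted_image P' \<kappa>' w' m))"
  shows "0 \<le> op_norm m D"
    and "\<xi> \<in> L2_fun m \<Longrightarrow> sq_norm m (\<lambda>g. wconv P \<kappa> w \<xi> g - wconv P' \<kappa>' w' \<xi> g) \<le> ennreal (op_norm m D) ^ 2 * sq_norm m \<xi>"
    and "0 \<le> K \<Longrightarrow> (\<And>\<xi>. \<xi> \<in> L2_fun m \<Longrightarrow>
      sq_norm m (\<lambda>g. wconv P \<kappa> w \<xi> g - wconv P' \<kappa>' w' \<xi> g) \<le> ennreal K ^ 2 * sq_norm m \<xi>) \<Longrightarrow> op_norm m D \<le> K"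
proof -
  interpret P: finite_measure P by fact
  interpret P': finite_measure P' by fact
  have C: "0 \<le> C" "0 \<le> C'" using bnd bnd' norm_ge_zero order_trans by blast+
  note D = op_diff_conv_op[OF P \<kappa> w bnd P' \<kappa>' w' bnd' sets, folded D_def]
  note L = wconv_L2[OF P \<kappa> w bnd] and L' = wconv_L2[OF P' \<kappa>' w' bnd']
  have hom: "L2_norm m (D (L2_scale m z c)) = cmod z * L2_norm m (D c)" if c: "c \<in> L2 m" for z c
  proof -
    obtain \<xi> where \<xi>: "\<xi> \<in> L2_fun m" "c = L2_class m \<xi>" using c by (auto simp: L2_def)
    let ?d = "\<lambda>g. wconv P \<kappa> w \<xi> g - wconv P' \<kappa>' w' \<xi> g"
    have d: "?d \<in> L2_fun m" by (intro L2_fun_diff L L' \<xi>)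
    have "D (L2_scale m z c) = L2_class m (\<lambda>g. z * ?d g)"
      unfolding \<xi>(2) L2_scale_class[OF \<xi>(1)] D[OF L2_fun_scale[OF \<xi>(1)]]
      by (simp add: wconv_scale right_diff_distrib)
    also have "\<dots> = L2_scale m z (D c)"
      unfolding \<xi>(2) D[OF \<xi>(1)] L2_scale_class[OF d] ..
    finally show ?thesis
      using L2_norm_scale[of "D c" m z] L2_class_in_L2[OF d] by (simp add: \<xi>(2) D[OF \<xi>(1)])
  qed
  \<comment> \<open>A crude bound from \<open>|a - b|^2 \<le> 2 |a|^2 + 2 |b|^2\<close>, where only
    finiteness matters. The leading 2 absorbs the constants, since
    \<open>2 a^2 + 2 b^2 \<le> 4 (a + b)^2\<close> for nonnegative \<open>a\<close> and
    \<open>b\<close>.\<close>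
  define K where "K = 2 * (C * measure P (space P) + C' * measure P' (space P'))"
  have bound: "L2_norm m (D c) \<le> K * L2_norm m c" if c: "c \<in> L2 m" for c
  proof -
    obtain \<xi> where \<xi>: "\<xi> \<in> L2_fun m" "c = L2_class m \<xi>" using c by (auto simp: L2_def)
    let ?d = "\<lambda>g. wconv P \<kappa> w \<xi> g - wconv P' \<kappa>' w' \<xi> g"
    have d: "?d \<in> L2_fun m" by (intro L2_fun_diff L L' \<xi>)
    note [measurable] = L2_fun_measurable[OF L[OF \<xi>(1)]] L2_fun_measurable[OF L'[OF \<xi>(1)]]
    let ?a = "C * measure P (space P)" and ?b = "C' * measure P' (space P')"
    have ab: "0 \<le> ?a" "0 \<le> ?b" using C by auto
    have K0: "0 \<le> K" using ab by (simp add: K_def)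
    have "sq_norm m ?d \<le> (\<integral>\<^sup>+g. 2 * ennreal (cmod (wconv P \<kappa> w \<xi> g)) ^ 2 + 2 * ennreal (cmod (wconv P' \<kappa>' w' \<xi> g)) ^ 2 \<partial>m)"
      unfolding sq_norm_def
    proof (intro nn_integral_mono)
      fix g
      have "(cmod (?d g))\<^sup>2 \<le> 2 * (cmod (wconv P \<kappa> w \<xi> g))\<^sup>2 + 2 * (cmod (wconv P' \<kappa>' w' \<xi> g))\<^sup>2"
        using cmod_add_squared_le[of "wconv P \<kappa> w \<xi> g" "- wconv P' \<kappa>' w' \<xi> g"] by simp
      then have "ennreal ((cmod (?d g))\<^sup>2) \<le> ennreal (2 * (cmod (wconv P \<kappa> w \<xi> g))\<^sup>2 + 2 * (cmod (wconv P' \<kappa>' w' \<xi> g))\<^sup>2)"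
        by (rule ennreal_leI)
      then show "ennreal (cmod (?d g)) ^ 2 \<le> 2 * ennreal (cmod (wconv P \<kappa> w \<xi> g)) ^ 2 + 2 * ennreal (cmod (wconv P' \<kappa>' w' \<xi> g)) ^ 2"
        by (simp add: ennreal_power ennreal_mult)
    qed
    also have "\<dots> = 2 * sq_norm m (wconv P \<kappa> w \<xi>) + 2 * sq_norm m (wconv P' \<kappa>' w' \<xi>)"
      unfolding sq_norm_def by (simp add: nn_integral_add nn_integral_cmult)
    also have "\<dots> \<le> 2 * (ennreal ?a ^ 2 * sq_norm m \<xi>) + 2 * (ennreal ?b ^ 2 * sq_norm m \<xi>)"
      using sq_norm_wconv_le[OF P \<kappa> w bnd L2_fun_measurable[OF \<xi>(1)]]
        sq_norm_wconv_le[OF P' \<kappa>' w' bnd' L2_fun_measurable[OF \<xi>(1)]] C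
      by (intro add_mono mult_left_mono) (auto simp: P.emeasure_eq_measure P'.emeasure_eq_measure ennreal_mult)
    also have "\<dots> = ennreal (2 * ?a\<^sup>2 + 2 * ?b\<^sup>2) * sq_norm m \<xi>"
      using ab by (simp add: ennreal_power ennreal_mult distrib_right mult.assoc)
    also have "\<dots> \<le> ennreal (K\<^sup>2) * sq_norm m \<xi>"
    proof (intro mult_right_mono ennreal_leI)
      have "0 \<le> ?a * ?b" using ab by simp
      then show "2 * ?a\<^sup>2 + 2 * ?b\<^sup>2 \<le> K\<^sup>2"
        unfolding K_def power2_eq_square using zero_le_square[of ?a] zero_le_square[of ?b]
        by (simp add: algebra_simps)
    qed simp
    finally have "sq_norm m ?d \<le> ennreal K ^ 2 * sq_norm m \<xi>"
      using K0 by (simp add: ennreal_power)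
    then show ?thesis
      unfolding \<xi>(2) D[OF \<xi>(1)] by (subst L2_norm_class_le_iff[OF d \<xi>(1) K0])
  qed
  have ob: "L2_norm m (D c) \<le> op_norm m D * L2_norm m c" if "c \<in> L2 m" for c
    using hom bound that by (rule L2_op_norm_bound)
  show nn: "0 \<le> op_norm m D"
  proof -
    have "L2_norm m (L2_class m (\<lambda>x. 0)) = 0"
      using L2_norm_class[OF L2_fun_zero, of m] by (simp add: sq_norm_def L2_norm_nonneg)
    moreover have "bdd_above ((\<lambda>c. L2_norm m (D c)) ` {c \<in> L2 m. L2_norm m c \<le> 1})"
    proof (rule bdd_aboveI)
      fix r assume "r \<in> (\<lambda>c. L2_norm m (D c)) ` {c \<in> L2 m. L2_norm m c \<le> 1}"
      then obtain d where d: "d \<in> L2 m" "L2_norm m d \<le> 1" "r = L2_norm m (D d)" by auto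
      have "r \<le> K * L2_norm m d" using bound d by simp
      also have "\<dots> \<le> \<bar>K\<bar> * 1"
        using d(2) L2_norm_nonneg[of m d] by (intro mult_mono) auto
      finally show "r \<le> \<bar>K\<bar>" by simp
    qed
    ultimately have "L2_norm m (D (L2_class m (\<lambda>x. 0))) \<le> op_norm m D"
      unfolding op_norm_def using L2_class_in_L2[OF L2_fun_zero, of m] by (intro cSUP_upper) auto
    then show ?thesis using L2_norm_nonneg order_trans by blast
  qed
  show "sq_norm m (\<lambda>g. wconv P \<kappa> w \<xi> g - wconv P' \<kappa>' w' \<xi> g) \<le> ennreal (op_norm m D) ^ 2 * sq_norm m \<xi>"
    if \<xi>: "\<xi> \<in> L2_fun m"
    using ob[OF L2_class_in_L2[OF \<xi>]] unfolding D[OF \<xi>]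
    by (subst (asm) L2_norm_class_le_iff) (auto intro: L2_fun_diff L L' \<xi> nn)
  show "op_norm m D \<le> K"
    if K: "0 \<le> K" and le: "\<And>\<xi>. \<xi> \<in> L2_fun m \<Longrightarrow>
      sq_norm m (\<lambda>g. wconv P \<kappa> w \<xi> g - wconv P' \<kappa>' w' \<xi> g) \<le> ennreal K ^ 2 * sq_norm m \<xi>" for K
  proof (rule op_norm_le[OF _ K])
    fix c assume "c \<in> L2 m"
    then obtain \<xi> where \<xi>: "\<xi> \<in> L2_fun m" "c = L2_class m \<xi>" by (auto simp: L2_def)
    show "L2_norm m (D c) \<le> K * L2_norm m c"
      unfolding \<xi>(2) D[OF \<xi>(1)]
      by (subst L2_norm_class_le_iff) (auto intro: L2_fun_diff L L' \<xi> K le)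
  qed
qed

end

section \<open>Matrix coefficients and transference\<close>

lemma borel_measurable_cnj[measurable (raw)]:
  "f \<in> borel_measurable M \<Longrightarrow> (\<lambda>x. cnj (f x)) \<in> borel_measurable M"
  by (rule borel_measurable_continuous_on[where f=cnj]) (intro continuous_intros)

lemma ennreal_power2_le_imp_le:
  assumes "x ^ 2 \<le> ennreal r ^ 2" "0 \<le> r"
  shows "x \<le> ennreal r"
proof (cases x)
  case (real a)
  then show ?thesis
    using assms by (auto simp: ennreal_power intro: ennreal_leI power2_le_imp_le)
next
  case top
  then show ?thesis using assms by (simp add: ennreal_power top_unique)
qed

context measured_group
begin

text \<open>Off the carrier the coefficient is cut off, so that it is bounded everywhere.\<close>

definition coefficient :: "('a \<Rightarrow> complex) \<Rightarrow> ('a \<Rightarrow> complex) \<Rightarrow> 'a \<Rightarrow> complex" where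
  "coefficient \<xi> \<eta> s = (if s \<in> carrier G then \<integral>g. \<xi> (inv s \<otimes> g) * cnj (\<eta> g) \<partial>m else 0)"

lemma coefficient_measurable:
  assumes [measurable]: "\<xi> \<in> borel_measurable m" "\<eta> \<in> borel_measurable m"
  shows "coefficient \<xi> \<eta> \<in> borel_measurable m"
proof -
  have "(\<lambda>s. \<integral>g. \<xi> (inv s \<otimes> g) * cnj (\<eta> g) \<partial>m) \<in> borel_measurable m"
    by measurable
  then show ?thesis
    by (rule measurable_cong[THEN iffD1, rotated]) (simp add: coefficient_def space_eq)
qed

lemma nn_integral_coefficient_le:
  assumes [measurable]: "\<xi> \<in> borel_measurable m" "\<eta> \<in> borel_measurable m" and s: "s \<in> carrier G"
  shows "(\<integral>\<^sup>+g. ennreal (cmod (\<xi> (inv s \<otimes> g) * cnj (\<eta> g))) \<partial>m) ^ 2 \<le> sq_norm m \<xi> * sq_norm m \<eta>"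
proof -
  have [measurable]: "s \<in> space m" using s by (simp add: space_eq)
  have "(\<integral>\<^sup>+g. ennreal (cmod (\<xi> (inv s \<otimes> g) * cnj (\<eta> g))) \<partial>m) ^ 2 =
      (\<integral>\<^sup>+g. ennreal (cmod (\<xi> (inv s \<otimes> g))) * ennreal (cmod (\<eta> g)) \<partial>m) ^ 2"
    by (simp add: norm_mult ennreal_mult)
  also have "\<dots> \<le> (\<integral>\<^sup>+g. ennreal (cmod (\<xi> (inv s \<otimes> g))) ^ 2 \<partial>m) * sq_norm m \<eta>"
    unfolding sq_norm_def by (intro Cauchy_Schwarz_nn_integral) auto
  also have "(\<integral>\<^sup>+g. ennreal (cmod (\<xi> (inv s \<otimes> g))) ^ 2 \<partial>m) = sq_norm m \<xi>"
    unfolding sq_norm_def using s by (intro nn_integral_translate) auto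
  finally show ?thesis .
qed

text \<open>For square integrable functions this is the product of their norms as a real number; it
  becomes the constant of the transference estimate.\<close>

definition coefficient_bound :: "('a \<Rightarrow> complex) \<Rightarrow> ('a \<Rightarrow> complex) \<Rightarrow> real" where
  "coefficient_bound \<xi> \<eta> = sqrt (enn2real (sq_norm m \<xi> * sq_norm m \<eta>))"

lemma coefficient_bound:
  assumes "\<xi> \<in> L2_fun m" "\<eta> \<in> L2_fun m"
  shows "0 \<le> coefficient_bound \<xi> \<eta>"
    and "ennreal (coefficient_bound \<xi> \<eta>) ^ 2 = sq_norm m \<xi> * sq_norm m \<eta>"
  using assms by (auto simp: coefficient_bound_def L2_fun_iff ennreal_power ennreal_mult_less_top)

lemma nn_integral_coefficient_le_bound:
  assumes \<xi>: "\<xi> \<in> L2_fun m" and \<eta>: "\<eta> \<in> L2_fun m" and s: "s \<in> carrier G"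
  shows "(\<integral>\<^sup>+g. ennreal (cmod (\<xi> (inv s \<otimes> g) * cnj (\<eta> g))) \<partial>m) \<le> ennreal (coefficient_bound \<xi> \<eta>)"
proof -
  have "(\<integral>\<^sup>+g. ennreal (cmod (\<xi> (inv s \<otimes> g) * cnj (\<eta> g))) \<partial>m) ^ 2 \<le> ennreal (coefficient_bound \<xi> \<eta>) ^ 2"
    unfolding coefficient_bound(2)[OF \<xi> \<eta>]
    by (intro nn_integral_coefficient_le L2_fun_measurable \<xi> \<eta> s)
  then show ?thesis by (rule ennreal_power2_le_imp_le) (rule coefficient_bound(1)[OF \<xi> \<eta>])
qed

lemma norm_coefficient_le:
  assumes "\<xi> \<in> L2_fun m" "\<eta> \<in> L2_fun m"
  shows "cmod (coefficient \<xi> \<eta> s) \<le> coefficient_bound \<xi> \<eta>"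
proof (cases "s \<in> carrier G")
  case True
  have "ennreal (cmod (coefficient \<xi> \<eta> s)) \<le> ennreal (coefficient_bound \<xi> \<eta>)"
    using order_trans[OF norm_integral_le_nn_integral nn_integral_coefficient_le_bound[OF assms True]] True
    by (simp add: coefficient_def)
  then show ?thesis using coefficient_bound(1)[OF assms] by simp
qed (simp add: coefficient_def coefficient_bound[OF assms])

text \<open>Fubini applies because the integral over \<open>g\<close> is bounded uniformly in
  \<open>s\<close> while \<open>b\<close> is integrable. With \<open>b = 1\<close> this computes the
  total mass of the measure on the quotient; in transference \<open>b s\<close> is \<open>a\<close>
  evaluated at \<open>inv (q s) \<otimes> y\<close>.\<close>

lemma integral_coefficient:
  assumes P: "finite_measure P" and sP[measurable_cong]: "sets P = sets m"
    and \<theta>[measurable]: "\<theta> \<in> borel_measurable P" and bnd: "\<And>s. cmod (\<theta> s) \<le> 1"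
    and \<xi>: "\<xi> \<in> L2_fun m" and \<eta>: "\<eta> \<in> L2_fun m" and b: "integrable P b"
  shows "integrable m (\<lambda>g. cnj (\<eta> g) * (\<integral>s. \<theta> s * \<xi> (inv s \<otimes> g) * b s \<partial>P))"
    and "(\<integral>s. \<theta> s * coefficient \<xi> \<eta> s * b s \<partial>P) = (\<integral>g. cnj (\<eta> g) * (\<integral>s. \<theta> s * \<xi> (inv s \<otimes> g) * b s \<partial>P) \<partial>m)"
proof -
  interpret P: finite_measure P by fact
  interpret pair: pair_sigma_finite P m ..
  note [measurable] = L2_fun_measurable[OF \<xi>] L2_fun_measurable[OF \<eta>] borel_measurable_integrable[OF b]
  have spP: "space P = space m" using sP by (rule sets_eq_imp_space_eq)
  define F where "F = (\<lambda>(s, g). \<theta> s * (\<xi> (inv s \<otimes> g) * cnj (\<eta> g)) * b s)"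
  have Fm[measurable]: "F \<in> borel_measurable (P \<Otimes>\<^sub>M m)" unfolding F_def by measurable
  have "(\<integral>\<^sup>+x. ennreal (cmod (F x)) \<partial>(P \<Otimes>\<^sub>M m)) = (\<integral>\<^sup>+s. (\<integral>\<^sup>+g. ennreal (cmod (F (s, g))) \<partial>m) \<partial>P)"
    by (subst nn_integral_fst[symmetric]) measurable
  also have "\<dots> \<le> (\<integral>\<^sup>+s. ennreal (coefficient_bound \<xi> \<eta>) * ennreal (cmod (b s)) \<partial>P)"
  proof (intro nn_integral_mono)
    fix s assume s: "s \<in> space P"
    then have [measurable]: "s \<in> space m" and sc: "s \<in> carrier G" by (simp_all add: spP space_eq)
    have "(\<integral>\<^sup>+g. ennreal (cmod (F (s, g))) \<partial>m) \<le> (\<integral>\<^sup>+g. ennreal (cmod (\<xi> (inv s \<otimes> g) * cnj (\<eta> g))) * ennreal (cmod (b s)) \<partial>m)"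
      using bnd[of s] by (intro nn_integral_mono)
        (auto simp: F_def norm_mult mult_left_le_one_le ennreal_mult[symmetric] intro!: ennreal_leI mult_right_mono)
    also have "\<dots> = (\<integral>\<^sup>+g. ennreal (cmod (\<xi> (inv s \<otimes> g) * cnj (\<eta> g))) \<partial>m) * ennreal (cmod (b s))"
      by (rule nn_integral_multc) measurable
    also have "\<dots> \<le> ennreal (coefficient_bound \<xi> \<eta>) * ennreal (cmod (b s))"
      by (intro mult_right_mono nn_integral_coefficient_le_bound \<xi> \<eta> sc) simp
    finally show "(\<integral>\<^sup>+g. ennreal (cmod (F (s, g))) \<partial>m) \<le> ennreal (coefficient_bound \<xi> \<eta>) * ennreal (cmod (b s))" .
  qed
  also have "\<dots> = ennreal (coefficient_bound \<xi> \<eta>) * (\<integral>\<^sup>+s. ennreal (cmod (b s)) \<partial>P)"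
    by (rule nn_integral_cmult) measurable
  also have "\<dots> < \<infinity>" using b by (simp add: integrable_iff_bounded ennreal_mult_less_top)
  finally have iF: "integrable (P \<Otimes>\<^sub>M m) F"
    by (intro integrableI_bounded) auto
  have 1: "(\<integral>g. F (s, g) \<partial>m) = \<theta> s * coefficient \<xi> \<eta> s * b s" if "s \<in> space P" for s
    using that by (simp add: F_def coefficient_def spP space_eq)
  have 2: "(\<integral>s. F (s, g) \<partial>P) = cnj (\<eta> g) * (\<integral>s. \<theta> s * \<xi> (inv s \<otimes> g) * b s \<partial>P)" for g
    unfolding F_def by (subst integral_mult_right_zero[symmetric]) (simp add: mult_ac)
  have iF': "integrable (P \<Otimes>\<^sub>M m) (\<lambda>(s, g). F (s, g))" using iF by simp
  show "integrable m (\<lambda>g. cnj (\<eta> g) * (\<integral>s. \<theta> s * \<xi> (inv s \<otimes> g) * b s \<partial>P))"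
    using pair.integrable_snd[OF iF'] by (simp add: 2)
  have "(\<integral>g. (\<integral>s. F (s, g) \<partial>P) \<partial>m) = (\<integral>s. (\<integral>g. F (s, g) \<partial>m) \<partial>P)"
    by (rule pair.Fubini_integral[OF iF'])
  then show "(\<integral>s. \<theta> s * coefficient \<xi> \<eta> s * b s \<partial>P) = (\<integral>g. cnj (\<eta> g) * (\<integral>s. \<theta> s * \<xi> (inv s \<otimes> g) * b s \<partial>P) \<partial>m)"
    by (simp add: 2 1 cong: Bochner_Integration.integral_cong)
qed

lemma integral_coefficient_wconv:
  assumes P: "finite_measure P" and sP: "sets P = sets m"
    and \<theta>: "\<theta> \<in> borel_measurable P" and bnd: "\<And>s. cmod (\<theta> s) \<le> 1" and \<xi>: "\<xi> \<in> L2_fun m"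
    and nz: "\<not> (AE g in m. wconv P (\<lambda>s. s) \<theta> \<xi> g = 0)"
  shows "(\<integral>s. \<theta> s * coefficient \<xi> (wconv P (\<lambda>s. s) \<theta> \<xi>) s \<partial>P) \<noteq> 0"
proof -
  let ?\<eta> = "wconv P (\<lambda>s. s) \<theta> \<xi>"
  interpret P: finite_measure P by fact
  have \<eta>: "?\<eta> \<in> L2_fun m"
    using sP by (intro wconv_L2[OF P _ \<theta> bnd \<xi>]) (simp add: measurable_ident_sets)
  have "(\<integral>s. \<theta> s * coefficient \<xi> ?\<eta> s \<partial>P) = (\<integral>g. cnj (?\<eta> g) * (\<integral>s. \<theta> s * \<xi> (inv s \<otimes> g) \<partial>P) \<partial>m)"
    using integral_coefficient(2)[OF P sP \<theta> bnd \<xi> \<eta>, of "\<lambda>_. 1"] by simp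
  also have "\<dots> = (\<integral>g. cnj (?\<eta> g) * ?\<eta> g \<partial>m)"
    by (simp add: wconv_def)
  also have "\<dots> = complex_of_real (\<integral>g. (cmod (?\<eta> g))\<^sup>2 \<partial>m)"
    by (subst integral_complex_of_real[symmetric]) (simp only: complex_norm_square mult.commute)
  finally have eq: "(\<integral>s. \<theta> s * coefficient \<xi> ?\<eta> s \<partial>P) = complex_of_real (\<integral>g. (cmod (?\<eta> g))\<^sup>2 \<partial>m)" .
  have "(\<integral>g. (cmod (?\<eta> g))\<^sup>2 \<partial>m) \<noteq> 0"
    using nz \<eta> by (subst integral_nonneg_eq_0_iff_AE) (auto simp: L2_fun_def)
  then show ?thesis unfolding eq by simp
qed

text \<open>Lets one good base point be fixed outside a null set, both for the total mass argument
  and for preimages of null sets.\<close>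

lemma AE_nonempty:
  assumes "AE x in m. p x"
  shows "\<exists>x\<in>space m. p x"
proof (rule ccontr)
  assume no: "\<not> ?thesis"
  have "AE x in m. False"
    using assms AE_space by eventually_elim (use no in blast)
  then show False
    using nonzero by (subst (asm) AE_iff_measurable[OF sets.top]) auto
qed

lemma integral_weight_eq_0:
  assumes P: "finite_measure P" and \<kappa>[measurable]: "\<kappa> \<in> P \<rightarrow>\<^sub>M m"
    and w[measurable]: "w \<in> borel_measurable P" and bnd: "\<And>s. cmod (w s) \<le> C"
    and 0: "\<And>a. a \<in> L2_fun m \<Longrightarrow> AE g in m. wconv P \<kappa> w a g = 0"
  shows "(\<integral>s. w s \<partial>P) = 0"
proof -
  interpret P: finite_measure P by fact
  obtain A :: "nat \<Rightarrow> 'a set" where A: "range A \<subseteq> sets m" "(\<Union>i. A i) = space m" "\<And>i. emeasure m (A i) \<noteq> \<infinity>" "incseq A"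
    using sigma_finite_incseq by metis
  have [measurable]: "A k \<in> sets m" for k using A(1) by auto
  \<comment> \<open>There are countably many exceptional null sets, so one \<open>g\<close> serves
    every \<open>k\<close>. Along its orbit the indicators increase to 1, and dominated convergence
    recovers the integral of \<open>w\<close>.\<close>
  have "AE g in m. \<forall>k. wconv P \<kappa> w (\<lambda>x. indicator (A k) x) g = 0"
  proof (subst AE_all_countable, intro allI 0)
    fix k
    have "sq_norm m (\<lambda>x. indicator (A k) x) = (\<integral>\<^sup>+x. indicator (A k) x \<partial>m)"
      unfolding sq_norm_def by (intro nn_integral_cong) (auto simp: indicator_def)
    then show "(\<lambda>x. indicator (A k) x) \<in> L2_fun m"
      using A(3)[of k] by (simp add: L2_fun_iff top.not_eq_extremum)
  qed
  then obtain g where g: "g \<in> space m" "\<And>k. wconv P \<kappa> w (\<lambda>x. indicator (A k) x) g = 0"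
    using AE_nonempty by blast
  note [measurable] = g(1)
  have iC: "integrable P (\<lambda>s. C)" by simp
  have "(\<lambda>k. \<integral>s. w s * indicator (A k) (inv (\<kappa> s) \<otimes> g) \<partial>P) \<longlonglongrightarrow> (\<integral>s. w s \<partial>P)"
  proof (rule integral_dominated_convergence[OF _ _ iC])
    show "AE s in P. (\<lambda>k. w s * indicator (A k) (inv (\<kappa> s) \<otimes> g)) \<longlonglongrightarrow> w s"
    proof (rule AE_I2)
      fix s assume "s \<in> space P"
      then have "inv (\<kappa> s) \<otimes> g \<in> (\<Union>i. A i)"
        using A(2) g(1) in_carrier[OF \<kappa>] by (simp add: space_eq)
      then have "(\<lambda>k. indicator (A k) (inv (\<kappa> s) \<otimes> g) :: complex) \<longlonglongrightarrow> 1"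
        using LIMSEQ_indicator_incseq[OF A(4), of "inv (\<kappa> s) \<otimes> g"] by simp
      from tendsto_mult[OF tendsto_const[of "w s"] this]
      show "(\<lambda>k. w s * indicator (A k) (inv (\<kappa> s) \<otimes> g)) \<longlonglongrightarrow> w s" by simp
    qed
    fix k
    show "AE s in P. norm (w s * indicator (A k) (inv (\<kappa> s) \<otimes> g)) \<le> C"
    proof (rule AE_I2)
      fix s show "norm (w s * indicator (A k) (inv (\<kappa> s) \<otimes> g)) \<le> C"
        using bnd[of s] order_trans[OF norm_ge_zero bnd[of s]] by (simp add: indicator_def)
    qed
  qed measurable
  moreover have "(\<integral>s. w s * indicator (A k) (inv (\<kappa> s) \<otimes> g) \<partial>P) = 0" for k
    using g(2)[of k] by (simp add: wconv_def)
  ultimately show ?thesis by (simp add: LIMSEQ_const_iff)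
qed

end


section \<open>Transference along a homomorphism\<close>

locale measured_hom = G: measured_group G m + Q: measured_group Q n
  for G :: "('a, 'c) monoid_scheme" and m and Q :: "('b, 'd) monoid_scheme" and n +
  fixes q
  assumes q_hom: "q \<in> hom G Q" and q_measurable[measurable]: "q \<in> m \<rightarrow>\<^sub>M n"
begin

lemma group_hom_q: "group_hom G Q q"
  by (intro group_hom.intro group_hom_axioms.intro q_hom G.group_axioms Q.group_axioms)

text \<open>With \<open>q g \<otimes> y\<close> in place of \<open>y\<close>, the argument of
  \<open>a\<close> depends on \<open>s\<close> and \<open>g\<close> only through
  \<open>inv s \<otimes> g\<close>, so that the integral over \<open>s\<close> becomes a convolution
  on \<open>G\<close>.\<close>

lemma q_twist:
  assumes "s \<in> carrier G" "g \<in> carrier G" "y \<in> carrier Q"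
  shows "inv\<^bsub>Q\<^esub> (q s) \<otimes>\<^bsub>Q\<^esub> (q g \<otimes>\<^bsub>Q\<^esub> y) = q (inv\<^bsub>G\<^esub> s \<otimes>\<^bsub>G\<^esub> g) \<otimes>\<^bsub>Q\<^esub> y"
proof -
  interpret group_hom G Q q by (rule group_hom_q)
  show ?thesis using assms by (simp add: Q.m_assoc)
qed

text \<open>Fell's absorption principle, applied to the representation \<open>\<lambda>\<^sub>Q \<circ> q\<close> of \<open>G\<close>: the substitution
  \<open>y \<mapsto> q g y\<close> for fixed \<open>g\<close> turns the kernel of the tensor product \<open>\<lambda>\<^sub>G \<otimes> (\<lambda>\<^sub>Q \<circ> q)\<close> into that of
  \<open>\<lambda>\<^sub>G \<otimes> 1\<close>.\<close>

lemma transference: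
  assumes P: "finite_measure P" and sP[measurable_cong]: "sets P = sets m"
    and \<theta>[measurable]: "\<theta> \<in> borel_measurable P" and bnd: "\<And>s. cmod (\<theta> s) \<le> 1"
    and P': "finite_measure P'" and sP'[measurable_cong]: "sets P' = sets m"
    and \<theta>'[measurable]: "\<theta>' \<in> borel_measurable P'" and bnd': "\<And>s. cmod (\<theta>' s) \<le> 1"
    and \<xi>: "\<xi> \<in> L2_fun m" and \<eta>: "\<eta> \<in> L2_fun m" and a: "a \<in> L2_fun n"
    and \<delta>: "\<And>\<phi>. \<phi> \<in> L2_fun m \<Longrightarrow>
      sq_norm m (\<lambda>g. G.wconv P (\<lambda>s. s) \<theta> \<phi> g - G.wconv P' (\<lambda>s. s) \<theta>' \<phi> g) \<le> ennreal \<delta> ^ 2 * sq_norm m \<phi>"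
  shows "sq_norm n (\<lambda>y. Q.wconv P q (\<lambda>s. \<theta> s * G.coefficient \<xi> \<eta> s) a y - Q.wconv P' q (\<lambda>s. \<theta>' s * G.coefficient \<xi> \<eta> s) a y)
    \<le> ennreal \<delta> ^ 2 * (sq_norm m \<xi> * sq_norm m \<eta>) * sq_norm n a"
proof -
  interpret P: finite_measure P by fact
  interpret P': finite_measure P' by fact
  interpret mn: pair_sigma_finite m n ..
  note [measurable] = L2_fun_measurable[OF \<xi>] L2_fun_measurable[OF \<eta>] L2_fun_measurable[OF a]
  have spP: "space P = space m" "space P' = space m" using sP sP' by (auto dest: sets_eq_imp_space_eq)
  have qP: "q \<in> P \<rightarrow>\<^sub>M n" "q \<in> P' \<rightarrow>\<^sub>M n" by measurable
  \<comment> \<open>The value at \<open>(g, y)\<close> of the tensor product representation,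
    integrated over \<open>s\<close> and applied to the tensor of \<xi> and \<open>a\<close>. The
    pairing with \<eta> is postponed.\<close>
  define W where "W R \<tau> g y = (\<integral>s. \<tau> s * \<xi> (inv\<^bsub>G\<^esub> s \<otimes>\<^bsub>G\<^esub> g) * a (inv\<^bsub>Q\<^esub> (q s) \<otimes>\<^bsub>Q\<^esub> y) \<partial>R)" for R \<tau> g y
  have Wm[measurable]: "(\<lambda>(g, y). W P \<theta> g y) \<in> borel_measurable (m \<Otimes>\<^sub>M n)"
    "(\<lambda>(g, y). W P' \<theta>' g y) \<in> borel_measurable (m \<Otimes>\<^sub>M n)"
    unfolding W_def by measurable
  \<comment> \<open>The same tensor after the substitution, at a fixed \<open>y\<close>: a function
    on \<open>G\<close> alone, to which the hypothesis on \<delta> applies.\<close>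
  define \<phi> where "\<phi> y g = \<xi> g * a (q g \<otimes>\<^bsub>Q\<^esub> y)" for y g
  have \<phi>m[measurable]: "(\<lambda>(y, g). \<phi> y g) \<in> borel_measurable (n \<Otimes>\<^sub>M m)"
    unfolding \<phi>_def by measurable
  define D where "D y = Q.wconv P q (\<lambda>s. \<theta> s * G.coefficient \<xi> \<eta> s) a y - Q.wconv P' q (\<lambda>s. \<theta>' s * G.coefficient \<xi> \<eta> s) a y" for y
  define W2 where "W2 g y = ennreal (cmod (W P \<theta> g y - W P' \<theta>' g y)) ^ 2" for g y
  have W2m[measurable]: "(\<lambda>(g, y). W2 g y) \<in> borel_measurable (m \<Otimes>\<^sub>M n)"
    unfolding W2_def by measurable
  \<comment> \<open>Fubini writes \<open>D y\<close> as a pairing with \<eta> in the variable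
    \<open>g\<close>, and Cauchy-Schwarz splits off the norm of \<eta>.\<close>
  have D: "AE y in n. ennreal (cmod (D y)) ^ 2 \<le> sq_norm m \<eta> * (\<integral>\<^sup>+g. W2 g y \<partial>m)"
    using AE_space Q.integrable_orbit[OF P qP(1) a] Q.integrable_orbit[OF P' qP(2) a]
  proof eventually_elim
    case (elim y)
    note [measurable] = elim(1)
    note I = G.integral_coefficient[OF P sP \<theta> bnd \<xi> \<eta> elim(2), folded W_def]
    note I' = G.integral_coefficient[OF P' sP' \<theta>' bnd' \<xi> \<eta> elim(3), folded W_def]
    have "D y = (\<integral>g. cnj (\<eta> g) * W P \<theta> g y \<partial>m) - (\<integral>g. cnj (\<eta> g) * W P' \<theta>' g y \<partial>m)"
      unfolding D_def Q.wconv_def I(2) I'(2) ..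
    also have "\<dots> = (\<integral>g. cnj (\<eta> g) * (W P \<theta> g y - W P' \<theta>' g y) \<partial>m)"
      unfolding right_diff_distrib by (rule Bochner_Integration.integral_diff[OF I(1) I'(1), symmetric])
    finally have "ennreal (cmod (D y)) \<le> (\<integral>\<^sup>+g. ennreal (cmod (cnj (\<eta> g) * (W P \<theta> g y - W P' \<theta>' g y))) \<partial>m)"
      by (simp only: norm_integral_le_nn_integral)
    also have "\<dots> = (\<integral>\<^sup>+g. ennreal (cmod (\<eta> g)) * ennreal (cmod (W P \<theta> g y - W P' \<theta>' g y)) \<partial>m)"
      by (simp add: norm_mult ennreal_mult)
    finally have "ennreal (cmod (D y)) ^ 2 \<le> (\<integral>\<^sup>+g. ennreal (cmod (\<eta> g)) * ennreal (cmod (W P \<theta> g y - W P' \<theta>' g y)) \<partial>m) ^ 2"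
      by (intro power_mono) auto
    also have "\<dots> \<le> sq_norm m \<eta> * (\<integral>\<^sup>+g. W2 g y \<partial>m)"
      unfolding sq_norm_def W2_def by (intro Cauchy_Schwarz_nn_integral) measurable
    finally show ?case .
  qed
  have tw: "W R \<tau> g (q g \<otimes>\<^bsub>Q\<^esub> y) = G.wconv R (\<lambda>s. s) \<tau> (\<phi> y) g"
    if "space R = space m" "g \<in> space m" "y \<in> space n" for R \<tau> g y
    unfolding W_def G.wconv_def \<phi>_def
    using that by (intro Bochner_Integration.integral_cong) (auto simp: q_twist G.space_eq Q.space_eq)
  have "(\<integral>\<^sup>+y. sq_norm m (\<phi> y) \<partial>n) = (\<integral>\<^sup>+g. (\<integral>\<^sup>+y. ennreal (cmod (\<phi> y g)) ^ 2 \<partial>n) \<partial>m)"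
    unfolding sq_norm_def by (rule mn.Fubini') measurable
  also have "\<dots> = (\<integral>\<^sup>+g. ennreal (cmod (\<xi> g)) ^ 2 * sq_norm n a \<partial>m)"
  proof (rule nn_integral_cong)
    fix g assume g: "g \<in> space m"
    then have qg: "q g \<in> carrier Q" using Q.in_carrier[OF q_measurable] by blast
    then have [measurable]: "q g \<in> space n" by (simp add: Q.space_eq)
    have "(\<integral>\<^sup>+y. ennreal (cmod (\<phi> y g)) ^ 2 \<partial>n) = (\<integral>\<^sup>+y. ennreal (cmod (\<xi> g)) ^ 2 * ennreal (cmod (a (q g \<otimes>\<^bsub>Q\<^esub> y))) ^ 2 \<partial>n)"
      by (simp add: \<phi>_def norm_mult ennreal_mult power_mult_distrib)
    also have "\<dots> = ennreal (cmod (\<xi> g)) ^ 2 * (\<integral>\<^sup>+y. ennreal (cmod (a (q g \<otimes>\<^bsub>Q\<^esub> y))) ^ 2 \<partial>n)"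
      by (rule nn_integral_cmult) measurable
    also have "(\<integral>\<^sup>+y. ennreal (cmod (a (q g \<otimes>\<^bsub>Q\<^esub> y))) ^ 2 \<partial>n) = sq_norm n a"
      unfolding sq_norm_def by (rule Q.nn_integral_translate[OF qg]) measurable
    finally show "(\<integral>\<^sup>+y. ennreal (cmod (\<phi> y g)) ^ 2 \<partial>n) = ennreal (cmod (\<xi> g)) ^ 2 * sq_norm n a" .
  qed
  also have "\<dots> = sq_norm m \<xi> * sq_norm n a"
    unfolding sq_norm_def[of m \<xi>] by (rule nn_integral_multc) measurable
  finally have \<phi>: "(\<integral>\<^sup>+y. sq_norm m (\<phi> y) \<partial>n) = sq_norm m \<xi> * sq_norm n a" .
  have \<phi>2m[measurable]: "(\<lambda>y. sq_norm m (\<phi> y)) \<in> borel_measurable n"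
    unfolding sq_norm_def by measurable
  have "AE y in n. sq_norm m (\<phi> y) \<noteq> \<infinity>"
    using \<xi> a by (intro nn_integral_PInf_AE) (auto simp: \<phi> L2_fun_iff ennreal_mult_eq_top_iff)
  \<comment> \<open>The hypothesis on \<delta> speaks only of square integrable functions;
    finiteness of the integral of \<open>sq_norm m (\<phi> y)\<close> makes almost every
    \<open>\<phi> y\<close> one of them.\<close>
  with AE_space have \<phi>L: "AE y in n. \<phi> y \<in> L2_fun m"
  proof eventually_elim
    case (elim y)
    note [measurable] = elim(1)
    show ?case using elim(2) by (simp add: L2_fun_iff top.not_eq_extremum)
  qed
  have "(\<integral>\<^sup>+y. (\<integral>\<^sup>+g. W2 g y \<partial>m) \<partial>n) = (\<integral>\<^sup>+g. (\<integral>\<^sup>+y. W2 g y \<partial>n) \<partial>m)"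
    by (rule mn.Fubini') measurable
  \<comment> \<open>The substitution is left invariance of \<open>n\<close> at a fixed
    \<open>g\<close>, which is why \<open>y\<close> is made the inner variable here and the outer
    one again afterwards.\<close>
  also have "\<dots> = (\<integral>\<^sup>+g. (\<integral>\<^sup>+y. W2 g (q g \<otimes>\<^bsub>Q\<^esub> y) \<partial>n) \<partial>m)"
  proof (rule nn_integral_cong)
    fix g assume [measurable]: "g \<in> space m"
    show "(\<integral>\<^sup>+y. W2 g y \<partial>n) = (\<integral>\<^sup>+y. W2 g (q g \<otimes>\<^bsub>Q\<^esub> y) \<partial>n)"
      by (intro Q.nn_integral_translate[symmetric] Q.in_carrier[OF q_measurable]) measurable
  qed
  also have "\<dots> = (\<integral>\<^sup>+y. (\<integral>\<^sup>+g. W2 g (q g \<otimes>\<^bsub>Q\<^esub> y) \<partial>m) \<partial>n)"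
    by (rule mn.Fubini'[symmetric]) measurable
  also have "\<dots> = (\<integral>\<^sup>+y. sq_norm m (\<lambda>g. G.wconv P (\<lambda>s. s) \<theta> (\<phi> y) g - G.wconv P' (\<lambda>s. s) \<theta>' (\<phi> y) g) \<partial>n)"
    unfolding sq_norm_def W2_def using spP by (intro nn_integral_cong) (simp add: tw)
  also have "\<dots> \<le> (\<integral>\<^sup>+y. ennreal \<delta> ^ 2 * sq_norm m (\<phi> y) \<partial>n)"
  proof (rule nn_integral_mono_AE)
    show "AE y in n. sq_norm m (\<lambda>g. G.wconv P (\<lambda>s. s) \<theta> (\<phi> y) g - G.wconv P' (\<lambda>s. s) \<theta>' (\<phi> y) g) \<le>
        ennreal \<delta> ^ 2 * sq_norm m (\<phi> y)"
      using \<phi>L by eventually_elim (rule \<delta>)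
  qed
  also have "\<dots> = ennreal \<delta> ^ 2 * (sq_norm m \<xi> * sq_norm n a)"
    unfolding \<phi>[symmetric] by (rule nn_integral_cmult) measurable
  finally have W2: "(\<integral>\<^sup>+y. (\<integral>\<^sup>+g. W2 g y \<partial>m) \<partial>n) \<le> ennreal \<delta> ^ 2 * (sq_norm m \<xi> * sq_norm n a)" .
  have "sq_norm n D \<le> (\<integral>\<^sup>+y. sq_norm m \<eta> * (\<integral>\<^sup>+g. W2 g y \<partial>m) \<partial>n)"
    unfolding sq_norm_def[of n] using D by (rule nn_integral_mono_AE)
  also have "\<dots> = sq_norm m \<eta> * (\<integral>\<^sup>+y. (\<integral>\<^sup>+g. W2 g y \<partial>m) \<partial>n)"
    by (rule nn_integral_cmult) measurable
  also have "\<dots> \<le> sq_norm m \<eta> * (ennreal \<delta> ^ 2 * (sq_norm m \<xi> * sq_norm n a))"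
    by (intro mult_left_mono W2) simp
  finally show ?thesis unfolding D_def by (simp add: mult_ac)
qed

text \<open>By Fubini and left invariance of \<open>n\<close>, for almost every \<open>y\<close> the
  set of \<open>g\<close> with \<open>inv (q g) \<otimes> y\<close> in \<open>N\<close> is null. One
  such \<open>y\<close> is \<open>q h\<close>, and left translation by \<open>h\<close> removes it.
  The inverse is what puts \<open>h\<close> on the left of \<open>g\<close>, the side on which
  \<open>m\<close> is invariant.\<close>

lemma null_sets_vimage_inv:
  assumes surj: "q ` carrier G = carrier Q" and N: "N \<in> null_sets n"
  shows "{x \<in> space m. q (inv\<^bsub>G\<^esub> x) \<in> N} \<in> null_sets m"
proof -
  interpret mn: pair_sigma_finite m n ..
  interpret q: group_hom G Q q by (rule group_hom_q)
  have [measurable]: "N \<in> sets n" using N by auto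
  let ?f = "\<lambda>g y. indicator N (inv\<^bsub>Q\<^esub> (q g) \<otimes>\<^bsub>Q\<^esub> y) :: ennreal"
  have "(\<integral>\<^sup>+y. (\<integral>\<^sup>+g. ?f g y \<partial>m) \<partial>n) = (\<integral>\<^sup>+g. (\<integral>\<^sup>+y. ?f g y \<partial>n) \<partial>m)"
    by (rule mn.Fubini') measurable
  also have "\<dots> = (\<integral>\<^sup>+g. (\<integral>\<^sup>+y. indicator N y \<partial>n) \<partial>m)"
    by (intro nn_integral_cong Q.nn_integral_translate Q.inv_closed Q.in_carrier[OF q_measurable]) auto
  also have "\<dots> = 0" using N by auto
  finally have "AE y in n. (\<integral>\<^sup>+g. ?f g y \<partial>m) = 0"
    by (subst (asm) nn_integral_0_iff_AE) measurable
  then obtain y where y: "y \<in> space n" "(\<integral>\<^sup>+g. ?f g y \<partial>m) = 0"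
    using Q.AE_nonempty by blast
  then obtain h where h: "h \<in> carrier G" "y = q h"
    using surj Q.space_eq by auto
  let ?A = "{x \<in> space m. q (inv\<^bsub>G\<^esub> x) \<in> N}"
  have A: "?A \<in> sets m" by measurable
  then have "emeasure m ?A = (\<integral>\<^sup>+x. indicator ?A x \<partial>m)" by simp
  also have "\<dots> = (\<integral>\<^sup>+x. indicator N (q (inv\<^bsub>G\<^esub> x)) \<partial>m)"
    by (intro nn_integral_cong) (auto simp: indicator_def)
  also have "\<dots> = (\<integral>\<^sup>+g. indicator N (q (inv\<^bsub>G\<^esub> (inv\<^bsub>G\<^esub> h \<otimes>\<^bsub>G\<^esub> g))) \<partial>m)"
    using h(1) by (intro G.nn_integral_translate[symmetric]) auto
  also have "\<dots> = (\<integral>\<^sup>+g. ?f g y \<partial>m)"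
    using h by (intro nn_integral_cong) (simp add: G.inv_mult_group G.space_eq)
  finally show ?thesis
    using y(2) A by (intro null_setsI) auto
qed

end

text \<open>Taken for the identity homomorphism of \<open>G\<close>, the preceding lemma says that
  inversion preserves null sets; this undoes the inverse.\<close>

lemma (in measured_hom) null_sets_vimage:
  assumes surj: "q ` carrier G = carrier Q" and N: "N \<in> null_sets n"
  shows "{x \<in> space m. q x \<in> N} \<in> null_sets m"
proof -
  interpret id: measured_hom G m G m "\<lambda>x. x"
    by unfold_locales (auto simp: hom_def)
  have "{x \<in> space m. inv\<^bsub>G\<^esub> x \<in> {x \<in> space m. q (inv\<^bsub>G\<^esub> x) \<in> N}} \<in> null_sets m"
    by (rule id.null_sets_vimage_inv[OF _ null_sets_vimage_inv[OF assms]]) simp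
  also have "{x \<in> space m. inv\<^bsub>G\<^esub> x \<in> {x \<in> space m. q (inv\<^bsub>G\<^esub> x) \<in> N}} = {x \<in> space m. q x \<in> N}"
    by (auto simp: G.space_eq)
  finally show ?thesis .
qed

section \<open>Borel sets of a topology, and the zero operator\<close>

lemma space_borel_of: "space (borel_of T) = topspace T"
  using openin_subset unfolding borel_of_def by (intro space_measure_of) auto

lemma sets_borel_of: "sets (borel_of T) = sigma_sets (topspace T) {U. openin T U}"
  using openin_subset unfolding borel_of_def by (intro sets_measure_of) auto

lemma openin_sets_borel_of: "openin T U \<Longrightarrow> U \<in> sets (borel_of T)"
  by (simp add: sets_borel_of sigma_sets.Basic)

lemma closedin_sets_borel_of: "closedin T C \<Longrightarrow> C \<in> sets (borel_of T)"
proof -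
  assume C: "closedin T C"
  then have "topspace T - (topspace T - C) \<in> sets (borel_of T)"
    by (intro sets.Diff openin_sets_borel_of openin_topspace openin_diff)
  then show ?thesis using closedin_subset[OF C] by (simp add: double_diff)
qed

lemma second_countableE:
  assumes "second_countable T"
  obtains \<B> where "countable \<B>" "\<And>V. V \<in> \<B> \<Longrightarrow> openin T V"
    "\<And>U x. openin T U \<Longrightarrow> x \<in> U \<Longrightarrow> \<exists>V\<in>\<B>. x \<in> V \<and> V \<subseteq> U"
proof -
  obtain \<B> where \<B>: "countable \<B> \<and> (\<forall>V \<in> \<B>. openin T V) \<and>
      (\<forall>U x. openin T U \<and> x \<in> U \<longrightarrow> (\<exists>V \<in> \<B>. x \<in> V \<and> V \<subseteq> U))"
    using assms unfolding second_countable_def ..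
  show thesis by (rule that[of \<B>]) (simp_all add: \<B>)
qed

text \<open>Uniqueness asks the intersection to equal \<open>{op_zero m}\<close>. As zero always
  lies in it, failure of uniqueness produces a nonzero member.\<close>

lemma op_zero_in_reduced_cstar:
  assumes "measured_group G m" and sets: "sets m = sets (borel_of T)"
  shows "op_zero m \<in> conv_op G T m ` measures_on T E \<inter> reduced_cstar G T m"
proof -
  interpret measured_group G m by fact
  \<comment> \<open>Writing the zero measure as a weighted image over the null measure brings it
    under the general statements on such operators.\<close>
  have 0: "finite_measure (null_measure m)" by (rule finite_measureI) simp
  have id: "(\<lambda>x. x) \<in> null_measure m \<rightarrow>\<^sub>M m" by (simp add: measurable_ident_sets)
  have w0: "weighted_image (null_measure m) (\<lambda>x. x) (\<lambda>_. 0) m = (\<lambda>A. 0)"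
    by (rule ext) (simp add: weighted_image_def)
  have wm: "(\<lambda>_. 0 :: complex) \<in> borel_measurable (null_measure m)" by simp
  have wb: "cmod 0 \<le> 0" by simp
  note op = conv_op_weighted_image[OF 0 id wm wb _ sets, unfolded w0]
    and bop = conv_op_bounded[OF 0 id wm wb sets, unfolded w0]
    and diff = op_diff_conv_op_bound[OF 0 id wm wb 0 id wm wb sets, unfolded w0]
  have conv: "conv_op G T m (\<lambda>A. 0) = op_zero m"
  proof (rule ext)
    fix c show "conv_op G T m (\<lambda>A. 0) c = op_zero m c"
    proof (cases "c \<in> L2 m")
      case True
      then obtain \<xi> where "\<xi> \<in> L2_fun m" "c = L2_class m \<xi>" by (auto simp: L2_def)
      then show ?thesis using op[of \<xi>] True by (simp add: op_zero_def L2_zero_def wconv_def[abs_def])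
    qed (simp add: conv_op_def op_zero_def)
  qed
  have "total_variation (borel_of T) (\<lambda>A. 0) (topspace T) \<le> 0"
    unfolding total_variation_def by (intro SUP_least) simp
  then have "measure_support T (\<lambda>A. 0) \<subseteq> E"
    by (auto simp: measure_support_def)
  then have "(\<lambda>A. 0) \<in> measures_on T E"
    by (simp add: measures_on_def complex_measure_def)
  moreover have "op_zero m \<in> reduced_cstar G T m"
    unfolding reduced_cstar_def
  proof (intro CollectI conjI allI impI)
    show "op_zero m \<in> bounded_ops m" using bop conv by simp
    fix \<epsilon> :: real assume "\<epsilon> > 0"
    have "op_norm m (op_diff m (op_zero m) (op_zero m)) \<le> 0"
      using diff(3)[of 0] conv by (simp add: sq_norm_def)
    moreover have "density_cm m (\<lambda>_. 0) = (\<lambda>A. 0)"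
      by (rule ext) (simp add: density_cm_def set_lebesgue_integral_def)
    ultimately show "\<exists>f. integrable m f \<and> op_norm m (op_diff m (op_zero m) (conv_op G T m (density_cm m f))) < \<epsilon>"
      using \<open>\<epsilon> > 0\<close> conv by (intro exI[of _ "\<lambda>_. 0"]) simp
  qed
  ultimately show ?thesis using conv by (metis IntI imageI)
qed

section \<open>Pushing operators and supports to the quotient\<close>

context measured_hom
begin

text \<open>Approximants on the quotient must again come from integrable functions. Preimages of
  null sets are null, so the pushed measure vanishes on null sets of \<open>n\<close>, and
  Radon-Nikodym supplies \<open>h\<close>.\<close>

lemma density_cm_push:
  assumes surj: "q ` carrier G = carrier Q"
    and f: "integrable m f" and u[measurable]: "u \<in> borel_measurable m" and bnd: "\<And>s. cmod (u s) \<le> C"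
  shows "\<exists>h. integrable n h \<and> density_cm n h =
    weighted_image (density m (\<lambda>x. ennreal (cmod (f x)))) q (\<lambda>s. sgn (f s) * u s) n"
proof -
  let ?P = "density m (\<lambda>x. ennreal (cmod (f x)))" and ?w = "\<lambda>s. sgn (f s) * u s"
  note fm[measurable] = borel_measurable_integrable[OF f]
  have P: "finite_measure ?P" by (rule weighted_image_polar(1)[OF f measurable_ident_sets[OF refl]])
  have C: "0 \<le> C" using bnd norm_ge_zero order_trans by blast
  have wm: "?w \<in> borel_measurable ?P" by (simp add: sgn_div_norm)
  have wb: "cmod (?w s) \<le> C" for s using bnd[of s] C by (simp add: norm_mult norm_sgn)
  have qP: "q \<in> ?P \<rightarrow>\<^sub>M n" by simp
  have cm: "complex_measure n (weighted_image ?P q ?w n)"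
    by (rule complex_measure_weighted_image[OF P qP wm wb])
  have "weighted_image ?P q ?w n B = 0" if B: "B \<in> null_sets n" for B
  proof -
    have "AE x in m. q x \<notin> B"
      using null_sets_vimage[OF surj B] by (auto dest: AE_not_in)
    then have "AE x in ?P. q x \<notin> B"
      by (subst AE_density) auto
    then have "(\<integral>x. indicator B (q x) * ?w x \<partial>?P) = 0"
      by (intro integral_eq_zero_AE) (auto elim: AE_mp)
    then show ?thesis by (simp add: weighted_image_def)
  qed
  then show ?thesis
    using complex_Radon_Nikodym[OF Q.sigma_finite_measure_axioms cm] by metis
qed

lemma reduced_cstar_push:
  assumes surj: "q ` carrier G = carrier Q"
    and sm: "sets m = sets (borel_of T)" and sn: "sets n = sets (borel_of TQ)"
    and P: "finite_measure P" and sP[measurable_cong]: "sets P = sets m"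
    and \<theta>[measurable]: "\<theta> \<in> borel_measurable P" and bnd: "\<And>s. cmod (\<theta> s) \<le> 1"
    and \<xi>: "\<xi> \<in> L2_fun m" and \<eta>: "\<eta> \<in> L2_fun m"
    and red: "conv_op G T m (weighted_image P (\<lambda>x. x) \<theta> m) \<in> reduced_cstar G T m"
  shows "conv_op Q TQ n (weighted_image P q (\<lambda>s. \<theta> s * G.coefficient \<xi> \<eta> s) n) \<in> reduced_cstar Q TQ n"
proof -
  let ?u = "G.coefficient \<xi> \<eta>" and ?C = "G.coefficient_bound \<xi> \<eta>"
  note [measurable] = G.coefficient_measurable[OF L2_fun_measurable[OF \<xi>] L2_fun_measurable[OF \<eta>]]
  note ub = G.norm_coefficient_le[OF \<xi> \<eta>] and C = G.coefficient_bound[OF \<xi> \<eta>]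
  have wb: "cmod (\<theta> s * ?u s) \<le> ?C" for s
    using mult_mono[OF bnd[of s] ub[of s]] by (simp add: norm_mult)
  have id: "(\<lambda>x. x) \<in> P \<rightarrow>\<^sub>M m" by (simp add: measurable_ident_sets sP)
  have qP: "q \<in> P \<rightarrow>\<^sub>M n" by measurable
  have wm: "(\<lambda>s. \<theta> s * ?u s) \<in> borel_measurable P" by measurable
  show ?thesis
    unfolding reduced_cstar_def
  proof (intro CollectI conjI allI impI)
    show "conv_op Q TQ n (weighted_image P q (\<lambda>s. \<theta> s * ?u s) n) \<in> bounded_ops n"
      by (rule Q.conv_op_bounded[OF P qP wm wb sn])
    fix \<epsilon> :: real assume \<epsilon>: "\<epsilon> > 0"
    \<comment> \<open>Transference multiplies the distance by \<open>?C\<close>, which may be 0;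
      adding 1 keeps the quotient meaningful and the final inequality strict.\<close>
    then have "\<epsilon> / (?C + 1) > 0" using C(1) by simp
    then obtain f where f: "integrable m f"
      and lt: "op_norm m (op_diff m (conv_op G T m (weighted_image P (\<lambda>x. x) \<theta> m)) (conv_op G T m (density_cm m f))) < \<epsilon> / (?C + 1)"
      using red unfolding reduced_cstar_def by blast
    note fm[measurable] = borel_measurable_integrable[OF f]
    define P' where "P' = density m (\<lambda>x. ennreal (cmod (f x)))"
    have P': "finite_measure P'"
      unfolding P'_def by (rule weighted_image_polar(1)[OF f measurable_ident_sets[OF refl]])
    have sP'[measurable_cong]: "sets P' = sets m" by (simp add: P'_def)
    have id': "(\<lambda>x. x) \<in> P' \<rightarrow>\<^sub>M m" by (simp add: measurable_ident_sets sP')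
    have sg[measurable]: "(\<lambda>x. sgn (f x)) \<in> borel_measurable P'" by (simp add: P'_def sgn_div_norm)
    have sb: "cmod (sgn (f x)) \<le> 1" for x by (simp add: norm_sgn)
    have wb': "cmod (sgn (f s) * ?u s) \<le> ?C" for s
      using mult_mono[OF sb[of s] ub[of s]] by (simp add: norm_mult)
    have qP': "q \<in> P' \<rightarrow>\<^sub>M n" by measurable
    have wm': "(\<lambda>s. sgn (f s) * ?u s) \<in> borel_measurable P'" by measurable
    define \<delta> where "\<delta> = op_norm m (op_diff m (conv_op G T m (weighted_image P (\<lambda>x. x) \<theta> m)) (conv_op G T m (density_cm m f)))"
    note d = G.op_diff_conv_op_bound[OF P id \<theta> bnd P' id' sg sb sm,
        folded density_cm_eq_weighted_image[OF f, folded P'_def], folded \<delta>_def]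
    obtain h where h: "integrable n h" "density_cm n h = weighted_image P' q (\<lambda>s. sgn (f s) * ?u s) n"
      using density_cm_push[OF surj f G.coefficient_measurable[OF L2_fun_measurable[OF \<xi>] L2_fun_measurable[OF \<eta>]] ub]
      unfolding P'_def by blast
    \<comment> \<open>Transference with \<open>u\<close> fixed and \<open>f\<close> as the second
      measure. Its hypothesis is the function form of the distance \<delta> on
      \<open>G\<close>.\<close>
    have "op_norm n (op_diff n (conv_op Q TQ n (weighted_image P q (\<lambda>s. \<theta> s * ?u s) n)) (conv_op Q TQ n (density_cm n h))) \<le> \<delta> * ?C"
      unfolding h(2)
    proof (rule Q.op_diff_conv_op_bound(3)[OF P qP wm wb P' qP' wm' wb' sn])
      show "0 \<le> \<delta> * ?C" using d(1) C(1) by simp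
      fix a assume "a \<in> L2_fun n"
      then have "sq_norm n (\<lambda>y. Q.wconv P q (\<lambda>s. \<theta> s * ?u s) a y - Q.wconv P' q (\<lambda>s. sgn (f s) * ?u s) a y)
          \<le> ennreal \<delta> ^ 2 * (sq_norm m \<xi> * sq_norm m \<eta>) * sq_norm n a"
        by (rule transference[OF P sP \<theta> bnd P' sP' sg sb \<xi> \<eta> _ d(2)])
      also have "\<dots> = ennreal (\<delta> * ?C) ^ 2 * sq_norm n a"
        using d(1) C(1) by (simp add: C(2)[symmetric] ennreal_mult power_mult_distrib)
      finally show "sq_norm n (\<lambda>y. Q.wconv P q (\<lambda>s. \<theta> s * ?u s) a y - Q.wconv P' q (\<lambda>s. sgn (f s) * ?u s) a y)
          \<le> ennreal (\<delta> * ?C) ^ 2 * sq_norm n a" .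
    qed
    also have "\<delta> * ?C \<le> \<delta> * (?C + 1)" using d(1) by (intro mult_left_mono) auto
    also have "\<dots> < \<epsilon>" using lt C(1) by (simp add: \<delta>_def pos_less_divide_eq)
    finally show "\<exists>f. integrable n f \<and> op_norm n (op_diff n (conv_op Q TQ n (weighted_image P q (\<lambda>s. \<theta> s * ?u s) n)) (conv_op Q TQ n (density_cm n f))) < \<epsilon>"
      using h(1) by blast
  qed
qed

end

text \<open>The support only says that each point off \<open>E\<close> has an open neighbourhood of
  variation 0. Second countability provides countably many basic ones covering \<open>B\<close>;
  cutting \<open>B\<close> into disjoint pieces along them gives a series of zeros.\<close>

lemma measures_onD:
  assumes sc: "second_countable T" and \<mu>: "\<mu> \<in> measures_on T E" and E: "closedin T E"
    and B: "B \<in> sets (borel_of T)" "B \<inter> E = {}"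
  shows "\<mu> B = 0"
proof -
  let ?M = "borel_of T"
  have cm: "complex_measure ?M \<mu>" and supp: "measure_support T \<mu> \<subseteq> E"
    using \<mu> by (auto simp: measures_on_def)
  have cs: "countably_summing ?M \<mu>" using cm by (simp add: complex_measure_def countably_summing_def)
  note sp = space_borel_of[of T] and op = openin_sets_borel_of[of T]
  have null: "\<mu> A = 0" if V: "V \<in> sets ?M" "total_variation ?M \<mu> V = 0" and A: "A \<in> sets ?M" "A \<subseteq> V" for A V
  proof -
    have "ennreal (cmod (\<mu> A)) \<le> (\<Sum>B\<in>{A, V - A}. ennreal (cmod (\<mu> B)))"
      by (cases "A = V - A") auto
    also have "\<dots> \<le> total_variation ?M \<mu> V"
      unfolding total_variation_def using A V by (intro SUP_upper) (auto simp: disjoint_def)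
    finally show ?thesis using V by simp
  qed
  obtain \<B> where \<B>: "countable \<B>" "\<And>V. V \<in> \<B> \<Longrightarrow> openin T V"
    "\<And>U x. openin T U \<Longrightarrow> x \<in> U \<Longrightarrow> \<exists>V\<in>\<B>. x \<in> V \<and> V \<subseteq> U"
    using second_countableE[OF sc] by metis
  define \<N> where "\<N> = {V \<in> \<B>. total_variation ?M \<mu> V = 0}"
  have mono: "total_variation ?M \<mu> V = 0" if "V \<subseteq> U" "V \<in> sets ?M" "U \<in> sets ?M" "total_variation ?M \<mu> U = 0" for U V
  proof -
    have "total_variation ?M \<mu> V \<le> 0"
      unfolding total_variation_def
    proof (intro SUP_least)
      fix P assume P: "P \<in> {P. finite P \<and> disjoint P \<and> P \<subseteq> sets ?M \<and> \<Union>P = V}"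
      have "\<mu> B = 0" if "B \<in> P" for B
        using P that by (intro null[OF \<open>U \<in> sets ?M\<close> \<open>total_variation ?M \<mu> U = 0\<close>]) (use \<open>V \<subseteq> U\<close> in auto)
      then show "(\<Sum>B\<in>P. ennreal (cmod (\<mu> B))) \<le> 0" by simp
    qed
    then show ?thesis by simp
  qed
  have cover: "B \<subseteq> \<Union>\<N>"
  proof
    fix x assume x: "x \<in> B"
    then have "x \<in> topspace T" using B sets.sets_into_space sp by blast
    moreover have "x \<notin> measure_support T \<mu>" using x B(2) supp by blast
    ultimately obtain U where U: "openin T U" "x \<in> U" "\<not> 0 < total_variation ?M \<mu> U"
      unfolding measure_support_def by blast
    then have U0: "total_variation ?M \<mu> U = 0" by simp
    obtain V where V: "V \<in> \<B>" "x \<in> V" "V \<subseteq> U" using \<B>(3)[OF U(1,2)] by blast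
    then show "x \<in> \<Union>\<N>"
      using mono[OF V(3) op op U0] \<B>(2) U(1) by (auto simp: \<N>_def)
  qed
  show ?thesis
  proof (cases "\<N> = {}")
    case True
    then show ?thesis using cover countably_summing_empty[OF cs] by auto
  next
    case False
    have "countable \<N>" using \<B>(1) by (simp add: \<N>_def)
    define A where "A = from_nat_into \<N>"
    have A: "A i \<in> \<N>" for i using from_nat_into[OF False] by (simp add: A_def)
    have UA: "(\<Union>i. A i) = \<Union>\<N>"
      using range_from_nat_into[OF False \<open>countable \<N>\<close>] by (simp add: A_def)
    have As: "A i \<in> sets ?M" for i using A[of i] \<B>(2) op by (auto simp: \<N>_def)
    have d: "disjointed A i \<in> sets ?M" for i
      using sets.range_disjointed_sets[of A ?M] As by auto
    have "(\<lambda>i. \<mu> (B \<inter> disjointed A i)) sums \<mu> (\<Union>i. B \<inter> disjointed A i)"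
    proof (rule countably_summingD[OF cs])
      show "disjoint_family (\<lambda>i. B \<inter> disjointed A i)"
        by (rule disjoint_family_on_bisimulation[OF disjoint_family_disjointed[of A]]) blast
    qed (use B d in auto)
    moreover have "(\<Union>i. B \<inter> disjointed A i) = B"
      using cover UA UN_disjointed_eq[of A] by auto
    moreover have "\<mu> (B \<inter> disjointed A i) = 0" for i
    proof (rule null[of "A i"])
      show "total_variation ?M \<mu> (A i) = 0" using A[of i] by (simp add: \<N>_def)
      show "B \<inter> disjointed A i \<subseteq> A i" using disjointed_subset[of A i] by blast
    qed (use As B d in auto)
    ultimately show ?thesis by (simp add: sums_iff)
  qed
qed

text \<open>The complement of \<open>E\<close> is itself an open neighbourhood of variation 0 for
  every point off \<open>E\<close>.\<close>

lemma measures_onI: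
  assumes "complex_measure (borel_of T) \<mu>" "closedin T E"
    and 0: "\<And>B. B \<in> sets (borel_of T) \<Longrightarrow> B \<inter> E = {} \<Longrightarrow> \<mu> B = 0"
  shows "\<mu> \<in> measures_on T E"
proof -
  have "total_variation (borel_of T) \<mu> (topspace T - E) \<le> 0"
    unfolding total_variation_def
  proof (intro SUP_least)
    fix P assume P: "P \<in> {P. finite P \<and> disjoint P \<and> P \<subseteq> sets (borel_of T) \<and> \<Union>P = topspace T - E}"
    have "\<mu> B = 0" if "B \<in> P" for B using P that by (intro 0) auto
    then show "(\<Sum>B\<in>P. ennreal (cmod (\<mu> B))) \<le> 0" by simp
  qed
  then have "measure_support T \<mu> \<subseteq> E"
    using assms(2) unfolding measure_support_def closedin_def by force
  then show ?thesis using assms(1) by (simp add: measures_on_def)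
qed

text \<open>That the original measure is 0 on the preimage of \<open>B\<close> would not survive the
  factor \<open>u\<close>. It is 0 on all measurable subsets of the preimage, however, so \<theta>
  vanishes almost everywhere there, and with it the product of \<theta> and
  \<open>u\<close>.\<close>

lemma (in measured_hom) measures_on_push:
  assumes sc: "second_countable T" and sm: "sets m = sets (borel_of T)" and sn: "sets n = sets (borel_of TQ)"
    and E: "closedin TQ E" and E': "closedin T {x \<in> carrier G. q x \<in> E}"
    and P: "finite_measure P" and sP[measurable_cong]: "sets P = sets m"
    and \<theta>[measurable]: "\<theta> \<in> borel_measurable P" and bnd: "\<And>s. cmod (\<theta> s) \<le> 1"
    and u[measurable]: "u \<in> borel_measurable m" and ub: "\<And>s. cmod (u s) \<le> C"
    and \<mu>: "weighted_image P (\<lambda>x. x) \<theta> m \<in> measures_on T {x \<in> carrier G. q x \<in> E}"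
  shows "weighted_image P q (\<lambda>s. \<theta> s * u s) n \<in> measures_on TQ E"
proof (rule measures_onI[OF _ E])
  interpret P: finite_measure P by fact
  have qP: "q \<in> P \<rightarrow>\<^sub>M n" by measurable
  have "complex_measure n (weighted_image P q (\<lambda>s. \<theta> s * u s) n)"
  proof (rule complex_measure_weighted_image[OF P qP])
    show "cmod (\<theta> s * u s) \<le> C" for s using mult_mono[OF bnd[of s] ub[of s]] by (simp add: norm_mult)
  qed measurable
  then show "complex_measure (borel_of TQ) (weighted_image P q (\<lambda>s. \<theta> s * u s) n)"
    using sn by (simp add: complex_measure_def)
  fix B assume "B \<in> sets (borel_of TQ)" and BE: "B \<inter> E = {}"
  then have B[measurable]: "B \<in> sets n" using sn by simp
  let ?A = "{x \<in> space P. q x \<in> B}"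
  have A[measurable]: "?A \<in> sets P" by measurable
  have i\<theta>: "integrable P \<theta>" using bnd by (intro P.integrable_const_bound[of _ 1]) auto
  have iA: "integrable P (\<lambda>x. indicator ?A x *\<^sub>R \<theta> x)" using A i\<theta> by (rule integrable_mult_indicator)
  have "AE x in P. indicator ?A x *\<^sub>R \<theta> x = 0"
  proof (rule P.density_zero[OF iA])
    fix S assume S: "S \<in> sets P"
    have "weighted_image P (\<lambda>x. x) \<theta> m (S \<inter> ?A) = 0"
      using S A sP sm BE by (intro measures_onD[OF sc \<mu> E']) auto
    moreover have "S \<inter> ?A \<in> sets m" using S A sP by auto
    ultimately have "(\<integral>x. indicator (S \<inter> ?A) x * \<theta> x \<partial>P) = 0"
      by (simp add: weighted_image_def)
    also have "(\<integral>x. indicator (S \<inter> ?A) x * \<theta> x \<partial>P) = set_lebesgue_integral P S (\<lambda>x. indicator ?A x *\<^sub>R \<theta> x)"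
      unfolding set_lebesgue_integral_def
      by (intro Bochner_Integration.integral_cong) (auto simp: indicator_def)
    finally show "set_lebesgue_integral P S (\<lambda>x. indicator ?A x *\<^sub>R \<theta> x) = 0" .
  qed
  with AE_space have "AE x in P. indicator B (q x) * (\<theta> x * u x) = 0"
    by eventually_elim (auto simp: indicator_def split: if_splits)
  then show "weighted_image P q (\<lambda>s. \<theta> s * u s) n B = 0"
    by (simp add: weighted_image_def integral_eq_zero_AE)
qed

section \<open>Topology of the quotient group\<close>

lemma measurable_borel_ofI:
  assumes "f \<in> space N \<rightarrow> topspace Z" "\<And>U. openin Z U \<Longrightarrow> {x \<in> space N. f x \<in> U} \<in> sets N"
  shows "f \<in> N \<rightarrow>\<^sub>M borel_of Z"
  unfolding borel_of_def
proof (rule measurable_measure_of)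
  show "{U. openin Z U} \<subseteq> Pow (topspace Z)" using openin_subset by auto
  fix U assume "U \<in> {U. openin Z U}"
  then have "{x \<in> space N. f x \<in> U} \<in> sets N" using assms(2) by simp
  also have "{x \<in> space N. f x \<in> U} = f -` U \<inter> space N" by auto
  finally show "f -` U \<inter> space N \<in> sets N" .
qed (rule assms(1))

lemma continuous_map_measurable:
  assumes "continuous_map X Y f"
  shows "f \<in> borel_of X \<rightarrow>\<^sub>M borel_of Y"
  using assms by (intro measurable_borel_ofI)
    (auto simp: continuous_map_def space_borel_of intro: openin_sets_borel_of)

lemma openin_prod_topologyE:
  assumes "openin (prod_topology X Y) W" "(x, y) \<in> W"
  obtains A B where "openin X A" "openin Y B" "x \<in> A" "y \<in> B" "A \<times> B \<subseteq> W"
proof -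
  have "\<exists>A B. openin X A \<and> openin Y B \<and> x \<in> A \<and> y \<in> B \<and> A \<times> B \<subseteq> W"
    using assms(1)[unfolded openin_prod_topology_alt, rule_format, OF assms(2)] .
  then show thesis using that by (elim exE conjE)
qed

text \<open>An open set of the product topology is a union of rectangles of basic open sets. Second
  countability makes the union countable and places it in the product \<sigma>-algebra, which in
  general misses some Borel sets of the product.\<close>

lemma continuous_map_measurable_pair:
  assumes f: "continuous_map (prod_topology X Y) Z f" and sc: "second_countable X" "second_countable Y"
  shows "f \<in> borel_of X \<Otimes>\<^sub>M borel_of Y \<rightarrow>\<^sub>M borel_of Z"
proof (rule measurable_borel_ofI)
  have sp: "space (borel_of X \<Otimes>\<^sub>M borel_of Y) = topspace (prod_topology X Y)"
    by (simp add: space_pair_measure space_borel_of)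
  show "f \<in> space (borel_of X \<Otimes>\<^sub>M borel_of Y) \<rightarrow> topspace Z"
    using f unfolding sp continuous_map_def by simp
  fix U assume U: "openin Z U"
  let ?W = "{z \<in> topspace (prod_topology X Y). f z \<in> U}"
  have W: "openin (prod_topology X Y) ?W" using f U unfolding continuous_map_def by blast
  obtain \<A> where \<A>: "countable \<A>" "\<And>V. V \<in> \<A> \<Longrightarrow> openin X V"
    "\<And>U x. openin X U \<Longrightarrow> x \<in> U \<Longrightarrow> \<exists>V\<in>\<A>. x \<in> V \<and> V \<subseteq> U"
    using second_countableE[OF sc(1)] by metis
  obtain \<B> where \<B>: "countable \<B>" "\<And>V. V \<in> \<B> \<Longrightarrow> openin Y V"
    "\<And>U x. openin Y U \<Longrightarrow> x \<in> U \<Longrightarrow> \<exists>V\<in>\<B>. x \<in> V \<and> V \<subseteq> U"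
    using second_countableE[OF sc(2)] by metis
  let ?I = "{p \<in> \<A> \<times> \<B>. fst p \<times> snd p \<subseteq> ?W}"
  have "?W \<subseteq> (\<Union>p\<in>?I. fst p \<times> snd p)"
  proof
    fix z assume z: "z \<in> ?W"
    obtain x y where xy: "z = (x, y)" by (cases z)
    obtain A B where AB: "openin X A" "openin Y B" "x \<in> A" "y \<in> B" "A \<times> B \<subseteq> ?W"
      using z unfolding xy by (rule openin_prod_topologyE[OF W])
    obtain A' where A': "A' \<in> \<A>" "x \<in> A'" "A' \<subseteq> A" using \<A>(3) AB by blast
    obtain B' where B': "B' \<in> \<B>" "y \<in> B'" "B' \<subseteq> B" using \<B>(3) AB by blast
    have "A' \<times> B' \<subseteq> ?W" using A'(3) B'(3) AB(5) by (meson Sigma_mono order_trans)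
    then have "(A', B') \<in> ?I" using A' B' by simp
    then show "z \<in> (\<Union>p\<in>?I. fst p \<times> snd p)"
      using A' B' xy by (intro UN_I[of "(A', B')"]) auto
  qed
  then have "?W = (\<Union>p\<in>?I. fst p \<times> snd p)" by auto
  also have "\<dots> \<in> sets (borel_of X \<Otimes>\<^sub>M borel_of Y)"
    using \<A>(1,2) \<B>(1,2)
    by (intro sets.countable_UN' countable_subset[of ?I "\<A> \<times> \<B>"])
      (auto intro!: pair_measureI openin_sets_borel_of)
  finally show "{x \<in> space (borel_of X \<Otimes>\<^sub>M borel_of Y). f x \<in> U} \<in> sets (borel_of X \<Otimes>\<^sub>M borel_of Y)"
    unfolding sp .
qed

text \<open>For \<sigma>-finiteness, local compactness puts every point into a basic open set
  contained in a compact set, hence of finite measure, and there are countably many basic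
  sets.\<close>

lemma measured_group_haar:
  assumes lc: "locally_compact_group G T" and sc: "second_countable T" and haar: "haar_measure G T m"
  shows "measured_group G m"
proof -
  have tg: "topological_group G T" and lcs: "locally_compact_space T"
    using lc by (auto simp: locally_compact_group_def)
  have grp: "group G" and ts: "topspace T = carrier G" and hd: "Hausdorff_space T"
    and mult: "continuous_map (prod_topology T T) T (\<lambda>(x, y). x \<otimes>\<^bsub>G\<^esub> y)"
    and inv: "continuous_map T T (\<lambda>x. inv\<^bsub>G\<^esub> x)"
    using tg by (auto simp: topological_group_def)
  have sm[measurable_cong]: "sets m = sets (borel_of T)" and spm: "space m = topspace T"
    using haar by (auto simp: haar_measure_def)
  obtain \<B> where \<B>: "countable \<B>" "\<And>V. V \<in> \<B> \<Longrightarrow> openin T V"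
    "\<And>U x. openin T U \<Longrightarrow> x \<in> U \<Longrightarrow> \<exists>V\<in>\<B>. x \<in> V \<and> V \<subseteq> U"
    using second_countableE[OF sc] by metis
  define \<F> where "\<F> = {V \<in> \<B>. emeasure m V \<noteq> \<infinity>}"
  have "\<Union>\<F> = space m"
  proof (intro equalityI subsetI)
    fix x assume "x \<in> space m"
    then have "x \<in> topspace T" by (simp add: spm)
    then obtain U K where UK: "openin T U" "compactin T K" "x \<in> U" "U \<subseteq> K"
      using lcs unfolding locally_compact_space_def by blast
    then obtain V where V: "V \<in> \<B>" "x \<in> V" "V \<subseteq> U" using \<B>(3) by blast
    have "K \<in> sets m"
      unfolding sm by (intro closedin_sets_borel_of compactin_imp_closedin hd UK)
    then have "emeasure m V \<le> emeasure m K"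
      using V UK by (intro emeasure_mono) auto
    also have "\<dots> < \<infinity>" using haar UK by (auto simp: haar_measure_def)
    finally show "x \<in> \<Union>\<F>" using V by (auto simp: \<F>_def)
  qed (use \<B>(2) openin_subset spm in \<open>auto simp: \<F>_def\<close>)
  then have sf: "sigma_finite_measure m"
    using \<B>(1,2) sm openin_sets_borel_of[of T]
    by (intro sigma_finite_measure.intro exI[of _ \<F>]) (auto simp: \<F>_def)
  show ?thesis
  proof (intro measured_group.intro measured_group_axioms.intro grp sf)
    show "(\<lambda>(x, y). x \<otimes>\<^bsub>G\<^esub> y) \<in> m \<Otimes>\<^sub>M m \<rightarrow>\<^sub>M m"
      using continuous_map_measurable_pair[OF mult sc sc]
      by (simp add: measurable_cong_sets[OF sets_pair_measure_cong[OF sm sm] sm])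
    show "(\<lambda>x. inv\<^bsub>G\<^esub> x) \<in> m \<rightarrow>\<^sub>M m"
      using continuous_map_measurable[OF inv] by (simp add: measurable_cong_sets[OF sm sm])
  qed (use haar ts in \<open>auto simp: haar_measure_def\<close>)
qed

text \<open>The preimage of the image of \<open>U\<close> is the union of the translates of
  \<open>U\<close> by elements of \<open>H\<close>, and each translate is open.\<close>

lemma open_map_coset:
  assumes tg: "topological_group G T" and H: "subgroup H G"
  shows "open_map T (coset_topology G T H) (\<lambda>x. H #>\<^bsub>G\<^esub> x)"
  unfolding open_map_def
proof (intro allI impI)
  interpret group G using tg by (simp add: topological_group_def)
  have ts: "topspace T = carrier G"
    and mult: "continuous_map (prod_topology T T) T (\<lambda>(x, y). x \<otimes>\<^bsub>G\<^esub> y)"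
    using tg by (auto simp: topological_group_def)
  have HG: "H \<subseteq> carrier G" by (rule subgroup.subset[OF H])
  fix U assume U: "openin T U"
  then have UG: "U \<subseteq> carrier G" using openin_subset ts by metis
  have eq: "{x \<in> topspace T. H #>\<^bsub>G\<^esub> x \<in> (\<lambda>x. H #>\<^bsub>G\<^esub> x) ` U} =
      (\<Union>h\<in>H. {x \<in> topspace T. inv\<^bsub>G\<^esub> h \<otimes>\<^bsub>G\<^esub> x \<in> U})"
  proof (intro equalityI subsetI)
    fix x assume "x \<in> {x \<in> topspace T. H #>\<^bsub>G\<^esub> x \<in> (\<lambda>x. H #>\<^bsub>G\<^esub> x) ` U}"
    then obtain u where x: "x \<in> carrier G" "u \<in> U" "H #>\<^bsub>G\<^esub> x = H #>\<^bsub>G\<^esub> u" by (auto simp: ts)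
    then have "x \<in> H #>\<^bsub>G\<^esub> u" using rcos_self[OF x(1) H] by simp
    then obtain h where h: "h \<in> H" "x = h \<otimes>\<^bsub>G\<^esub> u" by (auto simp: r_coset_def)
    have "h \<in> carrier G" "u \<in> carrier G" using h(1) HG UG x(2) by auto
    then have "inv\<^bsub>G\<^esub> h \<otimes>\<^bsub>G\<^esub> x = u" unfolding h(2) by (simp add: m_assoc[symmetric])
    then show "x \<in> (\<Union>h\<in>H. {x \<in> topspace T. inv\<^bsub>G\<^esub> h \<otimes>\<^bsub>G\<^esub> x \<in> U})"
      using x(1,2) ts by (intro UN_I[OF h(1)]) simp
  next
    fix x assume "x \<in> (\<Union>h\<in>H. {x \<in> topspace T. inv\<^bsub>G\<^esub> h \<otimes>\<^bsub>G\<^esub> x \<in> U})"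
    then obtain h where h: "h \<in> H" "x \<in> carrier G" "inv\<^bsub>G\<^esub> h \<otimes>\<^bsub>G\<^esub> x \<in> U" by (auto simp: ts)
    have "h \<in> carrier G" using h(1) HG by auto
    then have "x = h \<otimes>\<^bsub>G\<^esub> (inv\<^bsub>G\<^esub> h \<otimes>\<^bsub>G\<^esub> x)" using h(2) by (simp add: m_assoc[symmetric])
    then have "x \<in> H #>\<^bsub>G\<^esub> (inv\<^bsub>G\<^esub> h \<otimes>\<^bsub>G\<^esub> x)" using h(1) by (auto simp: r_coset_def)
    then have "H #>\<^bsub>G\<^esub> (inv\<^bsub>G\<^esub> h \<otimes>\<^bsub>G\<^esub> x) = H #>\<^bsub>G\<^esub> x"
      using h UG H by (intro repr_independence) auto
    then show "x \<in> {x \<in> topspace T. H #>\<^bsub>G\<^esub> x \<in> (\<lambda>x. H #>\<^bsub>G\<^esub> x) ` U}"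
      using h by (auto simp: ts intro!: image_eqI[of _ _ "inv\<^bsub>G\<^esub> h \<otimes>\<^bsub>G\<^esub> x"])
  qed
  have "openin T {x \<in> topspace T. inv\<^bsub>G\<^esub> h \<otimes>\<^bsub>G\<^esub> x \<in> U}" if "h \<in> H" for h
  proof -
    have "inv\<^bsub>G\<^esub> h \<in> topspace T" using that HG ts by auto
    then have "continuous_map T (prod_topology T T) (\<lambda>x. (inv\<^bsub>G\<^esub> h, x))"
      by (intro continuous_map_pairedI) auto
    then have "continuous_map T T ((\<lambda>(x, y). x \<otimes>\<^bsub>G\<^esub> y) \<circ> (\<lambda>x. (inv\<^bsub>G\<^esub> h, x)))"
      using mult by (rule continuous_map_compose)
    then have "continuous_map T T (\<lambda>x. inv\<^bsub>G\<^esub> h \<otimes>\<^bsub>G\<^esub> x)" by (simp add: comp_def)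
    then show ?thesis using U by (rule openin_continuous_map_preimage)
  qed
  then have "openin T {x \<in> topspace T. H #>\<^bsub>G\<^esub> x \<in> (\<lambda>x. H #>\<^bsub>G\<^esub> x) ` U}"
    unfolding eq by blast
  then show "openin (coset_topology G T H) ((\<lambda>x. H #>\<^bsub>G\<^esub> x) ` U)"
    using UG unfolding openin_coset_topology by (auto simp: carrier_FactGroup)
qed

text \<open>Since the quotient map is open, rectangles of neighbourhoods in \<open>G\<close> map to
  rectangles of neighbourhoods of cosets; continuity of the product and separation both rest on
  this. Inversion descends by the universal property of the quotient topology.\<close>

lemma topological_group_quotient:
  assumes tg: "topological_group G T" and H: "H \<lhd> G" and cl: "closedin T H"
  shows "topological_group (G Mod H) (coset_topology G T H)"
proof -
  interpret normal H G by (rule H)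
  have ts: "topspace T = carrier G"
    and mult: "continuous_map (prod_topology T T) T (\<lambda>(x, y). x \<otimes>\<^bsub>G\<^esub> y)"
    and inv: "continuous_map T T (\<lambda>x. inv\<^bsub>G\<^esub> x)"
    using tg by (auto simp: topological_group_def)
  let ?Q = "G Mod H" and ?T = "coset_topology G T H" and ?q = "\<lambda>x. H #>\<^bsub>G\<^esub> x"
  note tq = topspace_coset_topology[OF ts, of H]
  have qc: "continuous_map T ?T ?q"
    by (rule quotient_imp_continuous_map[OF quotient_map_coset_topology[OF ts]])
  have qo: "openin ?T (?q ` U)" if "openin T U" for U
    using open_map_coset[OF tg is_subgroup] that unfolding open_map_def by blast
  have pre: "openin T {x \<in> carrier G. ?q x \<in> V}" if "openin ?T V" for V
    using openin_continuous_map_preimage[OF qc that] by (simp add: ts)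
  have car: "carrier ?Q = ?q ` carrier G" by (rule carrier_FactGroup)
  have mult': "continuous_map (prod_topology ?T ?T) ?T (\<lambda>(x, y). x \<otimes>\<^bsub>?Q\<^esub> y)"
    unfolding continuous_map_def
  proof (intro conjI allI impI)
    show "(\<lambda>(x, y). x \<otimes>\<^bsub>?Q\<^esub> y) \<in> topspace (prod_topology ?T ?T) \<rightarrow> topspace ?T"
      using group.is_monoid[OF factorgroup_is_group] unfolding topspace_prod_topology tq
      by (auto intro!: monoid.m_closed simp del: mult_FactGroup)
    fix V assume V: "openin ?T V"
    show "openin (prod_topology ?T ?T) {p \<in> topspace (prod_topology ?T ?T). (case p of (x, y) \<Rightarrow> x \<otimes>\<^bsub>?Q\<^esub> y) \<in> V}"
      unfolding openin_prod_topology_alt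
    proof (intro allI impI)
      fix a b assume ab: "(a, b) \<in> {p \<in> topspace (prod_topology ?T ?T). (case p of (x, y) \<Rightarrow> x \<otimes>\<^bsub>?Q\<^esub> y) \<in> V}"
      then obtain x y where xy: "x \<in> carrier G" "y \<in> carrier G" "a = ?q x" "b = ?q y"
        by (auto simp: tq car)
      let ?W = "{p \<in> topspace (prod_topology T T). (case p of (x, y) \<Rightarrow> x \<otimes>\<^bsub>G\<^esub> y) \<in> {x \<in> carrier G. ?q x \<in> V}}"
      have "openin (prod_topology T T) ?W"
        by (rule openin_continuous_map_preimage[OF mult pre[OF V]])
      moreover have "(x, y) \<in> ?W"
        using xy ab by (simp add: ts rcos_sum)
      ultimately obtain A B where AB: "openin T A" "openin T B" "x \<in> A" "y \<in> B" "A \<times> B \<subseteq> ?W"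
        by (rule openin_prod_topologyE)
      have "?q ` A \<times> ?q ` B \<subseteq> {p \<in> topspace (prod_topology ?T ?T). (case p of (x, y) \<Rightarrow> x \<otimes>\<^bsub>?Q\<^esub> y) \<in> V}"
      proof
        fix p assume "p \<in> ?q ` A \<times> ?q ` B"
        then obtain u v where uv: "u \<in> A" "v \<in> B" "p = (?q u, ?q v)" by auto
        then have "(u, v) \<in> ?W" using AB(5) by blast
        then show "p \<in> {p \<in> topspace (prod_topology ?T ?T). (case p of (x, y) \<Rightarrow> x \<otimes>\<^bsub>?Q\<^esub> y) \<in> V}"
          by (auto simp: ts tq car rcos_sum uv(3))
      qed
      then show "\<exists>U W. openin ?T U \<and> openin ?T W \<and> a \<in> U \<and> b \<in> W \<and>
          U \<times> W \<subseteq> {p \<in> topspace (prod_topology ?T ?T). (case p of (x, y) \<Rightarrow> x \<otimes>\<^bsub>?Q\<^esub> y) \<in> V}"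
        using qo[OF AB(1)] qo[OF AB(2)] AB(3,4) xy(3,4) by (intro exI[of _ "?q ` A"] exI[of _ "?q ` B"]) simp
    qed
  qed
  have iq: "inv\<^bsub>?Q\<^esub> (?q x) = ?q (inv\<^bsub>G\<^esub> x)" if "x \<in> carrier G" for x
    using that by (subst inv_FactGroup) (auto simp: car rcos_inv)
  have inv': "continuous_map ?T ?T (\<lambda>x. inv\<^bsub>?Q\<^esub> x)"
  proof (rule continuous_compose_quotient_map[OF quotient_map_coset_topology[OF ts]])
    have "continuous_map T ?T (?q \<circ> (\<lambda>x. inv\<^bsub>G\<^esub> x))"
      by (rule continuous_map_compose[OF inv qc])
    then show "continuous_map T ?T ((\<lambda>x. inv\<^bsub>?Q\<^esub> x) \<circ> ?q)"
      by (rule continuous_map_eq) (simp add: iq ts)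
  qed
  have "Hausdorff_space ?T"
    unfolding Hausdorff_space_def
  proof (intro allI impI)
    fix a b assume "a \<in> topspace ?T \<and> b \<in> topspace ?T \<and> a \<noteq> b"
    then obtain x y where xy: "x \<in> carrier G" "y \<in> carrier G" "a = ?q x" "b = ?q y" "?q x \<noteq> ?q y"
      by (auto simp: tq car)
    have dc: "continuous_map (prod_topology T T) T (\<lambda>(u, v). u \<otimes>\<^bsub>G\<^esub> inv\<^bsub>G\<^esub> v)"
    proof -
      have "continuous_map (prod_topology T T) (prod_topology T T) (\<lambda>p. (fst p, inv\<^bsub>G\<^esub> (snd p)))"
        using continuous_map_compose[OF continuous_map_snd inv]
        by (intro continuous_map_pairedI continuous_map_fst) (simp add: comp_def)
      from continuous_map_compose[OF this mult] show ?thesis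
        by (simp add: comp_def case_prod_unfold)
    qed
    \<comment> \<open>The pairs lying in different cosets; they form an open set because
      \<open>H\<close> is closed. A rectangle inside it has disjoint images.\<close>
    let ?W = "{p \<in> topspace (prod_topology T T). (case p of (u, v) \<Rightarrow> u \<otimes>\<^bsub>G\<^esub> inv\<^bsub>G\<^esub> v) \<in> topspace T - H}"
    have sep: "?q u = ?q v \<longleftrightarrow> u \<otimes>\<^bsub>G\<^esub> inv\<^bsub>G\<^esub> v \<in> H" if "u \<in> carrier G" "v \<in> carrier G" for u v
    proof
      assume "?q u = ?q v"
      then have "?q (u \<otimes>\<^bsub>G\<^esub> inv\<^bsub>G\<^esub> v) = H"
        by (rule coset_mult_inv2) (use that subset in simp_all)
      then show "u \<otimes>\<^bsub>G\<^esub> inv\<^bsub>G\<^esub> v \<in> H"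
        by (rule coset_join1) (use that is_subgroup in simp_all)
    next
      assume uv: "u \<otimes>\<^bsub>G\<^esub> inv\<^bsub>G\<^esub> v \<in> H"
      have "?q (u \<otimes>\<^bsub>G\<^esub> inv\<^bsub>G\<^esub> v) = H"
        by (rule coset_join2[OF _ is_subgroup uv]) (use that in simp)
      then show "?q u = ?q v"
        by (rule coset_mult_inv1) (use that subset in simp_all)
    qed
    have "openin (prod_topology T T) ?W"
      by (rule openin_continuous_map_preimage[OF dc openin_diff[OF openin_topspace cl]])
    moreover have "(x, y) \<in> ?W" using xy by (simp add: ts sep)
    ultimately obtain A B where AB: "openin T A" "openin T B" "x \<in> A" "y \<in> B" "A \<times> B \<subseteq> ?W"
      by (rule openin_prod_topologyE)
    have "?q u \<noteq> ?q v" if uv: "u \<in> A" "v \<in> B" for u v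
    proof
      assume eq: "?q u = ?q v"
      have "(u, v) \<in> ?W" using AB(5) uv by blast
      then show False using eq by (auto simp: ts sep)
    qed
    then have "disjnt (?q ` A) (?q ` B)" by (auto simp: disjnt_iff)
    then show "\<exists>U V. openin ?T U \<and> openin ?T V \<and> a \<in> U \<and> b \<in> V \<and> disjnt U V"
      using qo[OF AB(1)] qo[OF AB(2)] AB(3,4) xy(3,4) by (intro exI[of _ "?q ` A"] exI[of _ "?q ` B"]) simp
  qed
  then show ?thesis
    using factorgroup_is_group tq mult' inv' by (simp add: topological_group_def)
qed

lemma locally_compact_group_quotient:
  assumes lc: "locally_compact_group G T" and H: "H \<lhd> G" and cl: "closedin T H"
  shows "locally_compact_group (G Mod H) (coset_topology G T H)"
    and "second_countable T \<Longrightarrow> second_countable (coset_topology G T H)"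
proof -
  interpret normal H G by (rule H)
  have tg: "topological_group G T" and lcs: "locally_compact_space T"
    using lc by (auto simp: locally_compact_group_def)
  have ts: "topspace T = carrier G" using tg by (simp add: topological_group_def)
  note o = open_map_coset[OF tg is_subgroup] and qm = quotient_map_coset_topology[OF ts, of H]
  note c = quotient_imp_continuous_map[OF qm] and s = quotient_imp_surjective_map[OF qm]
  show "locally_compact_group (G Mod H) (coset_topology G T H)"
    unfolding locally_compact_group_def
    using topological_group_quotient[OF tg H cl] locally_compact_space_continuous_open_map_image[OF c o s lcs] by blast
  show "second_countable (coset_topology G T H)" if "second_countable T"
    by (rule second_countable_open_map_image[OF c o s that])
qed

theorem theorem3p10:
  fixes G :: "('a, 'b) monoid_scheme" and T :: "'a topology" and H :: "'a set"
    and E :: "'a set set" and m :: "'a measure" and n :: "'a set measure"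
  assumes "locally_compact_group G T"
    and "second_countable T"
    and "comm_group G \<or> compact_space T"
    and "H \<lhd> G"
    and "closedin T H"
    and "haar_measure G T m"
    and "haar_measure (G Mod H) (coset_topology G T H) n"
    and "closedin (coset_topology G T H) E"
    and "M0_set G T m {x \<in> carrier G. H #>\<^bsub>G\<^esub> x \<in> E}"
  shows "M0_set (G Mod H) (coset_topology G T H) n E"
proof -
  let ?Q = "G Mod H" and ?TQ = "coset_topology G T H" and ?q = "\<lambda>x. H #>\<^bsub>G\<^esub> x"
  let ?E = "{x \<in> carrier G. H #>\<^bsub>G\<^esub> x \<in> E}"
  note lcQ = locally_compact_group_quotient(1)[OF assms(1,4,5)]
    and scQ = locally_compact_group_quotient(2)[OF assms(1,4,5,2)]
  have mG: "measured_group G m" by (rule measured_group_haar[OF assms(1,2,6)])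
  have mQ: "measured_group ?Q n" by (rule measured_group_haar[OF lcQ scQ assms(7)])
  have sm: "sets m = sets (borel_of T)" and sn: "sets n = sets (borel_of ?TQ)"
    using assms(6,7) by (auto simp: haar_measure_def)
  have ts: "topspace T = carrier G"
    using assms(1) by (simp add: locally_compact_group_def topological_group_def)
  have "?q \<in> m \<rightarrow>\<^sub>M n"
    using continuous_map_measurable[OF quotient_imp_continuous_map[OF quotient_map_coset_topology[OF ts]]]
    by (simp add: measurable_cong_sets[OF sm sn])
  then interpret measured_hom G m ?Q n ?q
    by (intro measured_hom.intro measured_hom_axioms.intro mG mQ normal.r_coset_hom_Mod assms(4))
  have surj: "?q ` carrier G = carrier ?Q" by (simp add: carrier_FactGroup)
  have E': "closedin T ?E" using assms(9) by (simp add: M0_set_def)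
  obtain S where S: "S \<in> conv_op G T m ` measures_on T ?E" "S \<in> reduced_cstar G T m" "S \<noteq> op_zero m"
    using assms(9) op_zero_in_reduced_cstar[OF mG sm, of ?E]
    unfolding M0_set_def extended_uniqueness_set_def by blast
  then obtain \<mu> where \<mu>: "\<mu> \<in> measures_on T ?E" "S = conv_op G T m \<mu>" by blast
  have "complex_measure m \<mu>"
    using \<mu>(1) sm by (simp add: measures_on_def complex_measure_def)
  then obtain P \<theta> where P: "finite_measure P" "sets P = sets m" and \<theta>: "\<theta> \<in> borel_measurable P"
    "\<And>x. cmod (\<theta> x) \<le> 1" and \<mu>_eq: "\<mu> = weighted_image P (\<lambda>x. x) \<theta> m"
    by (rule complex_measure_representation) (rule that; assumption)
  have id: "(\<lambda>x. x) \<in> P \<rightarrow>\<^sub>M m" by (simp add: measurable_ident_sets P(2))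
  \<comment> \<open>Otherwise \<open>S\<close> would send every class to zero. Off
    \<open>L2 m\<close> both operators have the default value of a restricted function, so they
    would be equal.\<close>
  have "\<exists>\<xi>\<in>L2_fun m. \<not> (AE g in m. G.wconv P (\<lambda>x. x) \<theta> \<xi> g = 0)"
  proof (rule ccontr)
    assume no: "\<not> ?thesis"
    have "S c = op_zero m c" for c
    proof (cases "c \<in> L2 m")
      case True
      then obtain \<xi> where \<xi>: "\<xi> \<in> L2_fun m" "c = L2_class m \<xi>" by (auto simp: L2_def)
      have "S c = L2_class m (G.wconv P (\<lambda>x. x) \<theta> \<xi>)"
        unfolding \<mu>(2) \<mu>_eq \<xi>(2) by (rule G.conv_op_weighted_image[OF P(1) id \<theta> \<xi>(1) sm])
      also have "\<dots> = L2_zero m"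
        unfolding L2_zero_def using no \<xi>(1) by (intro L2_class_cong_AE) blast
      finally show ?thesis using True by (simp add: op_zero_def)
    qed (simp add: \<mu>(2) conv_op_def op_zero_def)
    then show False using S(3) by blast
  qed
  then obtain \<xi> where \<xi>: "\<xi> \<in> L2_fun m" and nz: "\<not> (AE g in m. G.wconv P (\<lambda>x. x) \<theta> \<xi> g = 0)"
    by blast
  define \<eta> where "\<eta> = G.wconv P (\<lambda>x. x) \<theta> \<xi>"
  have \<eta>: "\<eta> \<in> L2_fun m" unfolding \<eta>_def by (rule G.wconv_L2[OF P(1) id \<theta> \<xi>])
  let ?u = "G.coefficient \<xi> \<eta>"
  define \<nu> where "\<nu> = weighted_image P ?q (\<lambda>s. \<theta> s * ?u s) n"
  note um = G.coefficient_measurable[OF L2_fun_measurable[OF \<xi>] L2_fun_measurable[OF \<eta>]]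
  note ub = G.norm_coefficient_le[OF \<xi> \<eta>]
  have \<nu>_on: "\<nu> \<in> measures_on ?TQ E"
    unfolding \<nu>_def using \<mu>(1) unfolding \<mu>_eq
    by (rule measures_on_push[OF assms(2) sm sn assms(8) E' P \<theta> um ub])
  have \<nu>_red: "conv_op ?Q ?TQ n \<nu> \<in> reduced_cstar ?Q ?TQ n"
    unfolding \<nu>_def using S(2) unfolding \<mu>(2) \<mu>_eq
    by (rule reduced_cstar_push[OF surj sm sn P \<theta> \<xi> \<eta>])
  have "conv_op ?Q ?TQ n \<nu> \<noteq> op_zero n"
  proof
    assume zero: "conv_op ?Q ?TQ n \<nu> = op_zero n"
    have qP: "?q \<in> P \<rightarrow>\<^sub>M n" using q_measurable by (simp add: measurable_cong_sets[OF P(2) refl])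
    have um': "?u \<in> borel_measurable P" using um by (simp add: measurable_cong_sets[OF P(2) refl])
    have wm: "(\<lambda>s. \<theta> s * ?u s) \<in> borel_measurable P" using \<theta>(1) um' by simp
    have wb: "cmod (\<theta> s * ?u s) \<le> G.coefficient_bound \<xi> \<eta>" for s
      using mult_mono[OF \<theta>(2)[of s] ub[of s]] by (simp add: norm_mult)
    have "(\<integral>s. \<theta> s * ?u s \<partial>P) = 0"
    proof (rule Q.integral_weight_eq_0[OF P(1) qP wm wb])
      fix a assume a: "a \<in> L2_fun n"
      have "L2_class n (Q.wconv P ?q (\<lambda>s. \<theta> s * ?u s) a) = conv_op ?Q ?TQ n \<nu> (L2_class n a)"
        unfolding \<nu>_def by (rule Q.conv_op_weighted_image[OF P(1) qP wm wb a sn, symmetric])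
      also have "\<dots> = L2_class n (\<lambda>x. 0)"
        unfolding zero using L2_class_in_L2[OF a] by (simp add: op_zero_def L2_zero_def)
      finally show "AE y in n. Q.wconv P ?q (\<lambda>s. \<theta> s * ?u s) a y = 0"
        by (rule L2_class_eqD) (rule Q.wconv_L2[OF P(1) qP wm wb a])
    qed
    moreover have "(\<integral>s. \<theta> s * ?u s \<partial>P) \<noteq> 0"
      unfolding \<eta>_def by (rule G.integral_coefficient_wconv[OF P \<theta> \<xi> nz])
    ultimately show False by simp
  qed
  \<comment> \<open>The operator of \<nu> is a member of the intersection other than
    \<open>op_zero n\<close>, so the intersection is not \<open>{op_zero n}\<close>.\<close>
  then show ?thesis
    using \<nu>_on \<nu>_red assms(8) unfolding M0_set_def extended_uniqueness_set_def by blast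
qed

end
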